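(* Let $\nu>0$, let $\mathcal{P}$ be the set of probability measures on $\mathbb{R}^2$, and for $(s,\zeta)\in[0,\infty)\times\mathcal{P}$ let $\mathbb{P}_{s,\zeta}$ be the path law on $\Omega_s=C([s,\infty);\mathbb{R}^2)$ of the probabilistically weak solution $X(\cdot,s,\zeta)$ described in the context. Then $(\mathbb{P}_{s,\zeta})_{(s,\zeta)\in[0,\infty)\times\mathcal{P}}$ is a nonlinear Markov process with $\mathcal{P}_0=\mathcal{P}$, i.e.: (i) for all $0\le s\le t$ and $\zeta\in\mathcal{P}$, $\mu^{s,\zeta}_t:=\mathbb{P}_{s,\zeta}\circ(\pi^s_t)^{-1}\in\mathcal{P}$; (ii) for all $0\le s\le r\le t$, $\zeta\in\mathcal{P}$ and $A\in\mathcal{B}(\mathbb{R}^2)$, $$\mathbb{P}_{s,\zeta}(\pi^s_t\in A\mid\mathcal{F}_{s,r})(\cdot)=p_{(s,\zeta),(r,\pi^s_r(\cdot))}(\pi^r_t\in A)\quad\mathbb{P}_{s,\zeta}\text{-a.s.},$$ where $p_{(s,\zeta),(r,y)}$, $y\in\mathbb{R}^2$, is a regular conditional probability kernel from $\mathbb{R}^2$ to $\mathcal{B}(\Omega_r)$ of $\mathbb{P}_{r,\mu^{s,\zeta}_r}[\,\cdot\mid\pi^r_r=y]$ (in particular $p_{(s,\zeta),(r,y)}$ is a probability measure on $\Omega_r$ with $p_{(s,\zeta),(r,y)}(\pi^r_r=y)=1$).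
   Context: The Biot–Savart kernel is $k(x)=\frac{(-x_2,x_1)}{2\pi|x|^2}$, $x\ne0$, $K(z)=k*z$. For $(s,\zeta)\in[0,\infty)\times\mathcal{P}$, $\mu^{s,\zeta}=(\mu^{s,\zeta}_t)_{t\ge s}$ denotes the narrowly continuous version of the solution of the vorticity equation $u_t-\nu\Delta u+\operatorname{div}(uK(u))=0$ on $(s,\infty)\times\mathbb{R}^2$ with $u(s)=\zeta$ given by the Giga–Miyakawa–Osada construction (extended by later work to all finite measure initial data; it is a mild and distributional solution with $|u(t)|_{L^r}\le C_r(t-s)^{-1+1/r}$), and $X(\cdot,s,\zeta)$, defined on a stochastic basis $(\Omega^{s,\zeta},\mathcal{F}^{s,\zeta},(\mathcal{F}^{s,\zeta}_t)_{t\ge s},\mathbb{P}^{s,\zeta})$ with a 2-dimensional Brownian motion $W$, is a probabilistically weak solution of $dX(t)=K(\mu^{s,\zeta}_t)(X(t))\,dt+\sqrt{2\nu}\,dW(t)$, $t\ge s$, with $\mathbb{P}^{s,\zeta}\circ X(t,s,\zeta)^{-1}=\mu^{s,\zeta}_t$ for $t\ge s$; $\mathbb{P}_{s,\zeta}:=\mathbb{P}^{s,\zeta}\circ X(\cdot,s,\zeta)^{-1}$. $\Omega_s=C([s,\infty);\mathbb{R}^2)$ carries the topology of locally uniform convergence and its Borel $\sigma$-algebra $\mathcal{B}(\Omega_s)$; $\pi^s_\tau(w)=w(\tau)$ for $\tau\ge s$, and $\mathcal{F}_{s,r}=\sigma(\pi^s_\tau:s\le\tau\le r)$. *)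

theory Defs
  imports "HOL-Analysis.Analysis" "HOL-Probability.Probability"
begin

definition Prob2 :: "(real^2) measure set" where
  "Prob2 = {\<mu>. prob_space \<mu> \<and> sets \<mu> = sets borel}"

text \<open>k(x) = (-x2, x1) / (2 pi |x|^2) for x nonzero; the value at 0 is irrelevant (set to 0).\<close>
definition bs_k :: "real^2 \<Rightarrow> real^2" where
  "bs_k x = (if x = 0 then 0
     else (1 / (2 * pi * (norm x)^2)) *\<^sub>R (\<chi> i. if i = 1 then - (x $ 2) else x $ 1))"

definition bs_K :: "(real^2) measure \<Rightarrow> real^2 \<Rightarrow> real^2" where
  "bs_K z x = (\<integral>y. bs_k (x - y) \<partial>z)"

definition test_fun ::
  "(real^2 \<Rightarrow> real) \<Rightarrow> (real^2 \<Rightarrow> real^2) \<Rightarrow> (real^2 \<Rightarrow> real^2^2) \<Rightarrow> bool" where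
  "test_fun \<phi> D\<phi> H\<phi> \<longleftrightarrow>
     (\<forall>x. (\<phi> has_derivative (\<lambda>h. D\<phi> x \<bullet> h)) (at x)) \<and>
     (\<forall>x. (D\<phi> has_derivative (\<lambda>h. H\<phi> x *v h)) (at x)) \<and>
     continuous_on UNIV H\<phi> \<and>
     compact (closure {x. \<phi> x \<noteq> 0})"

definition laplacian_of :: "(real^2 \<Rightarrow> real^2^2) \<Rightarrow> real^2 \<Rightarrow> real" where
  "laplacian_of H\<phi> x = H\<phi> x $ 1 $ 1 + H\<phi> x $ 2 $ 2"

text \<open>mu :: real => measure is a narrowly continuous curve of probability measures on
  [s,oo) starting at zeta, having for t > s a density u(t) with
  |u(t)|_{L^r} <= C_r (t-s)^{-1+1/r} (1 <= r <= oo), and solving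
  u_t - nu Lap u + div(u K(u)) = 0 in the distributional (weak, time-integrated) sense.\<close>
definition vorticity_solution ::
  "real \<Rightarrow> real \<Rightarrow> (real^2) measure \<Rightarrow> (real \<Rightarrow> (real^2) measure) \<Rightarrow> bool" where
  "vorticity_solution \<nu> s \<zeta> \<mu> \<longleftrightarrow>
     (\<forall>t\<ge>s. \<mu> t \<in> Prob2) \<and>
     \<mu> s = \<zeta> \<and>
     (\<forall>f::real^2 \<Rightarrow> real. continuous_on UNIV f \<and> bounded (range f) \<longrightarrow>
        continuous_on {s..} (\<lambda>t. \<integral>x. f x \<partial>\<mu> t)) \<and>
     (\<exists>u :: real \<Rightarrow> real^2 \<Rightarrow> real.
        (\<forall>t>s. u t \<in> borel_measurable borel \<and> (\<forall>x. 0 \<le> u t x) \<and>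
               \<mu> t = density lborel (\<lambda>x. ennreal (u t x))) \<and>
        (\<forall>r::real. 1 \<le> r \<longrightarrow> (\<exists>C. \<forall>t>s.
            (\<integral>x. \<bar>u t x\<bar> powr r \<partial>lborel) powr (1 / r) \<le> C * (t - s) powr (-1 + 1 / r))) \<and>
        (\<exists>C. \<forall>t>s. AE x in lborel. \<bar>u t x\<bar> \<le> C * (t - s) powr (-1))) \<and>
     (\<forall>\<phi> D\<phi> H\<phi> \<tau> t. test_fun \<phi> D\<phi> H\<phi> \<and> s \<le> \<tau> \<and> \<tau> \<le> t \<longrightarrow>
        set_integrable lborel {\<tau>..t}
          (\<lambda>r. \<integral>x. \<nu> * laplacian_of H\<phi> x + bs_K (\<mu> r) x \<bullet> D\<phi> x \<partial>\<mu> r) \<and>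
        (\<integral>x. \<phi> x \<partial>\<mu> t) - (\<integral>x. \<phi> x \<partial>\<mu> \<tau>) =
          (LINT r:{\<tau>..t}|lborel. \<integral>x. \<nu> * laplacian_of H\<phi> x + bs_K (\<mu> r) x \<bullet> D\<phi> x \<partial>\<mu> r))"

text \<open>Omega_s = C([s,oo);R^2); a path is represented by a function on all of R that is
  continuous on [s,oo) and frozen (equal to w(s)) on (-oo,s).\<close>
definition Omega :: "real \<Rightarrow> (real \<Rightarrow> real^2) set" where
  "Omega s = {w. continuous_on {s..} w \<and> (\<forall>t<s. w t = w s)}"

text \<open>Borel sigma-algebra of Omega_s (locally uniform topology) = sigma-algebra generated by
  the coordinate maps pi^s_tau, tau >= s.\<close>
definition Omega_space :: "real \<Rightarrow> (real \<Rightarrow> real^2) measure" where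
  "Omega_space s = sigma (Omega s)
     {{w \<in> Omega s. w \<tau> \<in> B} | \<tau> B. s \<le> \<tau> \<and> B \<in> sets (borel :: (real^2) measure)}"

definition F_sr :: "real \<Rightarrow> real \<Rightarrow> (real \<Rightarrow> real^2) measure" where
  "F_sr s r = sigma (Omega s)
     {{w \<in> Omega s. w \<tau> \<in> B} | \<tau> B. s \<le> \<tau> \<and> \<tau> \<le> r \<and> B \<in> sets (borel :: (real^2) measure)}"

definition path_of :: "real \<Rightarrow> (real \<Rightarrow> 'a \<Rightarrow> real^2) \<Rightarrow> 'a \<Rightarrow> (real \<Rightarrow> real^2)" where
  "path_of s X \<omega> = (\<lambda>t. if s \<le> t then X t \<omega> else X s \<omega>)"

definition gauss2 :: "real \<Rightarrow> (real^2) measure" where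
  "gauss2 v = density lborel (\<lambda>x. ennreal (exp (- (norm x * norm x) / (2 * v)) / (2 * pi * v)))"

definition weak_solution ::
  "real \<Rightarrow> real \<Rightarrow> (real \<Rightarrow> (real^2) measure) \<Rightarrow> 'a measure \<Rightarrow> (real \<Rightarrow> 'a measure)
     \<Rightarrow> (real \<Rightarrow> 'a \<Rightarrow> real^2) \<Rightarrow> (real \<Rightarrow> 'a \<Rightarrow> real^2) \<Rightarrow> bool" where
  "weak_solution \<nu> s \<mu> M Fl W X \<longleftrightarrow>
     prob_space M \<and>
     (\<forall>t\<ge>s. subalgebra M (Fl t)) \<and>
     (\<forall>r t. s \<le> r \<and> r \<le> t \<longrightarrow> sets (Fl r) \<subseteq> sets (Fl t)) \<and>
     \<comment> \<open>W is a 2-dimensional (Fl)-Brownian motion on [s,oo)\<close>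
     (\<forall>t\<ge>s. W t \<in> borel_measurable (Fl t)) \<and>
     (\<forall>\<omega>\<in>space M. continuous_on {s..} (\<lambda>t. W t \<omega>)) \<and>
     (AE \<omega> in M. W s \<omega> = 0) \<and>
     (\<forall>r t. s \<le> r \<and> r < t \<longrightarrow>
        distr M borel (\<lambda>\<omega>. W t \<omega> - W r \<omega>) = gauss2 (t - r) \<and>
        (\<forall>A\<in>sets (Fl r). \<forall>B\<in>sets (borel :: (real^2) measure).
           measure M (A \<inter> {\<omega>\<in>space M. W t \<omega> - W r \<omega> \<in> B}) =
           measure M A * measure M {\<omega>\<in>space M. W t \<omega> - W r \<omega> \<in> B})) \<and>
     \<comment> \<open>X is continuous, adapted and solves the SDE\<close>
     (\<forall>t\<ge>s. X t \<in> borel_measurable (Fl t)) \<and>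
     (\<forall>\<omega>\<in>space M. continuous_on {s..} (\<lambda>t. X t \<omega>)) \<and>
     (AE \<omega> in M. \<forall>t\<ge>s.
        set_integrable lborel {s..t} (\<lambda>\<tau>. bs_K (\<mu> \<tau>) (X \<tau> \<omega>)) \<and>
        X t \<omega> = X s \<omega> + (LINT \<tau>:{s..t}|lborel. bs_K (\<mu> \<tau>) (X \<tau> \<omega>))
                 + sqrt (2 * \<nu>) *\<^sub>R (W t \<omega> - W s \<omega>))"

definition marg :: "(real \<Rightarrow> (real^2) measure \<Rightarrow> (real \<Rightarrow> real^2) measure)
    \<Rightarrow> real \<Rightarrow> (real^2) measure \<Rightarrow> real \<Rightarrow> (real^2) measure" where
  "marg Pl s \<zeta> t = distr (Pl s \<zeta>) borel (\<lambda>w. w t)"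

definition rcp_kernel ::
  "(real \<Rightarrow> real^2) measure \<Rightarrow> real \<Rightarrow> (real^2 \<Rightarrow> (real \<Rightarrow> real^2) measure) \<Rightarrow> bool" where
  "rcp_kernel Q r p \<longleftrightarrow>
     (\<forall>y. prob_space (p y) \<and> sets (p y) = sets (Omega_space r)) \<and>
     (\<forall>y. emeasure (p y) {w \<in> Omega r. w r = y} = 1) \<and>
     (\<forall>B\<in>sets (Omega_space r). (\<lambda>y. emeasure (p y) B) \<in> borel_measurable borel) \<and>
     (\<forall>B\<in>sets (Omega_space r). \<forall>A\<in>sets (borel :: (real^2) measure).
        emeasure Q (B \<inter> {w \<in> Omega r. w r \<in> A}) =
        (\<integral>\<^sup>+ y. indicator A y * emeasure (p y) B \<partial>(distr Q borel (\<lambda>w. w r))))"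

definition nonlinear_markov ::
  "(real \<Rightarrow> (real^2) measure \<Rightarrow> (real \<Rightarrow> real^2) measure) \<Rightarrow> (real^2) measure set \<Rightarrow> bool" where
  "nonlinear_markov Pl P0 \<longleftrightarrow>
     P0 \<subseteq> Prob2 \<and>
     (\<forall>s\<ge>0. \<forall>\<zeta>\<in>P0. prob_space (Pl s \<zeta>) \<and> sets (Pl s \<zeta>) = sets (Omega_space s)) \<and>
     (\<forall>s t \<zeta>. 0 \<le> s \<and> s \<le> t \<and> \<zeta> \<in> P0 \<longrightarrow> marg Pl s \<zeta> t \<in> P0) \<and>
     (\<forall>s r t \<zeta> A. 0 \<le> s \<and> s \<le> r \<and> r \<le> t \<and> \<zeta> \<in> P0 \<and> A \<in> sets (borel :: (real^2) measure) \<longrightarrow>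
        (\<exists>p. rcp_kernel (Pl r (marg Pl s \<zeta> r)) r p) \<and>
        (\<forall>p. rcp_kernel (Pl r (marg Pl s \<zeta> r)) r p \<longrightarrow>
           (AE w in Pl s \<zeta>.
              real_cond_exp (Pl s \<zeta>) (F_sr s r) (indicator {w' \<in> Omega s. w' t \<in> A}) w =
              measure (p (w r)) {w' \<in> Omega r. w' t \<in> A})))"

end

theory Submission
  imports Defs
begin

text \<open>
  Let \<open>X\<close> solve the SDE, let \<open>\<phi>\<close> be a test function and put \<open>Y t = X t + sqrt (2 * \<nu>) *\<^sub>R (W T - W t)\<close>. Then
  \<open>Y t\<close> equals \<open>X T\<close> minus the drift integrated over \<open>{t..T}\<close>, hence is absolutely continuous in \<open>t\<close>, and the
  ordinary chain rule together with the independence of \<open>W T - W t\<close> from the past yields a mild (Duhamel) formula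
  for the laws of \<open>X\<close>, also when they are weighted by a density depending on the past only; no stochastic
  integration is needed. The heat semigroup gains a factor \<open>1 / sqrt (T - t)\<close> for the gradient, so mild solutions
  with bounded drift are unique by contraction in total variation.

  For \<open>r > s\<close> the solution restarted at time \<open>r\<close> from the (bounded) density at time \<open>r\<close> has a drift that is only known to be
  \<open>O(1 / sqrt (t - r))\<close>, which is critical for the contraction. It is in fact \<open>o(1 / sqrt (t - r))\<close>: up to a
  displacement \<open>O(sqrt (t - r))\<close> the particle performs a free Brownian motion, which preserves the density bound,
  so balls of radius of order \<open>sqrt (t - r)\<close> carry mass \<open>O(t - r)\<close>. This gives the flow property; uniqueness for the
  linear equation, applied to the laws weighted by events of the past, then gives the Markov property. For \<open>r = s\<close>
  the Markov property is the definition of the kernel.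
\<close>

section \<open>The Biot--Savart kernel\<close>

text \<open>The hypotheses give one curve \<open>mu s \<zeta>\<close> for each pair and no
  uniqueness, so the curve restarted at \<open>r\<close> could a priori leave the old one. The
  initial measure may be a point mass; laws are therefore compared from \<open>r > s\<close> on,
  where the density is at most C / (r - s).

  Why the order 1 / sqrt (t - r) is critical: the integral of 1 / sqrt (\<tau> - r) times the
  smoothing factor 1 / sqrt (T - \<tau>) over [r, T] does not depend on T - r. A shorter interval
  gains nothing; only a small constant in front does, and the ball estimate provides it.

  Total variation is the right distance for two reasons: the gradient bound of the heat semigroup
  depends on sup |\<phi>| alone, and the quadratic drift term splits, by Fubini, into bounded
  functions integrated against the difference of the two laws.

  Weights turn uniqueness of one-time laws into a statement about the past: an event of the past is
  replaced by its conditional probability given the position at \<open>r\<close>, which the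
  restarted process can see.\<close>

lemma bs_k_alt: "bs_k x = (1 / (2 * pi * (norm x)\<^sup>2)) *\<^sub>R (\<chi> i. if i = 1 then - (x $ 2) else x $ 1)"
  by (simp add: bs_k_def)

text \<open>Rotation by a right angle preserves length. At the origin both sides are 0, since
  division by 0 yields 0; this spares a case distinction on \<open>x\<close> everywhere
  below.\<close>

lemma norm_bs_k: "norm (bs_k x) = 1 / (2 * pi * norm x)"
proof -
  have "norm ((\<chi> i. if i = 1 then - (x $ 2) else x $ 1) :: real^2) = norm x"
    by (simp add: norm_eq_sqrt_inner inner_vec_def UNIV_2 add.commute)
  then show ?thesis
    unfolding bs_k_alt by (simp add: power2_eq_square)
qed

lemma borel_measurable_bs_k [measurable]: "bs_k \<in> borel_measurable borel"
proof -
  have "continuous_on UNIV (\<lambda>x::real^2. (\<chi> i. if i = 1 then - (x $ 2) else x $ 1) :: real^2)"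
  proof (intro continuous_on_vec_lambda)
    show "continuous_on UNIV (\<lambda>x::real^2. if i = 1 then - (x $ 2) else x $ 1)" for i :: 2
      by (cases "i = 1") (auto intro!: continuous_intros)
  qed
  then have [measurable]:
    "(\<lambda>x::real^2. (\<chi> i. if i = 1 then - (x $ 2) else x $ 1) :: real^2) \<in> borel_measurable borel"
    by (rule borel_measurable_continuous_onI)
  have eq: "bs_k = (\<lambda>x. (1 / (2 * pi * (norm x)\<^sup>2)) *\<^sub>R (\<chi> i. if i = 1 then - (x $ 2) else x $ 1))"
    by (rule ext) (rule bs_k_alt)
  show ?thesis by (subst eq) measurable
qed

text \<open>Integral of the norm of \<open>bs_k\<close>, as an extended nonnegative number, so that
  it is meaningful before integrability is known. It sees only the distance of x and y and therefore
  also controls the reflected kernel that appears after exchanging integrals.\<close>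

definition bs_potential :: "(real^2) measure \<Rightarrow> real^2 \<Rightarrow> ennreal" where
  "bs_potential \<mu> x = (\<integral>\<^sup>+y. ennreal (1 / (2 * pi * norm (x - y))) \<partial>\<mu>)"

text \<open>Dyadic shells: the ball of radius R / 2^k carries the weight 2^(k+1) / (2 pi R) and
  contributes R / 2^k. The exact value is R; the factor 2 is the sum of the geometric
  series.\<close>

lemma nn_integral_inverse_norm_cball:
  fixes x :: "real^2"
  assumes R: "0 < R"
  shows "(\<integral>\<^sup>+y. ennreal (1 / (2 * pi * norm (x - y))) * indicator (cball x R) y \<partial>lborel) \<le> ennreal (2 * R)"
proof -
  have [measurable]: "cball x r \<in> sets borel" for r by (simp add: borel_closed)
  let ?f = "\<lambda>k y. ennreal (2 ^ Suc k / (2 * pi * R)) * indicator (cball x (R / 2 ^ k)) y"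
  have "ennreal (1 / (2 * pi * norm (x - y))) * indicator (cball x R) y \<le> (\<Sum>k. ?f k y)" for y
  proof (cases "y = x \<or> y \<notin> cball x R")
    case False
    define n where "n = norm (x - y)"
    have n: "0 < n" "n \<le> R" using False by (auto simp: n_def dist_norm)
    obtain j where "(1/2::real) ^ j < n / R"
      using real_arch_pow_inv[of "n / R" "1/2"] n R by auto
    then have j: "R / 2 ^ j < n" using R by (simp add: field_simps power_divide)
    \<comment> \<open>The shell R / 2^(k+1) < n <= R / 2^k that contains y. Minimality of k gives
      the upper bound; for k = 0 membership in the ball does.\<close>
    define k where "k = (LEAST k. R / 2 ^ Suc k < n)"
    have "R / 2 ^ Suc j < n" using j R by (smt (verit) divide_strict_left_mono power_strict_increasing_iff lessI zero_less_power mult_pos_pos)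
    then have k1: "R / 2 ^ Suc k < n" unfolding k_def by (rule LeastI)
    have k2: "n \<le> R / 2 ^ k"
    proof (cases k)
      case 0 then show ?thesis using n by simp
    next
      case (Suc l)
      then have "\<not> (R / 2 ^ Suc l < n)" using not_less_Least[of l "\<lambda>k. R / 2 ^ Suc k < n"] k_def by simp
      then show ?thesis using Suc by simp
    qed
    have "1 / (2 * pi * n) \<le> 2 ^ Suc k / (2 * pi * R)"
      using k1 R n by (simp add: field_simps)
    then have "ennreal (1 / (2 * pi * norm (x - y))) * indicator (cball x R) y \<le> ?f k y"
      using False k2 by (auto simp: n_def dist_norm intro!: ennreal_leI)
    also have "\<dots> \<le> (\<Sum>k. ?f k y)"
      using sum_le_suminf[of "\<lambda>k. ?f k y" "{k}"] by (simp only: summableI sum.insert finite.intros empty_iff not_False_eq_True sum.empty add_0_right zero_le)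
    finally show ?thesis .
  qed auto
  then have "(\<integral>\<^sup>+y. ennreal (1 / (2 * pi * norm (x - y))) * indicator (cball x R) y \<partial>lborel)
      \<le> (\<integral>\<^sup>+y. (\<Sum>k. ?f k y) \<partial>lborel)"
    by (intro nn_integral_mono)
  also have "\<dots> = (\<Sum>k. \<integral>\<^sup>+y. ?f k y \<partial>lborel)"
    by (rule nn_integral_suminf) measurable
  also have "\<dots> = (\<Sum>k. ennreal (R * (1/2) ^ k))"
  proof (rule suminf_cong)
    fix k
    have "(\<integral>\<^sup>+y. ?f k y \<partial>lborel) = ennreal (2 ^ Suc k / (2 * pi * R)) * emeasure lborel (cball x (R / 2 ^ k))"
      by (rule nn_integral_cmult_indicator) simp
    also have "\<dots> = ennreal (2 ^ Suc k / (2 * pi * R)) * ennreal (pi * (R / 2 ^ k)\<^sup>2)"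
      using R by (subst emeasure_cball) (auto simp: unit_ball_vol_2)
    also have "\<dots> = ennreal (R * (1/2) ^ k)"
      using R by (subst ennreal_mult[symmetric]) (auto simp: field_simps power2_eq_square power_divide)
    finally show "(\<integral>\<^sup>+y. ?f k y \<partial>lborel) = ennreal (R * (1/2) ^ k)" .
  qed
  also have "\<dots> = ennreal (2 * R)"
    using R sums_mult[OF geometric_sums[of "1/2::real"], of R]
    by (intro suminf_ennreal_eq) (auto simp: mult.commute)
  finally show ?thesis .
qed

text \<open>Three zones: within \<open>\<epsilon>\<close> the density bound tames the singularity,
  up to \<open>R\<close> only the mass \<open>m\<close> of the ball counts, beyond \<open>R\<close>
  the kernel is at most 1 / (2 pi R) against total mass 1. Keeping \<open>m\<close> separate yields
  smallness later, when balls carry little mass.\<close>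

lemma bs_potential_le:
  fixes x :: "real^2" and u :: "real^2 \<Rightarrow> real"
  assumes \<mu>: "\<mu> = density lborel (\<lambda>x. ennreal (u x))" and [measurable]: "u \<in> borel_measurable borel"
    and u: "AE x in lborel. u x \<le> \<Lambda>" and P: "prob_space \<mu>" and "0 \<le> \<Lambda>"
    and \<epsilon>: "0 < \<epsilon>" "\<epsilon> \<le> R" and m: "emeasure \<mu> (cball x R) \<le> ennreal m" "0 \<le> m"
  shows "bs_potential \<mu> x \<le> ennreal (2 * \<Lambda> * \<epsilon> + m / (2 * pi * \<epsilon>) + 1 / (2 * pi * R))"
proof -
  interpret prob_space \<mu> by fact
  have [simp, measurable_cong]: "sets \<mu> = sets borel" by (simp add: \<mu>)
  have [measurable]: "cball x r \<in> sets borel" for r by (simp add: borel_closed)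
  let ?k = "\<lambda>y. 1 / (2 * pi * norm (x - y))"
  let ?a = "\<lambda>y. ennreal (?k y) * indicator (cball x \<epsilon>) y"
  let ?b = "\<lambda>y. ennreal (1 / (2 * pi * \<epsilon>)) * indicator (cball x R) y"
  have "ennreal (?k y) \<le> ?a y + ?b y + ennreal (1 / (2 * pi * R))" for y
  proof -
    consider "y \<in> cball x \<epsilon>" | "y \<notin> cball x \<epsilon>" "y \<in> cball x R" | "y \<notin> cball x R" by blast
    then show ?thesis
    proof cases
      case 1 then show ?thesis by (simp add: add.assoc)
    next
      case 2
      then have "ennreal (?k y) \<le> ennreal (1 / (2 * pi * \<epsilon>))"
        using \<epsilon> by (intro ennreal_leI divide_left_mono) (auto simp: dist_norm intro!: mult_pos_pos)
      also have "\<dots> \<le> ?a y + ?b y + ennreal (1 / (2 * pi * R))" using 2 by simp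
      finally show ?thesis .
    next
      case 3
      then have "ennreal (?k y) \<le> ennreal (1 / (2 * pi * R))"
        using \<epsilon> by (intro ennreal_leI divide_left_mono) (auto simp: dist_norm intro!: mult_pos_pos)
      then show ?thesis by (simp add: add_increasing)
    qed
  qed
  then have le: "bs_potential \<mu> x \<le> (\<integral>\<^sup>+y. ?a y + ?b y + ennreal (1 / (2 * pi * R)) \<partial>\<mu>)"
    unfolding bs_potential_def by (intro nn_integral_mono)
  have split: "(\<integral>\<^sup>+y. ?a y + ?b y + ennreal (1 / (2 * pi * R)) \<partial>\<mu>) =
    (\<integral>\<^sup>+y. ?a y \<partial>\<mu>) + (\<integral>\<^sup>+y. ?b y \<partial>\<mu>) + ennreal (1 / (2 * pi * R))"
  proof -
    have 1: "?a \<in> borel_measurable \<mu>"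
      by measurable
    have 2: "?b \<in> borel_measurable \<mu>"
      by measurable
    have 3: "(\<lambda>y. ?a y + ?b y) \<in> borel_measurable \<mu>" by measurable
    have "(\<integral>\<^sup>+y. ?a y + ?b y + ennreal (1 / (2 * pi * R)) \<partial>\<mu>) =
      (\<integral>\<^sup>+y. ?a y + ?b y \<partial>\<mu>) + (\<integral>\<^sup>+y. ennreal (1 / (2 * pi * R)) \<partial>\<mu>)"
      by (rule nn_integral_add[OF 3]) simp
    also have "(\<integral>\<^sup>+y. ?a y + ?b y \<partial>\<mu>) = (\<integral>\<^sup>+y. ?a y \<partial>\<mu>) + (\<integral>\<^sup>+y. ?b y \<partial>\<mu>)"
      by (rule nn_integral_add[OF 1 2])
    finally show ?thesis by (simp only: nn_integral_const emeasure_space_1 mult_1_right)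
  qed
  have "(\<integral>\<^sup>+y. ?b y \<partial>\<mu>) = ennreal (1 / (2 * pi * \<epsilon>)) * emeasure \<mu> (cball x R)"
    by (rule nn_integral_cmult_indicator) simp
  also have "\<dots> \<le> ennreal (1 / (2 * pi * \<epsilon>)) * ennreal m"
    by (intro mult_left_mono m) simp
  also have "\<dots> = ennreal (m / (2 * pi * \<epsilon>))"
    using \<epsilon> m by (subst ennreal_mult[symmetric]) auto
  finally have b: "(\<integral>\<^sup>+y. ?b y \<partial>\<mu>) \<le> ennreal (m / (2 * pi * \<epsilon>))" .
  have "(\<integral>\<^sup>+y. ?a y \<partial>\<mu>) = (\<integral>\<^sup>+y. ennreal (u y) * ?a y \<partial>lborel)"
    unfolding \<mu> by (rule nn_integral_density) measurable
  also have "\<dots> \<le> (\<integral>\<^sup>+y. ennreal \<Lambda> * ?a y \<partial>lborel)"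
    using u by (intro nn_integral_mono_AE) (auto elim!: eventually_mono intro!: mult_right_mono ennreal_leI)
  also have "\<dots> = ennreal \<Lambda> * (\<integral>\<^sup>+y. ?a y \<partial>lborel)"
    by (rule nn_integral_cmult) measurable
  also have "\<dots> \<le> ennreal \<Lambda> * ennreal (2 * \<epsilon>)"
    by (intro mult_left_mono nn_integral_inverse_norm_cball \<epsilon>) simp
  also have "\<dots> = ennreal (2 * \<Lambda> * \<epsilon>)"
    using \<epsilon> \<open>0 \<le> \<Lambda>\<close> by (subst ennreal_mult[symmetric]) (auto simp: ac_simps)
  finally have "(\<integral>\<^sup>+y. ?a y \<partial>\<mu>) \<le> ennreal (2 * \<Lambda> * \<epsilon>)" .
  with b have "bs_potential \<mu> x \<le> ennreal (2 * \<Lambda> * \<epsilon>) + ennreal (m / (2 * pi * \<epsilon>)) + ennreal (1 / (2 * pi * R))"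
    by (intro order_trans[OF le[unfolded split]] add_mono) auto
  also have "\<dots> = ennreal (2 * \<Lambda> * \<epsilon> + m / (2 * pi * \<epsilon>) + 1 / (2 * pi * R))"
    using \<epsilon> m \<open>0 \<le> \<Lambda>\<close> by (subst ennreal_plus[symmetric], simp, simp)+ simp
  finally show ?thesis .
qed

lemma bs_potential_le_sqrt:
  fixes u :: "real^2 \<Rightarrow> real"
  assumes \<mu>: "\<mu> = density lborel (\<lambda>x. ennreal (u x))" and u: "u \<in> borel_measurable borel"
    "AE x in lborel. u x \<le> \<Lambda>" and P: "prob_space \<mu>" and \<Lambda>: "0 < \<Lambda>"
  shows "bs_potential \<mu> x \<le> ennreal (3 * sqrt \<Lambda>)"
proof -
  interpret prob_space \<mu> by fact
  \<comment> \<open>The radius at which density term and mass term are of equal order. Both radii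
    are set to it and \<open>m\<close> to 1; the sum (2 + 1 / pi) sqrt \<Lambda> is rounded up to 3
    sqrt \<Lambda>.\<close>
  define e where "e = 1 / sqrt \<Lambda>"
  have e: "0 < e" and l: "\<Lambda> * e = sqrt \<Lambda>" "1 / e = sqrt \<Lambda>"
    using \<Lambda> by (auto simp: e_def real_div_sqrt)
  have "bs_potential \<mu> x \<le> ennreal (2 * \<Lambda> * e + 1 / (2 * pi * e) + 1 / (2 * pi * e))"
    using \<Lambda> e by (intro bs_potential_le[OF \<mu> u P]) (auto simp: emeasure_le_1)
  also have "2 * \<Lambda> * e + 1 / (2 * pi * e) + 1 / (2 * pi * e) = 2 * sqrt \<Lambda> + sqrt \<Lambda> / pi"
    unfolding mult.assoc l(1) using l(2) by (simp add: field_simps)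
  also have "\<dots> \<le> 3 * sqrt \<Lambda>"
    using \<Lambda> pi_gt3 by (simp add: field_simps)
  finally show ?thesis by (simp add: ennreal_leI)
qed

text \<open>Where the kernel fails to be integrable, the Bochner integral is 0 and the bound is
  trivial.\<close>

lemma norm_bs_K_le:
  assumes "sets \<mu> = sets borel" "bs_potential \<mu> x \<le> ennreal c" "0 \<le> c"
  shows "norm (bs_K \<mu> x) \<le> c"
proof -
  have [measurable_cong]: "sets \<mu> = sets borel" by fact
  have "ennreal (norm (bs_K \<mu> x)) \<le> bs_potential \<mu> x"
  proof (cases "integrable \<mu> (\<lambda>y. bs_k (x - y))")
    case True
    then show ?thesis
      using integral_norm_bound_ennreal[OF True] by (simp add: bs_K_def bs_potential_def norm_bs_k)
  next
    case False
    then show ?thesis by (simp add: bs_K_def not_integrable_integral_eq)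
  qed
  with assms show ?thesis
    using order_trans ennreal_le_iff by blast
qed

lemma integrable_bs_k:
  assumes "sets \<mu> = sets borel" "bs_potential \<mu> x < \<infinity>"
  shows "integrable \<mu> (\<lambda>y. bs_k (x - y))"
proof -
  have [measurable_cong]: "sets \<mu> = sets borel" by fact
  show ?thesis
    using assms(2) by (intro integrableI_bounded) (simp_all add: bs_potential_def norm_bs_k)
qed

section \<open>Heat semigroup gradient bound\<close>

text \<open>The gradient is an explicit argument. Its bound is left unquantified while \<phi> is
  bounded by 1: the estimates that matter depend on sup |\<phi>| only, which makes the class dual to
  total variation. One derivative is what the pathwise chain rule consumes.\<close>

definition C1_test :: "(real^2 \<Rightarrow> real) \<Rightarrow> (real^2 \<Rightarrow> real^2) \<Rightarrow> bool" where
  "C1_test \<phi> D \<longleftrightarrow> (\<forall>x. (\<phi> has_derivative (\<lambda>h. D x \<bullet> h)) (at x)) \<and>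
     continuous_on UNIV D \<and> bounded (range D) \<and> (\<forall>x. \<bar>\<phi> x\<bar> \<le> 1)"

lemma C1_testD:
  assumes "C1_test \<phi> D"
  shows "(\<phi> has_derivative (\<lambda>h. D x \<bullet> h)) (at x)" "continuous_on UNIV D" "bounded (range D)"
    "\<bar>\<phi> x\<bar> \<le> 1" "continuous_on UNIV \<phi>" "\<phi> \<in> borel_measurable borel" "D \<in> borel_measurable borel"
proof -
  show 1: "(\<phi> has_derivative (\<lambda>h. D x \<bullet> h)) (at x)" "continuous_on UNIV D" "bounded (range D)"
    "\<bar>\<phi> x\<bar> \<le> 1" for x using assms by (auto simp: C1_test_def)
  show 2: "continuous_on UNIV \<phi>"
    by (intro continuous_at_imp_continuous_on ballI has_derivative_continuous[OF 1(1)])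
  show "\<phi> \<in> borel_measurable borel" "D \<in> borel_measurable borel"
    using 1(2) 2 by (auto intro: borel_measurable_continuous_onI)
qed

lemma C1_test_bound:
  assumes "C1_test \<phi> D"
  shows "\<exists>L>0. (\<forall>x. norm (D x) \<le> L) \<and> (\<forall>x y. \<bar>\<phi> x - \<phi> y\<bar> \<le> L * norm (x - y))"
proof -
  obtain L where L: "0 < L" "\<And>x. norm (D x) \<le> L"
    using C1_testD(3)[OF assms] by (auto simp: bounded_pos)
  have "\<bar>\<phi> x - \<phi> y\<bar> \<le> L * norm (x - y)" for x y
  proof -
    have "norm (\<phi> x - \<phi> y) \<le> L * norm (x - y)"
    proof (rule differentiable_bound[of UNIV])
      show "(\<phi> has_derivative (\<lambda>h. D z \<bullet> h)) (at z within UNIV)" for z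
        using C1_testD(1)[OF assms] .
      show "onorm (\<lambda>h. D z \<bullet> h) \<le> L" for z
        using L(1) order_trans[OF Cauchy_Schwarz_ineq2 mult_right_mono[OF L(2)]]
        by (intro onorm_bound) auto
    qed auto
    then show ?thesis by simp
  qed
  with L show ?thesis by blast
qed

definition gauss_density :: "real \<Rightarrow> real^2 \<Rightarrow> real" where
  "gauss_density v x = exp (- (norm x * norm x) / (2 * v)) / (2 * pi * v)"

lemma gauss2_density: "gauss2 v = density lborel (\<lambda>x. ennreal (gauss_density v x))"
  by (simp add: gauss2_def gauss_density_def)

lemma borel_measurable_gauss_density [measurable]: "gauss_density v \<in> borel_measurable borel"
  unfolding gauss_density_def by measurable

lemma sets_gauss2 [simp, measurable_cong]: "sets (gauss2 v) = sets borel"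
  by (simp add: gauss2_def)

lemma space_gauss2 [simp]: "space (gauss2 v) = UNIV"
  by (simp add: gauss2_def)

lemma gauss_density_pos: "0 < v \<Longrightarrow> 0 < gauss_density v x"
  by (simp add: gauss_density_def)

text \<open>Completing the square: 2 |z - a|^2 - |z|^2 = |z - 2a|^2 - 2 |a|^2. Integrating the left
  side gives the chi-square distance of two shifted Gaussians up to a constant, so that distance
  becomes explicit.\<close>

lemma gauss_density_shift:
  assumes "0 < v"
  shows "(gauss_density v (z - a))\<^sup>2 / gauss_density v z =
    exp ((norm a)\<^sup>2 / v) * gauss_density v (z - 2 *\<^sub>R a)"
proof -
  have e: "2 * (- (norm (z - a) * norm (z - a)) / (2 * v)) - (- (norm z * norm z) / (2 * v)) =
    (norm a)\<^sup>2 / v + - (norm (z - 2 *\<^sub>R a) * norm (z - 2 *\<^sub>R a)) / (2 * v)"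
    using assms by (simp add: power2_norm_eq_inner power2_eq_square[symmetric] inner_diff_left inner_diff_right inner_commute field_simps)
  have "(gauss_density v (z - a))\<^sup>2 / gauss_density v z =
    exp (2 * (- (norm (z - a) * norm (z - a)) / (2 * v)) - (- (norm z * norm z) / (2 * v))) / (2 * pi * v)"
    using assms by (simp only: gauss_density_def exp_diff exp_double) (simp add: field_simps power2_eq_square)
  also have "\<dots> = exp ((norm a)\<^sup>2 / v) * gauss_density v (z - 2 *\<^sub>R a)"
    unfolding e exp_add gauss_density_def by simp
  finally show ?thesis .
qed

lemma lborel_integral_shift:
  fixes f :: "real^2 \<Rightarrow> real"
  assumes [measurable]: "f \<in> borel_measurable borel"
  shows "(\<integral>z. f (z - a) \<partial>lborel) = (\<integral>z. f z \<partial>lborel)"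
    and "integrable lborel (\<lambda>z. f (z - a)) \<longleftrightarrow> integrable lborel f"
proof -
  have d: "distr lborel borel (\<lambda>z. z - a) = lborel"
    using lborel_distr_plus[of "- a"] by (simp add: fun_eq_iff[of "(+) (- a)" "\<lambda>z. z - a", THEN iffD2])
  show "(\<integral>z. f (z - a) \<partial>lborel) = (\<integral>z. f z \<partial>lborel)"
    by (subst (2) d[symmetric]) (simp add: integral_distr)
  show "integrable lborel (\<lambda>z. f (z - a)) \<longleftrightarrow> integrable lborel f"
    by (subst (2) d[symmetric]) (simp add: integrable_distr_eq)
qed

text \<open>The normalisation comes from \<open>prob_space (gauss2 v)\<close>, which is later
  supplied by the law of the Brownian increments.\<close>

lemma gauss_density_integral:
  assumes "0 < v" and P: "prob_space (gauss2 v)"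
  shows "integrable lborel (gauss_density v)" "(\<integral>z. gauss_density v z \<partial>lborel) = 1"
proof -
  interpret prob_space "gauss2 v" by fact
  have "emeasure (gauss2 v) UNIV = 1" using emeasure_space_1 by simp
  then have n: "(\<integral>\<^sup>+z. ennreal (gauss_density v z) \<partial>lborel) = 1"
    by (simp add: gauss2_density emeasure_density)
  show "integrable lborel (gauss_density v)"
    using n gauss_density_pos[OF assms(1)] by (intro integrableI_nonneg) (auto intro: less_imp_le)
  show "(\<integral>z. gauss_density v z \<partial>lborel) = 1"
    using n gauss_density_pos[OF assms(1)] by (subst integral_eq_nn_integral) (auto intro: less_imp_le)
qed

text \<open>With \<open>p = gauss_density v (z - a)\<close> and \<open>q = gauss_density v z\<close>, the bound integrates
  \<open>\<bar>p - q\<bar> \<le> l / 2 * q + (p - q)\<^sup>2 / (2 * l * q)\<close>, where \<open>p\<^sup>2 / q\<close> is again a multiple of a shifted Gaussian.\<close>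

lemma gauss2_shift_bound:
  fixes \<phi> :: "real^2 \<Rightarrow> real"
  assumes v: "0 < v" and P: "prob_space (gauss2 v)" and [measurable]: "\<phi> \<in> borel_measurable borel"
    and b: "\<And>x. \<bar>\<phi> x\<bar> \<le> 1" and l: "0 < l"
  shows "\<bar>(\<integral>z. \<phi> (z + a) \<partial>gauss2 v) - (\<integral>z. \<phi> z \<partial>gauss2 v)\<bar>
    \<le> l / 2 + (exp ((norm a)\<^sup>2 / v) - 1) / (2 * l)"
proof -
  note G = gauss_density_integral[OF v P] 
  note pos = gauss_density_pos[OF v]
  have Ga: "integrable lborel (\<lambda>z. gauss_density v (z - a))" "(\<integral>z. gauss_density v (z - a) \<partial>lborel) = 1" for a
    using G by (simp_all add: lborel_integral_shift)
  have i: "(\<integral>z. f z \<partial>gauss2 v) = (\<integral>z. f z * gauss_density v z \<partial>lborel)"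
    if [measurable]: "f \<in> borel_measurable borel" for f :: "real^2 \<Rightarrow> real"
    unfolding gauss2_density using pos by (subst integral_density) (auto intro: less_imp_le simp: mult.commute)
  have int: "integrable lborel (\<lambda>z. \<phi> z * gauss_density v (z - a))" for a
    by (rule Bochner_Integration.integrable_bound[OF Ga(1)[of a]])
       (auto simp: abs_mult intro!: mult_mono[OF b order_refl, simplified])
  have "(\<integral>z. \<phi> (z + a) \<partial>gauss2 v) = (\<integral>z. \<phi> (z + a) * gauss_density v z \<partial>lborel)"
    by (rule i) measurable
  also have "\<dots> = (\<integral>z. \<phi> z * gauss_density v (z - a) \<partial>lborel)"
    using lborel_integral_shift(1)[of "\<lambda>z. \<phi> (z + a) * gauss_density v z" a] by simp
  finally have 1: "(\<integral>z. \<phi> (z + a) \<partial>gauss2 v) - (\<integral>z. \<phi> z \<partial>gauss2 v) =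
     (\<integral>z. \<phi> z * gauss_density v (z - a) - \<phi> z * gauss_density v z \<partial>lborel)"
    using int[of a] int[of 0] by (simp add: i)
  let ?B = "\<lambda>z. (l / 2 + 1 / (2 * l)) * gauss_density v z +
     exp ((norm a)\<^sup>2 / v) / (2 * l) * gauss_density v (z - 2 *\<^sub>R a) - (1 / l) * gauss_density v (z - a)"
  have "norm (\<phi> z * gauss_density v (z - a) - \<phi> z * gauss_density v z) \<le> ?B z" for z
  proof -
    let ?p = "gauss_density v (z - a)" and ?q = "gauss_density v z"
    have "\<phi> z * ?p - \<phi> z * ?q = \<phi> z * (?p - ?q)" by (simp add: algebra_simps)
    then have "norm (\<phi> z * ?p - \<phi> z * ?q) \<le> \<bar>?p - ?q\<bar>"
      using mult_right_mono[OF b, of "\<bar>?p - ?q\<bar>" z] by (simp add: abs_mult)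
    also have "\<dots> \<le> l / 2 * ?q + (?p - ?q)\<^sup>2 / (2 * l * ?q)"
    proof -
      have "0 \<le> (l * ?q - \<bar>?p - ?q\<bar>)\<^sup>2" by simp
      then have "2 * l * ?q * \<bar>?p - ?q\<bar> \<le> l\<^sup>2 * ?q\<^sup>2 + (?p - ?q)\<^sup>2"
        by (simp add: power2_diff power_mult_distrib)
      then show ?thesis using l pos[of z] by (simp add: field_simps power2_eq_square)
    qed
    also have "(?p - ?q)\<^sup>2 / (2 * l * ?q) = 1 / (2 * l) * (?p\<^sup>2 / ?q - 2 * ?p + ?q)"
      using l pos[of z] by (simp add: field_simps power2_eq_square)
    also have "l / 2 * ?q + \<dots> = ?B z"
      unfolding gauss_density_shift[OF v] using l by (simp add: field_simps)
    finally show ?thesis .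
  qed
  moreover have B: "integrable lborel ?B" using Ga(1)[of "2 *\<^sub>R a"] Ga(1)[of a] G(1) by simp
  ultimately have "norm (\<integral>z. \<phi> z * gauss_density v (z - a) - \<phi> z * gauss_density v z \<partial>lborel) \<le> (\<integral>z. ?B z \<partial>lborel)"
    by (intro Bochner_Integration.integral_norm_bound_integral) (use int[of a] int[of 0] in auto)
  also have "\<dots> = (l / 2 + 1 / (2 * l)) + exp ((norm a)\<^sup>2 / v) / (2 * l) - 1 / l"
    using Ga[of "2 *\<^sub>R a"] Ga[of a] G by simp
  also have "\<dots> = l / 2 + (exp ((norm a)\<^sup>2 / v) - 1) / (2 * l)"
    using l by (simp add: field_simps)
  finally show ?thesis unfolding 1 by simp
qed

text \<open>The gradient of the heat average of \<phi> is a limit of difference quotients, and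
  moving x by t amounts to moving the Gaussian by t / c. Only sup |\<phi>| enters the constant; the
  bound \<open>L\<close> of \<open>D\<close> serves for integrability and for passing to the
  limit.\<close>

lemma gauss2_gradient_bound:
  assumes v: "0 < v" and P: "prob_space (gauss2 v)" and T: "C1_test \<phi> D" and c: "0 < c"
  shows "norm (\<integral>z. D (x + c *\<^sub>R z) \<partial>gauss2 v) \<le> 1 / (c * sqrt v)"
proof -
  interpret prob_space "gauss2 v" by fact
  note [measurable] = C1_testD(6,7)[OF T]
  obtain L where L: "0 < L" "\<And>x. norm (D x) \<le> L" "\<And>x y. \<bar>\<phi> x - \<phi> y\<bar> \<le> L * norm (x - y)"
    using C1_test_bound[OF T] by blast
  have iD: "integrable (gauss2 v) (\<lambda>z. D (x + c *\<^sub>R z))"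
    by (rule integrable_const_bound[of _ L]) (auto simp: L)
  define k where "k = 1 / (c * sqrt v)"
  have k: "0 < k" using c v by (simp add: k_def)
  have main: "(\<integral>z. D (x + c *\<^sub>R z) \<partial>gauss2 v) \<bullet> e \<le> k" if e: "norm e = 1" for e
  proof -
    define t where "t n = inverse (real (Suc n))" for n
    have t: "0 < t n" "t n \<le> 1" for n by (auto simp: t_def field_simps)
    have t0: "t \<longlonglongrightarrow> 0" unfolding t_def by (rule LIMSEQ_inverse_real_of_nat)
    let ?q = "\<lambda>n z. (\<phi> (x + c *\<^sub>R z + t n *\<^sub>R e) - \<phi> (x + c *\<^sub>R z)) / t n"
    have lim: "(\<lambda>n. ?q n z) \<longlonglongrightarrow> D (x + c *\<^sub>R z) \<bullet> e" for z
    proof -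
      have "((\<lambda>s. \<phi> (x + c *\<^sub>R z + s *\<^sub>R e)) has_derivative (\<lambda>s. D (x + c *\<^sub>R z + 0 *\<^sub>R e) \<bullet> (s *\<^sub>R e))) (at 0)"
        by (rule has_derivative_compose[OF _ C1_testD(1)[OF T]]) (auto intro!: derivative_eq_intros)
      then have "((\<lambda>s. \<phi> (x + c *\<^sub>R z + s *\<^sub>R e)) has_field_derivative (D (x + c *\<^sub>R z) \<bullet> e)) (at 0)"
        by (simp add: has_field_derivative_def mult_commute_abs)
      then have "((\<lambda>h. (\<phi> (x + c *\<^sub>R z + h *\<^sub>R e) - \<phi> (x + c *\<^sub>R z)) / h) \<longlongrightarrow> D (x + c *\<^sub>R z) \<bullet> e) (at 0)"
        by (simp add: DERIV_def)
      moreover have "filterlim t (at 0) sequentially"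
        using t0 t(1) by (auto simp: filterlim_at less_imp_neq[symmetric])
      ultimately show ?thesis by (rule filterlim_compose)
    qed
    have "(\<lambda>n. \<integral>z. ?q n z \<partial>gauss2 v) \<longlonglongrightarrow> (\<integral>z. D (x + c *\<^sub>R z) \<bullet> e \<partial>gauss2 v)"
    proof (rule integral_dominated_convergence[where w="\<lambda>_. L"])
      show "AE z in gauss2 v. norm (?q n z) \<le> L" for n
      proof (rule AE_I2)
        fix z
        have "\<bar>\<phi> (x + c *\<^sub>R z + t n *\<^sub>R e) - \<phi> (x + c *\<^sub>R z)\<bar> \<le> L * t n"
          using L(3)[of "x + c *\<^sub>R z + t n *\<^sub>R e" "x + c *\<^sub>R z"] e t(1)[of n] by simp
        then show "norm (?q n z) \<le> L" using t(1)[of n] by (simp add: field_simps)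
      qed
    qed (auto simp: lim)
    moreover have q_le: "(\<integral>z. ?q n z \<partial>gauss2 v) \<le> k + k ^ 3 * t n ^ 2 / 2" if n: "k * t n \<le> 1" for n
    proof -
      have i: "integrable (gauss2 v) (\<lambda>z. \<phi> (y + c *\<^sub>R z))" for y
        by (rule integrable_const_bound[of _ 1]) (auto simp: C1_testD(4)[OF T])
      have "(\<integral>z. ?q n z \<partial>gauss2 v) = ((\<integral>z. \<phi> (x + c *\<^sub>R (z + (t n / c) *\<^sub>R e)) \<partial>gauss2 v) - (\<integral>z. \<phi> (x + c *\<^sub>R z) \<partial>gauss2 v)) / t n"
        using i[of x] i[of "x + t n *\<^sub>R e"] c by (simp add: algebra_simps)
      \<comment> \<open>The free parameter of the shift bound is l = k t, where (k t)^2 is the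
        squared shift divided by v. This balances its two terms, each of size about k t / 2.\<close>
      also have "\<dots> \<le> ((k * t n) / 2 + (exp ((norm ((t n / c) *\<^sub>R e))\<^sup>2 / v) - 1) / (2 * (k * t n))) / t n"
        using gauss2_shift_bound[OF v P, of "\<lambda>z. \<phi> (x + c *\<^sub>R z)" "k * t n" "(t n / c) *\<^sub>R e"]
          C1_testD(4)[OF T] k t(1)[of n] by (intro divide_right_mono) auto
      also have "(norm ((t n / c) *\<^sub>R e))\<^sup>2 / v = (k * t n)\<^sup>2"
        using c v e by (simp add: k_def power_divide power_mult_distrib field_simps)
      also have "exp ((k * t n)\<^sup>2) - 1 \<le> (k * t n)\<^sup>2 + ((k * t n)\<^sup>2)\<^sup>2"
        using exp_bound[of "(k * t n)\<^sup>2"] n k t(1)[of n] by (simp add: power_le_one)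
      also have "((k * t n) / 2 + ((k * t n)\<^sup>2 + ((k * t n)\<^sup>2)\<^sup>2) / (2 * (k * t n))) / t n = k + k ^ 3 * t n ^ 2 / 2"
        using k t(1)[of n] by (simp add: field_simps power2_eq_square power3_eq_cube)
      finally show ?thesis using k t(1)[of n] by (auto simp: divide_right_mono)
    qed
    moreover have ev: "eventually (\<lambda>n. k * t n \<le> 1) sequentially"
    proof -
      have "(\<lambda>n. k * t n) \<longlonglongrightarrow> k * 0" by (intro tendsto_intros t0)
      then have "eventually (\<lambda>n. k * t n < 1) sequentially" by (rule order_tendstoD) simp
      then show ?thesis by (rule eventually_mono) simp
    qed
    moreover have "(\<lambda>n. k + k ^ 3 * t n ^ 2 / 2) \<longlonglongrightarrow> k + k ^ 3 * 0 ^ 2 / 2"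
      by (intro tendsto_intros t0) auto
    ultimately have "(\<integral>z. D (x + c *\<^sub>R z) \<bullet> e \<partial>gauss2 v) \<le> k + k ^ 3 * 0 ^ 2 / 2"
      using eventually_mono[OF ev q_le] by (intro tendsto_le[OF sequentially_bot])
    then show ?thesis using iD by simp
  qed
  let ?w = "\<integral>z. D (x + c *\<^sub>R z) \<partial>gauss2 v"
  show ?thesis
  proof (cases "?w = 0")
    case False
    have "?w \<bullet> sgn ?w \<le> k" by (rule main) (simp add: norm_sgn False)
    then show ?thesis using False by (simp add: k_def sgn_div_norm power2_norm_eq_inner[symmetric] power2_eq_square mult.assoc[symmetric])
  qed (use c v in simp)
qed

section \<open>Chain rule along absolutely continuous paths and test functions\<close>

text \<open>\<open>f\<close> is merely integrable, so \<open>Y\<close> need not be differentiable at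
  a given point. The increments of \<phi> along Y are compared with the integral on short intervals,
  up to e times the integral of |f|; this error adds up over adjacent intervals and thus extends to
  [a, b].\<close>

lemma C1_test_chain_rule:
  fixes f Y :: "real \<Rightarrow> real^2"
  assumes T: "C1_test \<phi> D" and ab: "a \<le> b" and f: "set_integrable lborel {a..b} f"
    and Y: "\<And>t. a \<le> t \<Longrightarrow> t \<le> b \<Longrightarrow> Y t = y - (LINT \<tau>:{t..b}|lborel. f \<tau>)"
  shows "set_integrable lborel {a..b} (\<lambda>\<tau>. D (Y \<tau>) \<bullet> f \<tau>)"
    and "\<phi> (Y b) - \<phi> (Y a) = (LINT \<tau>:{a..b}|lborel. D (Y \<tau>) \<bullet> f \<tau>)"
proof -
  have f': "set_integrable lborel {u..v} f" if "a \<le> u" "v \<le> b" for u v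
    by (rule set_integrable_subset[OF f]) (use that in auto)
  have fI: "f integrable_on {u..v}" "(\<lambda>x. norm (f x)) integrable_on {u..v}"
    and fL: "(LINT \<tau>:{u..v}|lborel. f \<tau>) = integral {u..v} f" if "a \<le> u" "v \<le> b" for u v
    using set_borel_integral_eq_integral[OF f'[OF that]] set_borel_integral_eq_integral[OF set_integrable_norm[OF f'[OF that]]]
    by auto
  have Y': "Y t = y - integral {t..b} f" if "a \<le> t" "t \<le> b" for t
    using Y[OF that] fL[of t b] that by simp
  have YY: "Y v - Y u = integral {u..v} f" if "a \<le> u" "u \<le> v" "v \<le> b" for u v
    using Henstock_Kurzweil_Integration.integral_combine[of u v b f] fI(1)[of u b] that by (simp add: Y' algebra_simps)
  have normY: "norm (Y v - Y u) \<le> integral {u..v} (\<lambda>x. norm (f x))" if "a \<le> u" "u \<le> v" "v \<le> b" for u v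
    unfolding YY[OF that] by (rule Henstock_Kurzweil_Integration.integral_norm_bound_integral) (use fI that in auto)
  have cY: "continuous_on {a..b} Y"
  proof -
    have "continuous_on {a..b} (\<lambda>t. y - integral {t..b} f)"
      by (intro continuous_intros indefinite_integral_continuous_1' fI) auto
    then show ?thesis by (rule continuous_on_cong[THEN iffD1, rotated 2]) (auto simp: Y')
  qed
  have cDY: "continuous_on {a..b} (\<lambda>t. D (Y t))"
    using continuous_on_compose2[OF C1_testD(2)[OF T] cY] by auto
  obtain L where L: "0 < L" "\<And>x. norm (D x) \<le> L" using C1_test_bound[OF T] by blast
  let ?g = "\<lambda>\<tau>. D (Y \<tau>) \<bullet> f \<tau>"
  show g: "set_integrable lborel {a..b} ?g"
  proof -
    have [measurable]: "(\<lambda>x. indicator {a..b} x *\<^sub>R D (Y x)) \<in> borel_measurable borel"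
      by (rule borel_measurable_continuous_on_indicator[OF _ cDY]) simp
    have [measurable]: "(\<lambda>x. indicator {a..b} x *\<^sub>R f x) \<in> borel_measurable borel"
      using f by (auto simp: set_integrable_def)
    have "integrable lborel (\<lambda>x. (indicator {a..b} x *\<^sub>R D (Y x)) \<bullet> (indicator {a..b} x *\<^sub>R f x))"
    proof (rule Bochner_Integration.integrable_bound)
      show "integrable lborel (\<lambda>x. L * norm (indicator {a..b} x *\<^sub>R f x))"
        by (intro integrable_mult_right integrable_norm) (use f in \<open>simp add: set_integrable_def\<close>)
      have "norm (D (Y x) \<bullet> f x) \<le> norm (L * norm (f x))" for x
        using Cauchy_Schwarz_ineq2[of "D (Y x)" "f x"] mult_right_mono[OF L(2)[of "Y x"], of "norm (f x)"] L(1)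
        by (simp add: abs_mult)
      then show "AE x in lborel. norm ((indicator {a..b} x *\<^sub>R D (Y x)) \<bullet> (indicator {a..b} x *\<^sub>R f x)) \<le> norm (L * norm (indicator {a..b} x *\<^sub>R f x))"
        by (auto simp: indicator_def)
    qed measurable
    then show ?thesis unfolding set_integrable_def
      by (rule Bochner_Integration.integrable_cong[THEN iffD1, rotated 2]) (auto simp: indicator_def)
  qed
  have gI: "?g integrable_on {u..v}" if "a \<le> u" "v \<le> b" for u v
    by (rule set_borel_integral_eq_integral(1)[OF set_integrable_subset[OF g]]) (use that in auto)
  have main: "\<bar>\<phi> (Y b) - \<phi> (Y a) - integral {a..b} ?g\<bar> \<le> e * integral {a..b} (\<lambda>x. norm (f x))" if e: "0 < e" for e
  proof -
    \<comment> \<open>Both sides of this estimate are additive over adjacent intervals, as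
      \<open>Bolzano\<close> requires. Near a point x it holds because \<phi> is differentiable at
      \<open>Y x\<close> and \<open>D\<close> is continuous along \<open>Y\<close>, each
      contributing e / 2.\<close>
    define P where "P u v \<longleftrightarrow> (a \<le> u \<and> v \<le> b \<longrightarrow>
      \<bar>\<phi> (Y v) - \<phi> (Y u) - integral {u..v} ?g\<bar> \<le> e * integral {u..v} (\<lambda>x. norm (f x)))" for u v
    have "P a b"
    proof (rule Bolzano[OF ab])
      fix u v w assume uv: "P u v" "P v w" "u \<le> v" "v \<le> w"
      show "P u w" unfolding P_def
      proof
        assume "a \<le> u \<and> w \<le> b"
        with uv[unfolded P_def] show "\<bar>\<phi> (Y w) - \<phi> (Y u) - integral {u..w} ?g\<bar> \<le> e * integral {u..w} (\<lambda>x. norm (f x))"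
          using Henstock_Kurzweil_Integration.integral_combine[of u v w ?g] Henstock_Kurzweil_Integration.integral_combine[of u v w "\<lambda>x. norm (f x)"] gI[of u w] fI(2)[of u w]
          by (smt (verit, ccfv_SIG) distrib_left)
      qed
    next
      fix x assume x: "a \<le> x" "x \<le> b"
      obtain d1 where d1: "0 < d1" "\<And>t. t \<in> {a..b} \<Longrightarrow> dist t x < d1 \<Longrightarrow> dist (D (Y t)) (D (Y x)) < e / 2"
        using cDY x e unfolding continuous_on_iff by (metis atLeastAtMost_iff half_gt_zero)
      obtain d2 where d2: "0 < d2" "\<And>z. norm (z - Y x) < d2 \<Longrightarrow> norm (\<phi> z - \<phi> (Y x) - D (Y x) \<bullet> (z - Y x)) \<le> e / 2 * norm (z - Y x)"
        using C1_testD(1)[OF T, of "Y x"] e unfolding has_derivative_at_alt by (meson half_gt_zero)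
      obtain d3 where d3: "0 < d3" "\<And>t. t \<in> {a..b} \<Longrightarrow> dist t x < d3 \<Longrightarrow> dist (Y t) (Y x) < d2"
        using cY x d2(1) unfolding continuous_on_iff by (metis atLeastAtMost_iff)
      have "P u v" if uv: "u \<le> x" "x \<le> v" "v - u < min d1 d3" for u v
        unfolding P_def
      proof
        assume "a \<le> u \<and> v \<le> b"
        then have ab': "a \<le> u" "v \<le> b" by auto
        let ?n = "\<lambda>u v. integral {u..v} (\<lambda>x. norm (f x))"
        have "norm (Y u - Y x) < d2" "norm (Y v - Y x) < d2"
          using d3(2)[of u] d3(2)[of v] uv ab' by (auto simp: dist_norm)
        then have "\<bar>\<phi> (Y u) - \<phi> (Y x) - D (Y x) \<bullet> (Y u - Y x)\<bar> \<le> e / 2 * norm (Y u - Y x)"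
          "\<bar>\<phi> (Y v) - \<phi> (Y x) - D (Y x) \<bullet> (Y v - Y x)\<bar> \<le> e / 2 * norm (Y v - Y x)"
          using d2(2)[of "Y u"] d2(2)[of "Y v"] by auto
        moreover have "e / 2 * norm (Y u - Y x) \<le> e / 2 * ?n u x"
          using normY[of u x] uv ab' e x by (intro mult_left_mono) (auto simp: norm_minus_commute)
        moreover have "e / 2 * norm (Y v - Y x) \<le> e / 2 * ?n x v"
          using normY[of x v] uv ab' e x by (intro mult_left_mono) auto
        moreover have "?n u x + ?n x v = ?n u v"
          using uv ab' fI(2)[of u v] by (intro Henstock_Kurzweil_Integration.integral_combine) auto
        moreover have "D (Y x) \<bullet> (Y v - Y x) - D (Y x) \<bullet> (Y u - Y x) = D (Y x) \<bullet> (Y v - Y u)"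
          by (simp add: inner_diff_right)
        ultimately have 1: "\<bar>\<phi> (Y v) - \<phi> (Y u) - D (Y x) \<bullet> (Y v - Y u)\<bar> \<le> e / 2 * ?n u v"
          by (smt (verit, ccfv_threshold) distrib_left)
        have i: "(\<lambda>\<tau>. D (Y x) \<bullet> f \<tau>) integrable_on {u..v}"
          "integral {u..v} (\<lambda>\<tau>. D (Y x) \<bullet> f \<tau>) = D (Y x) \<bullet> integral {u..v} f"
          using integrable_linear[OF fI(1)[OF ab'] bounded_linear_inner_right[of "D (Y x)"]]
            integral_linear[OF fI(1)[OF ab'] bounded_linear_inner_right[of "D (Y x)"]] by (simp_all add: o_def)
        have "D (Y x) \<bullet> (Y v - Y u) - integral {u..v} ?g = integral {u..v} (\<lambda>\<tau>. D (Y x) \<bullet> f \<tau> - ?g \<tau>)"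
          using YY[of u v] uv ab' i gI[OF ab'] by (simp add: Henstock_Kurzweil_Integration.integral_diff)
        moreover have "norm (integral {u..v} (\<lambda>\<tau>. D (Y x) \<bullet> f \<tau> - ?g \<tau>)) \<le> integral {u..v} (\<lambda>\<tau>. e / 2 * norm (f \<tau>))"
        proof (rule Henstock_Kurzweil_Integration.integral_norm_bound_integral)
          show "(\<lambda>\<tau>. D (Y x) \<bullet> f \<tau> - ?g \<tau>) integrable_on {u..v}" using i(1) gI[OF ab'] by (rule integrable_diff)
          show "(\<lambda>\<tau>. e / 2 * norm (f \<tau>)) integrable_on {u..v}" using fI(2)[OF ab'] by (simp add: integrable_on_mult_right)
          fix \<tau> assume "\<tau> \<in> {u..v}"
          then have "dist \<tau> x < d1" "\<tau> \<in> {a..b}" using uv ab' by (auto simp: dist_real_def)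
          then have "norm (D (Y x) - D (Y \<tau>)) \<le> e / 2"
            using d1(2)[of \<tau>] by (simp add: dist_norm norm_minus_commute less_imp_le)
          then show "norm (D (Y x) \<bullet> f \<tau> - ?g \<tau>) \<le> e / 2 * norm (f \<tau>)"
            using Cauchy_Schwarz_ineq2[of "D (Y x) - D (Y \<tau>)" "f \<tau>"] mult_right_mono[of _ "e/2" "norm (f \<tau>)"]
            by (fastforce simp: inner_diff_left)
        qed
        moreover have "integral {u..v} (\<lambda>\<tau>. e / 2 * norm (f \<tau>)) = e / 2 * ?n u v" by simp
        ultimately show "\<bar>\<phi> (Y v) - \<phi> (Y u) - integral {u..v} ?g\<bar> \<le> e * ?n u v"
          using 1 by (smt (verit, ccfv_threshold) field_sum_of_halves distrib_right real_norm_def)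
      qed
      then show "\<exists>d>0. \<forall>u v. u \<le> x \<and> x \<le> v \<and> v - u < d \<longrightarrow> P u v"
        using d1(1) d3(1) by (intro exI[of _ "min d1 d3"]) auto
    qed
    then show ?thesis by (simp add: P_def)
  qed
  have "\<bar>\<phi> (Y b) - \<phi> (Y a) - integral {a..b} ?g\<bar> \<le> 0"
  proof (rule field_le_epsilon)
    fix e :: real assume e: "0 < e"
    let ?n = "integral {a..b} (\<lambda>x. norm (f x))"
    have n: "0 \<le> ?n" by (rule integral_nonneg) (use fI ab in auto)
    have "\<bar>\<phi> (Y b) - \<phi> (Y a) - integral {a..b} ?g\<bar> \<le> e / (1 + ?n) * ?n"
      using main[of "e / (1 + ?n)"] e n by simp
    also have "\<dots> \<le> e" using e n by (simp add: field_simps)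
    finally show "\<bar>\<phi> (Y b) - \<phi> (Y a) - integral {a..b} ?g\<bar> \<le> 0 + e" by simp
  qed
  then show "\<phi> (Y b) - \<phi> (Y a) = (LINT \<tau>:{a..b}|lborel. D (Y \<tau>) \<bullet> f \<tau>)"
    using set_borel_integral_eq_integral(2)[OF g] by simp
qed

section \<open>Products of test functions and approximation of indicators of open sets\<close>

lemma C1_test_mult:
  assumes 1: "C1_test \<phi> D" and 2: "C1_test \<psi> E"
  shows "C1_test (\<lambda>x. \<phi> x * \<psi> x) (\<lambda>x. \<phi> x *\<^sub>R E x + \<psi> x *\<^sub>R D x)"
  unfolding C1_test_def
proof (intro conjI allI)
  fix x
  have "((\<lambda>x. \<phi> x * \<psi> x) has_derivative (\<lambda>h. \<phi> x * (E x \<bullet> h) + (D x \<bullet> h) * \<psi> x)) (at x)"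
    by (intro has_derivative_mult C1_testD(1) assms)
  then show "((\<lambda>x. \<phi> x * \<psi> x) has_derivative (\<lambda>h. (\<phi> x *\<^sub>R E x + \<psi> x *\<^sub>R D x) \<bullet> h)) (at x)"
    by (simp add: inner_add_left mult.commute)
  show "\<bar>\<phi> x * \<psi> x\<bar> \<le> 1"
    using C1_testD(4)[OF 1, of x] C1_testD(4)[OF 2, of x] by (simp add: abs_mult mult_le_one)
next
  show "continuous_on UNIV (\<lambda>x. \<phi> x *\<^sub>R E x + \<psi> x *\<^sub>R D x)"
    by (intro continuous_intros C1_testD(2,5)[OF 1] C1_testD(2,5)[OF 2])
  obtain L M where LM: "\<And>x. norm (D x) \<le> L" "\<And>x. norm (E x) \<le> M"
    using C1_test_bound[OF 1] C1_test_bound[OF 2] by metis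
  have "norm (\<phi> x *\<^sub>R E x + \<psi> x *\<^sub>R D x) \<le> M + L" for x
    using LM(1)[of x] LM(2)[of x] mult_mono[OF C1_testD(4)[OF 1, of x] LM(2)[of x]] mult_mono[OF C1_testD(4)[OF 2, of x] LM(1)[of x]]
    by (intro norm_triangle_le add_mono) auto
  then show "bounded (range (\<lambda>x. \<phi> x *\<^sub>R E x + \<psi> x *\<^sub>R D x))"
    by (auto simp: bounded_iff)
qed

lemma C1_test_one: "C1_test (\<lambda>x. 1) (\<lambda>x. 0)"
  by (simp add: C1_test_def)

lemma C1_test_power:
  assumes "C1_test \<phi> D" shows "\<exists>E. C1_test (\<lambda>x. \<phi> x ^ n) E"
proof (induction n)
  case 0 then show ?case using C1_test_one by auto
next
  case (Suc n) then show ?case using C1_test_mult[OF assms] by auto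
qed

lemma C1_test_prod:
  assumes "\<And>i::nat. \<exists>E. C1_test (\<phi> i) E" shows "\<exists>E. C1_test (\<lambda>x. \<Prod>i<n. \<phi> i x) E"
proof (induction n)
  case 0 then show ?case using C1_test_one by auto
next
  case (Suc n)
  from this assms[of n] show ?case using C1_test_mult by fastforce
qed

text \<open>Squaring removes the kink of the positive part at 0; this is what makes
  \<open>ball_bump\<close> continuously differentiable.\<close>

lemma DERIV_pos_part_sq: "((\<lambda>s::real. (max 0 s)\<^sup>2) has_field_derivative 2 * max 0 s) (at s)"
proof -
  consider "s > 0" | "s < 0" | "s = 0" by linarith
  then show ?thesis
  proof cases
    case 1
    have "((\<lambda>s::real. s\<^sup>2) has_field_derivative 2 * max 0 s) (at s)"
      using 1 by (auto intro!: derivative_eq_intros)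
    then show ?thesis
      by (rule DERIV_cong_ev[THEN iffD1, rotated 3, OF _ refl _ refl])
         (use 1 eventually_nhds_in_open[of "{0<..}" s] in \<open>auto elim!: eventually_mono\<close>)
  next
    case 2
    have "((\<lambda>s::real. 0) has_field_derivative 2 * max 0 s) (at s)"
      using 2 by (auto intro!: derivative_eq_intros)
    then show ?thesis
      by (rule DERIV_cong_ev[THEN iffD1, rotated 3, OF _ refl _ refl])
         (use 2 eventually_nhds_in_open[of "{..<0}" s] in \<open>auto elim!: eventually_mono\<close>)
  next
    case 3
    have "((\<lambda>h::real. (max 0 h)\<^sup>2 / h) \<longlongrightarrow> 0) (at 0)"
    proof (rule Lim_null_comparison)
      show "\<forall>\<^sub>F h in at 0. norm ((max 0 h)\<^sup>2 / h) \<le> \<bar>h::real\<bar>"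
        by (auto simp: max_def power2_eq_square)
      show "((\<lambda>h::real. \<bar>h\<bar>) \<longlongrightarrow> 0) (at 0)" by (intro tendsto_eq_intros) auto
    qed
    then show ?thesis using 3 by (simp add: DERIV_def)
  qed
qed

text \<open>A C1 function that is positive exactly on the open ball. It is built from the squared
  distance, which unlike the norm is smooth at the centre.\<close>

definition ball_bump :: "real^2 \<Rightarrow> real \<Rightarrow> real^2 \<Rightarrow> real" where
  "ball_bump c R x = (max 0 (1 - ((x - c) \<bullet> (x - c)) / R\<^sup>2))\<^sup>2"

lemma ball_bump:
  assumes "0 < R"
  shows "0 \<le> ball_bump c R x" "ball_bump c R x \<le> 1" "x \<in> ball c R \<longleftrightarrow> 0 < ball_bump c R x"
proof -
  let ?s = "1 - ((x - c) \<bullet> (x - c)) / R\<^sup>2"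
  show "0 \<le> ball_bump c R x" by (simp add: ball_bump_def)
  have "0 \<le> max 0 ?s" "max 0 ?s \<le> 1" by auto
  then show "ball_bump c R x \<le> 1" unfolding ball_bump_def by (rule power_le_one)
  have "x \<in> ball c R \<longleftrightarrow> (norm (x - c))\<^sup>2 < R\<^sup>2"
    using power2_less_imp_less[of "norm (x - c)" R] power_strict_mono[of "norm (x - c)" R 2] assms
    by (auto simp: dist_norm norm_minus_commute)
  also have "\<dots> \<longleftrightarrow> 0 < ?s" using assms by (simp add: power2_norm_eq_inner field_simps)
  also have "\<dots> \<longleftrightarrow> 0 < ball_bump c R x"
  proof -
    have "0 < t \<longleftrightarrow> 0 < (max 0 t)\<^sup>2" for t :: real by (auto simp: max_def)
    then show ?thesis unfolding ball_bump_def .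
  qed
  finally show "x \<in> ball c R \<longleftrightarrow> 0 < ball_bump c R x" .
qed

text \<open>The complement is the useful form: a product of such factors equals 1 off a union of
  balls and is below 1 on it.\<close>

lemma C1_test_ball_bump:
  assumes R: "0 < R"
  shows "\<exists>E. C1_test (\<lambda>x. 1 - ball_bump c R x) E"
proof -
  let ?s = "\<lambda>x. 1 - ((x - c) \<bullet> (x - c)) / R\<^sup>2"
  let ?D = "\<lambda>x. (4 * max 0 (?s x) / R\<^sup>2) *\<^sub>R (x - c)"
  have "C1_test (\<lambda>x. 1 - ball_bump c R x) ?D"
    unfolding C1_test_def
  proof (intro conjI allI)
    fix x
    have "(?s has_derivative (\<lambda>h. - (2 * ((x - c) \<bullet> h)) / R\<^sup>2)) (at x)"
    proof -
      have "((\<lambda>x. (x - c) \<bullet> (x - c)) has_derivative (\<lambda>h. 2 * ((x - c) \<bullet> h))) (at x)"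
        by (auto intro!: derivative_eq_intros simp: inner_commute)
      from has_derivative_diff[OF has_derivative_const[of 1] has_derivative_mult_right[OF this, of "1 / R\<^sup>2"]]
      show ?thesis by simp
    qed
    from DERIV_compose_FDERIV[OF DERIV_pos_part_sq this]
    have "((\<lambda>x. (max 0 (?s x))\<^sup>2) has_derivative (\<lambda>h. (- (2 * ((x - c) \<bullet> h)) / R\<^sup>2) * (2 * max 0 (?s x)))) (at x)" .
    then have "((\<lambda>x. 1 - (max 0 (?s x))\<^sup>2) has_derivative (\<lambda>h. 0 - (- (2 * ((x - c) \<bullet> h)) / R\<^sup>2) * (2 * max 0 (?s x)))) (at x)"
      by (intro has_derivative_diff) auto
    then show "((\<lambda>x. 1 - ball_bump c R x) has_derivative (\<lambda>h. ?D x \<bullet> h)) (at x)"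
      unfolding ball_bump_def
      by (rule has_derivative_eq_rhs) (simp add: fun_eq_iff mult.commute mult.left_commute)
    show "\<bar>1 - ball_bump c R x\<bar> \<le> 1" using ball_bump(1,2)[OF R, of c x] by simp
  next
    show "continuous_on UNIV ?D" using R by (intro continuous_intros) auto
    have "norm (?D x) \<le> 4 / R" for x
    proof (cases "norm (x - c) \<le> R")
      case True
      have "max 0 (?s x) \<le> 1" by auto
      then have "max 0 (?s x) * norm (x - c) \<le> 1 * R" using True R by (intro mult_mono) auto
      then have "4 * (max 0 (?s x) * norm (x - c)) / R\<^sup>2 \<le> 4 * R / R\<^sup>2" by (intro divide_right_mono) auto
      then show ?thesis using R by (simp add: power2_eq_square abs_mult)
    next
      case False
      then have "R\<^sup>2 \<le> (norm (x - c))\<^sup>2" using R by (intro power_mono) auto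
      then have "?s x \<le> 0" using R by (simp add: power2_norm_eq_inner field_simps)
      then show ?thesis using R by (simp add: max_def)
    qed
    then show "bounded (range ?D)" by (auto simp: bounded_iff)
  qed
  then show ?thesis by blast
qed

text \<open>\<open>U\<close> is a countable union of balls. The product of the complementary bumps
  of the first n balls, each to the power n, is 1 off \<open>U\<close> and tends to 0 on
  \<open>U\<close>. One minus it stays in [0, 1], so the bound 1 is kept however many balls are
  used.\<close>

lemma C1_test_approx_open:
  assumes U: "open U"
  obtains \<phi> where "\<And>n::nat. \<exists>E. C1_test (\<phi> n) E" "\<And>x. (\<lambda>n. \<phi> n x) \<longlonglongrightarrow> indicator U x"
proof (cases "U = {}")
  case True
  have "C1_test (\<lambda>x. 0) (\<lambda>x. 0)" by (simp add: C1_test_def)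
  then show thesis using that[of "\<lambda>n x. 0"] True by auto
next
  case False
  let ?F = "{ball c R | c R. 0 < R \<and> ball c R \<subseteq> U}"
  obtain F' where F': "F' \<subseteq> ?F" "countable F'" "\<Union>F' = \<Union>?F"
    by (rule Lindelof[of ?F]) auto
  have "\<Union>?F = U"
  proof
    show "U \<subseteq> \<Union>?F"
    proof
      fix x assume "x \<in> U"
      then obtain e where "0 < e" "ball x e \<subseteq> U" using U open_contains_ball by blast
      then show "x \<in> \<Union>?F" by (intro UnionI[of "ball x e"]) auto
    qed
  qed auto
  with F' False have ne: "F' \<noteq> {}" and un: "\<Union>F' = U" by auto
  define B where "B = from_nat_into F'"
  have rB: "range B = F'" unfolding B_def using ne F'(2) by (rule range_from_nat_into)
  have "\<exists>c R. B i = ball c R \<and> 0 < R \<and> ball c R \<subseteq> U" for i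
    using rB F'(1) by blast
  then obtain c R where cR: "\<And>i. B i = ball (c i) (R i)" "\<And>i. 0 < R i" by metis
  have UB: "U = (\<Union>i. ball (c i) (R i))" using un rB cR(1) by auto
  \<comment> \<open>The exponent n drives the product to 0 also where the bumps are positive but
    small; the plain product need not get there.\<close>
  define \<psi> where "\<psi> n x = (\<Prod>i<n. (1 - ball_bump (c i) (R i) x) ^ n)" for n x
  have \<psi>: "\<exists>E. C1_test (\<psi> n) E" for n
    unfolding \<psi>_def using C1_test_ball_bump[OF cR(2)] C1_test_power by (intro C1_test_prod) blast
  have f01: "0 \<le> (1 - ball_bump (c i) (R i) x) ^ n" "(1 - ball_bump (c i) (R i) x) ^ n \<le> 1" for i n x
    using ball_bump(1,2)[OF cR(2)[of i], of "c i" x] by (auto intro: power_le_one)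
  have \<psi>01: "0 \<le> \<psi> n x" "\<psi> n x \<le> 1" for n x
    unfolding \<psi>_def using f01 by (auto intro!: prod_nonneg prod_le_1)
  show thesis
  proof (rule that[of "\<lambda>n x. 1 - \<psi> n x"])
    show "\<exists>E. C1_test (\<lambda>x. 1 - \<psi> n x) E" for n
    proof -
      obtain E where E: "C1_test (\<psi> n) E" using \<psi> by blast
      have "C1_test (\<lambda>x. 1 - \<psi> n x) (\<lambda>x. - E x)"
        unfolding C1_test_def
      proof (intro conjI allI)
        show "((\<lambda>x. 1 - \<psi> n x) has_derivative (\<lambda>h. - E x \<bullet> h)) (at x)" for x
          using has_derivative_diff[OF has_derivative_const[of 1] C1_testD(1)[OF E, of x]] by simp
        show "continuous_on UNIV (\<lambda>x. - E x)" by (intro continuous_intros C1_testD(2)[OF E])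
        show "bounded (range (\<lambda>x. - E x))" using C1_testD(3)[OF E] by (simp add: bounded_iff)
        show "\<bar>1 - \<psi> n x\<bar> \<le> 1" for x using \<psi>01[of n x] by simp
      qed
      then show ?thesis by blast
    qed
    fix x
    show "(\<lambda>n. 1 - \<psi> n x) \<longlonglongrightarrow> indicator U x"
    proof (cases "x \<in> U")
      case False
      have "ball_bump (c i) (R i) x = 0" for i
      proof -
        have "x \<notin> ball (c i) (R i)" using False UB by blast
        then have "\<not> 0 < ball_bump (c i) (R i) x"
          using ball_bump(3)[OF cR(2)[of i], where x=x and c="c i"] by simp
        then show ?thesis using ball_bump(1)[OF cR(2)[of i], of "c i" x] by linarith
      qed
      then show ?thesis using False by (simp add: \<psi>_def)
    next
      case True
      then obtain i where i: "x \<in> ball (c i) (R i)" using UB by auto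
      let ?q = "1 - ball_bump (c i) (R i) x"
      have q: "0 \<le> ?q" "?q < 1" using ball_bump[OF cR(2)[of i], where x=x and c="c i"] i by auto
      have "(\<lambda>n. \<psi> n x) \<longlonglongrightarrow> 0"
      proof (rule Lim_null_comparison)
        have "norm (\<psi> n x) \<le> ?q ^ n" if "i < n" for n
        proof -
          have "\<psi> n x = ?q ^ n * (\<Prod>j\<in>{..<n} - {i}. (1 - ball_bump (c j) (R j) x) ^ n)"
            unfolding \<psi>_def using that by (subst prod.remove[of _ i]) auto
          also have "\<dots> \<le> ?q ^ n * 1"
            using f01 by (intro mult_left_mono prod_le_1) auto
          finally show ?thesis using \<psi>01[of n x] by simp
        qed
        then show "\<forall>\<^sub>F n in sequentially. norm (\<psi> n x) \<le> ?q ^ n"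
          by (intro eventually_mono[OF eventually_gt_at_top[of i]])
        show "(\<lambda>n. ?q ^ n) \<longlonglongrightarrow> 0" using q by (intro LIMSEQ_power_zero) auto
      qed
      then have "(\<lambda>n. 1 - \<psi> n x) \<longlonglongrightarrow> 1 - 0" by (intro tendsto_intros)
      then show ?thesis using True by simp
    qed
  qed
qed

section \<open>Total variation tested by functions\<close>

text \<open>Approximate indicators and dominated convergence give the bound on open sets without
  loss; outer regularity carries it to Borel sets.\<close>

lemma measure_diff_le_from_C1_test:
  fixes n1 n2 :: "(real^2) measure"
  assumes f: "finite_measure n1" "finite_measure n2" and s: "sets n1 = sets borel" "sets n2 = sets borel"
    and B: "\<And>\<phi> D. C1_test \<phi> D \<Longrightarrow> \<bar>(\<integral>x. \<phi> x \<partial>n1) - (\<integral>x. \<phi> x \<partial>n2)\<bar> \<le> B"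
    and A: "A \<in> sets borel"
  shows "\<bar>measure n1 A - measure n2 A\<bar> \<le> B"
proof -
  interpret n1: finite_measure n1 by fact
  interpret n2: finite_measure n2 by fact
  note [measurable_cong] = s
  have opn: "\<bar>measure n1 U - measure n2 U\<bar> \<le> B" if U: "open U" for U
  proof -
    obtain \<phi> where \<phi>: "\<And>n::nat. \<exists>E. C1_test (\<phi> n) E" "\<And>x. (\<lambda>n. \<phi> n x) \<longlonglongrightarrow> indicator U x"
      using C1_test_approx_open[OF U] by blast
    have [measurable]: "\<phi> n \<in> borel_measurable borel" for n using \<phi>(1) C1_testD(6) by blast
    have b: "\<bar>\<phi> n x\<bar> \<le> 1" for n x using \<phi>(1) C1_testD(4) by blast
    have [measurable]: "U \<in> sets borel" using U by simp
    have l: "(\<lambda>n. \<integral>x. \<phi> n x \<partial>m) \<longlonglongrightarrow> measure m U" if "finite_measure m" "sets m = sets borel" for m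
    proof -
      interpret finite_measure m by fact
      note [measurable_cong] = that(2)
      have "(\<lambda>n. \<integral>x. \<phi> n x \<partial>m) \<longlonglongrightarrow> (\<integral>x. indicator U x \<partial>m)"
        by (rule integral_dominated_convergence[where w="\<lambda>_. 1"]) (auto simp: b \<phi>(2))
      then show ?thesis using that(2) U sets_eq_imp_space_eq[OF that(2)] by simp
    qed
    have "(\<lambda>n. \<bar>(\<integral>x. \<phi> n x \<partial>n1) - (\<integral>x. \<phi> n x \<partial>n2)\<bar>) \<longlonglongrightarrow> \<bar>measure n1 U - measure n2 U\<bar>"
      by (intro tendsto_intros l f s)
    then show ?thesis
      by (rule LIMSEQ_le_const2) (use \<phi>(1) B in blast)
  qed
  show ?thesis
  proof (rule field_le_epsilon)
    fix e :: real assume e: "0 < e"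
    have reg: "\<exists>U. A \<subseteq> U \<and> open U \<and> measure m U \<le> measure m A + e / 2"
      if "finite_measure m" "sets m = sets borel" for m
    proof -
      interpret finite_measure m by fact
      have "emeasure m A = (INF U \<in> {U. A \<subseteq> U \<and> open U}. emeasure m U)"
        using that(2) A by (intro outer_regular) auto
      moreover have "emeasure m A < ennreal (measure m A + e / 2)"
        using e by (simp add: emeasure_eq_measure ennreal_less_iff)
      ultimately obtain U where "A \<subseteq> U" "open U" "emeasure m U < ennreal (measure m A + e / 2)"
        by (auto simp: INF_less_iff)
      moreover from this have "measure m U < measure m A + e / 2"
        by (simp only: emeasure_eq_measure ennreal_less_iff measure_nonneg)
      ultimately show ?thesis by (auto intro: less_imp_le)
    qed
    obtain U1 where U1: "A \<subseteq> U1" "open U1" "measure n1 U1 \<le> measure n1 A + e / 2" using reg[OF f(1) s(1)] by blast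
    obtain U2 where U2: "A \<subseteq> U2" "open U2" "measure n2 U2 \<le> measure n2 A + e / 2" using reg[OF f(2) s(2)] by blast
    \<comment> \<open>One open set has to be close to \<open>A\<close> for both measures at once,
      hence the intersection.\<close>
    let ?U = "U1 \<inter> U2"
    have "\<bar>measure n1 ?U - measure n2 ?U\<bar> \<le> B" using U1 U2 by (intro opn) auto
    moreover have "measure n1 A \<le> measure n1 ?U" "measure n1 ?U \<le> measure n1 U1"
      using U1 U2 s by (auto intro!: n1.finite_measure_mono)
    moreover have "measure n2 A \<le> measure n2 ?U" "measure n2 ?U \<le> measure n2 U2"
      using U1 U2 s by (auto intro!: n2.finite_measure_mono)
    ultimately show "\<bar>measure n1 A - measure n2 A\<bar> \<le> B + e"
      using U1(3) U2(3) e by linarith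
  qed
qed

text \<open>Layer cake: \<open>h m\<close> averages the indicators of the level sets {m g >= j}, j =
  1..m, and equals floor (m g) / m, which tends to g. Each level set contributes at most N, so their
  average does too.\<close>

lemma integral_diff_le_unit:
  fixes n1 n2 :: "(real^2) measure"
  assumes f: "finite_measure n1" "finite_measure n2" and s: "sets n1 = sets borel" "sets n2 = sets borel"
    and N: "\<And>A. A \<in> sets borel \<Longrightarrow> \<bar>measure n1 A - measure n2 A\<bar> \<le> N"
    and [measurable]: "g \<in> borel_measurable borel" and g: "\<And>x. 0 \<le> g x" "\<And>x. g x \<le> 1"
  shows "\<bar>(\<integral>x. g x \<partial>n1) - (\<integral>x. g x \<partial>n2)\<bar> \<le> N"
proof -
  define S where "S m j = {x. real j \<le> real m * g x}" for m j :: nat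
  have [measurable]: "S m j \<in> sets borel" for m j unfolding S_def by measurable
  define h where "h m x = (\<Sum>j\<in>{1..m}. indicat_real (S m j) x) / real m" for m x
  have h_floor: "h m x = of_int \<lfloor>real m * g x\<rfloor> / real m" for m x
  proof -
    have "(\<Sum>j\<in>{1..m}. indicat_real (S m j) x) = real (card {j\<in>{1..m}. x \<in> S m j})"
      by (simp add: indicator_def sum.If_cases Int_def)
    also have "{j\<in>{1..m}. x \<in> S m j} = {1..nat \<lfloor>real m * g x\<rfloor>}"
    proof (rule set_eqI)
      fix j
      have "real m * g x \<le> real m" using g(2)[of x] by (simp add: mult_left_le)
      then have "real j \<le> real m * g x \<Longrightarrow> j \<le> m" by linarith
      then show "j \<in> {j\<in>{1..m}. x \<in> S m j} \<longleftrightarrow> j \<in> {1..nat \<lfloor>real m * g x\<rfloor>}"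
        using g(1)[of x] by (auto simp: S_def le_nat_iff le_floor_iff)
    qed
    also have "real (card \<dots>) = of_int \<lfloor>real m * g x\<rfloor>" using g(1)[of x] by simp
    finally show ?thesis by (simp add: h_def)
  qed
  have hb: "\<bar>h m x\<bar> \<le> 1" for m x
  proof -
    have "(\<Sum>j\<in>{1..m}. indicat_real (S m j) x) \<le> (\<Sum>j\<in>{1..m}. 1)" by (intro sum_mono) (simp add: indicator_le_1)
    then show ?thesis by (cases "m = 0") (auto simp: h_def sum_nonneg divide_le_eq)
  qed
  have hl: "(\<lambda>m. h m x) \<longlonglongrightarrow> g x" for x
  proof (rule tendsto_sandwich)
    have "(\<lambda>m. g x - inverse (real m)) \<longlonglongrightarrow> g x - 0" by (intro tendsto_intros lim_inverse_n)
    then show "(\<lambda>m. g x - inverse (real m)) \<longlonglongrightarrow> g x" by simp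
    show "\<forall>\<^sub>F m in sequentially. g x - inverse (real m) \<le> h m x"
      using eventually_gt_at_top[of 0] 
    proof (rule eventually_mono)
      fix m :: nat assume m: "0 < m"
      have "real m * g x - 1 \<le> of_int \<lfloor>real m * g x\<rfloor>" by linarith
      then have "(real m * g x - 1) / real m \<le> h m x" unfolding h_floor by (rule divide_right_mono) simp
      then show "g x - inverse (real m) \<le> h m x" using m by (simp add: diff_divide_distrib inverse_eq_divide)
    qed
    show "\<forall>\<^sub>F m in sequentially. h m x \<le> g x"
      using eventually_gt_at_top[of 0] by (rule eventually_mono) (simp add: h_floor divide_le_eq mult.commute)
  qed auto
  have [measurable]: "h m \<in> borel_measurable borel" for m unfolding h_def by measurable
  have l: "(\<lambda>m. \<integral>x. h m x \<partial>n) \<longlonglongrightarrow> (\<integral>x. g x \<partial>n)"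
    and i: "(\<integral>x. h m x \<partial>n) = (\<Sum>j\<in>{1..m}. measure n (S m j)) / real m"
    if "finite_measure n" "sets n = sets borel" for n m
  proof -
    interpret finite_measure n by fact
    note [measurable_cong] = that(2)
    show "(\<lambda>m. \<integral>x. h m x \<partial>n) \<longlonglongrightarrow> (\<integral>x. g x \<partial>n)"
      by (rule integral_dominated_convergence[where w="\<lambda>_. 1"]) (auto simp: hb hl)
    have "(\<integral>x. indicat_real (S m j) x \<partial>n) = measure n (S m j)" for j
      using sets_eq_imp_space_eq[OF that(2)] by simp
    moreover have "integrable n (indicat_real (S m j))" for j
      by (rule integrable_const_bound[of _ 1]) (auto simp: that(2))
    ultimately show "(\<integral>x. h m x \<partial>n) = (\<Sum>j\<in>{1..m}. measure n (S m j)) / real m"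
      unfolding h_def by (subst Bochner_Integration.integral_divide_zero, subst Bochner_Integration.integral_sum) auto
  qed
  have "\<bar>(\<integral>x. h m x \<partial>n1) - (\<integral>x. h m x \<partial>n2)\<bar> \<le> N" for m
  proof (cases "m = 0")
    case True
    then show ?thesis using N[of "{}"] by (simp add: h_def)
  next
    case False
    have "(\<integral>x. h m x \<partial>n1) - (\<integral>x. h m x \<partial>n2) = (\<Sum>j\<in>{1..m}. measure n1 (S m j) - measure n2 (S m j)) / real m"
      by (simp add: i f s sum_subtractf diff_divide_distrib)
    also have "\<bar>\<dots>\<bar> \<le> (\<Sum>j\<in>{1..m}. N) / real m"
    proof -
      have "\<bar>\<Sum>j\<in>{1..m}. measure n1 (S m j) - measure n2 (S m j)\<bar> \<le> (\<Sum>j\<in>{1..m}. N)"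
        by (rule order_trans[OF sum_abs sum_mono]) (auto intro!: N)
      then show ?thesis unfolding abs_divide using False by (intro divide_mono) auto
    qed
    finally show ?thesis using False by simp
  qed
  moreover have "(\<lambda>m. \<bar>(\<integral>x. h m x \<partial>n1) - (\<integral>x. h m x \<partial>n2)\<bar>) \<longlonglongrightarrow> \<bar>(\<integral>x. g x \<partial>n1) - (\<integral>x. g x \<partial>n2)\<bar>"
    by (intro tendsto_intros l f s)
  ultimately show ?thesis by (intro LIMSEQ_le_const2) auto
qed

text \<open>\<open>g\<close> is moved into [0, 1] as (g + c) / (2 c). Undoing this costs 2 c N for
  the rescaling and c N for the difference of the total masses, whence the factor 3.\<close>

lemma integral_diff_le:
  fixes n1 n2 :: "(real^2) measure"
  assumes f: "finite_measure n1" "finite_measure n2" and s: "sets n1 = sets borel" "sets n2 = sets borel"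
    and N: "\<And>A. A \<in> sets borel \<Longrightarrow> \<bar>measure n1 A - measure n2 A\<bar> \<le> N"
    and [measurable]: "g \<in> borel_measurable borel" and g: "\<And>x. \<bar>g x\<bar> \<le> c"
  shows "\<bar>(\<integral>x. g x \<partial>n1) - (\<integral>x. g x \<partial>n2)\<bar> \<le> 3 * c * N"
proof (cases "c = 0")
  case True
  then have "g x = 0" for x using g[of x] by simp
  then have "g = (\<lambda>_. 0)" by auto
  then show ?thesis using True by simp
next
  case False
  have c: "0 < c" using g[of undefined] False by linarith
  interpret n1: finite_measure n1 by fact
  interpret n2: finite_measure n2 by fact
  note [measurable_cong] = s
  have i: "integrable n1 g" "integrable n2 g"
    by (auto intro!: n1.integrable_const_bound[of _ c] n2.integrable_const_bound[of _ c] simp: g)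
  let ?h = "\<lambda>x. (g x + c) / (2 * c)"
  have h: "0 \<le> ?h x" "?h x \<le> 1" for x
    using g[of x] c by (auto simp: divide_le_eq abs_le_iff)
  have "\<bar>(\<integral>x. ?h x \<partial>n1) - (\<integral>x. ?h x \<partial>n2)\<bar> \<le> N"
    using h by (intro integral_diff_le_unit[OF f s N]) auto
  moreover have "(\<integral>x. ?h x \<partial>n1) = ((\<integral>x. g x \<partial>n1) + c * measure n1 UNIV) / (2 * c)"
    "(\<integral>x. ?h x \<partial>n2) = ((\<integral>x. g x \<partial>n2) + c * measure n2 UNIV) / (2 * c)"
    using i sets_eq_imp_space_eq[OF s(1)] sets_eq_imp_space_eq[OF s(2)] by (simp_all add: mult.commute)
  ultimately have "\<bar>((\<integral>x. g x \<partial>n1) - (\<integral>x. g x \<partial>n2)) + c * (measure n1 UNIV - measure n2 UNIV)\<bar> / (2 * c) \<le> N"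
    using c by (simp add: field_simps abs_divide)
  then have 1: "\<bar>((\<integral>x. g x \<partial>n1) - (\<integral>x. g x \<partial>n2)) + c * (measure n1 UNIV - measure n2 UNIV)\<bar> \<le> 2 * c * N"
    using c by (simp add: field_simps)
  have "\<bar>c * (measure n1 UNIV - measure n2 UNIV)\<bar> \<le> c * N"
    using N[of UNIV] c by (simp add: abs_mult)
  with 1 show ?thesis by (simp add: algebra_simps) 
qed

section \<open>Singular integrals in time\<close>

text \<open>The integrand is singular at one end point, where division by 0 makes its value 0. The
  antiderivative is continuous up to that point, and positivity turns the gauge integral into a
  Lebesgue integral.\<close>

lemma set_integral_inverse_sqrt:
  fixes a b :: real
  assumes "a \<le> b"
  shows "set_integrable lborel {a..b} (\<lambda>t. 1 / sqrt (t - a))" "(LINT t:{a..b}|lborel. 1 / sqrt (t - a)) = 2 * sqrt (b - a)"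
    and "set_integrable lborel {a..b} (\<lambda>t. 1 / sqrt (b - t))" "(LINT t:{a..b}|lborel. 1 / sqrt (b - t)) = 2 * sqrt (b - a)"
proof -
  have gen: "set_integrable lborel {a..b} f \<and> (LINT t:{a..b}|lborel. f t) = I"
    if h: "(f has_integral I) {a..b}" and [measurable]: "f \<in> borel_measurable borel" and nn: "\<And>t. t \<in> {a..b} \<Longrightarrow> 0 \<le> f t"
    for f :: "real \<Rightarrow> real" and I
  proof -
    let ?g = "\<lambda>t. indicator {a..b} t * f t"
    have g0: "0 \<le> ?g t" for t using nn by (auto simp: indicator_def)
    have "(?g has_integral I) UNIV"
    proof -
      have "?g = (\<lambda>t. if t \<in> {a..b} then f t else 0)" by (auto simp: indicator_def fun_eq_iff)
      then show ?thesis using h by (simp only: has_integral_restrict_UNIV)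
    qed
    then have "integral\<^sup>N lborel ?g = I"
      by (intro nn_integral_has_integral_lborel g0) auto
    moreover have "0 \<le> I" using h nn by (rule has_integral_nonneg)
    ultimately have "has_bochner_integral lborel ?g I"
      using g0 by (intro has_bochner_integral_nn_integral) auto
    then show ?thesis by (auto simp: set_integrable_def set_lebesgue_integral_def has_bochner_integral_iff)
  qed
  have "((\<lambda>t. 1 / sqrt (t - a)) has_integral (2 * sqrt (b - a) - 2 * sqrt (a - a))) {a..b}"
    by (rule fundamental_theorem_of_calculus_interior[OF assms])
       (auto intro!: continuous_intros derivative_eq_intros simp: has_real_derivative_iff_has_vector_derivative[symmetric] field_simps)
  from gen[OF this] show "set_integrable lborel {a..b} (\<lambda>t. 1 / sqrt (t - a))" "(LINT t:{a..b}|lborel. 1 / sqrt (t - a)) = 2 * sqrt (b - a)"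
    by auto
  have "((\<lambda>t. 1 / sqrt (b - t)) has_integral (- 2 * sqrt (b - b) - - 2 * sqrt (b - a))) {a..b}"
    by (rule fundamental_theorem_of_calculus_interior[OF assms])
       (auto intro!: continuous_intros derivative_eq_intros simp: has_real_derivative_iff_has_vector_derivative[symmetric] field_simps)
  from gen[OF this] show "set_integrable lborel {a..b} (\<lambda>t. 1 / sqrt (b - t))" "(LINT t:{a..b}|lborel. 1 / sqrt (b - t)) = 2 * sqrt (b - a)"
    by auto
qed

text \<open>At each t one of the two distances is at least half of b - a. The integral of the right
  side over [a, b] is 4 sqrt 2 whatever b - a is: this scale invariance is the critical case, and
  the constant reappears in \<open>mild_contraction\<close>.\<close>

lemma inverse_sqrt_product_le:
  fixes a b t :: real
  assumes "a < b" "a \<le> t" "t \<le> b"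
  shows "1 / sqrt (t - a) * (1 / sqrt (b - t)) \<le> sqrt (2 / (b - a)) * (1 / sqrt (t - a) + 1 / sqrt (b - t))"
proof -
  have aux: "1 / sqrt s \<le> sqrt (2 / (b - a))" if "(b - a) / 2 \<le> s" for s
  proof -
    have "1 / s \<le> 2 / (b - a)" using that assms by (simp add: field_simps)
    then have "sqrt (1 / s) \<le> sqrt (2 / (b - a))" by simp
    then show ?thesis by (simp add: real_sqrt_divide)
  qed
  have nn: "0 \<le> 1 / sqrt (t - a)" "0 \<le> 1 / sqrt (b - t)" "0 \<le> sqrt (2 / (b - a))" using assms by auto
  consider "(b - a) / 2 \<le> t - a" | "(b - a) / 2 \<le> b - t"
    by (cases "(b - a) / 2 \<le> t - a") (auto simp: field_simps)
  then show ?thesis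
  proof cases
    case 1
    show ?thesis using mult_right_mono[OF aux[OF 1] nn(2)] mult_nonneg_nonneg[OF nn(3) nn(1)] by (simp only: distrib_left)
  next
    case 2
    show ?thesis using mult_left_mono[OF aux[OF 2] nn(1)] mult_nonneg_nonneg[OF nn(3) nn(2)] by (simp only: distrib_left mult.commute)
  qed
qed

section \<open>Weak solutions of the SDE\<close>

lemma set_integral_split:
  fixes f :: "real \<Rightarrow> 'a::euclidean_space"
  assumes f: "set_integrable lborel {a..c} f" and "a \<le> b" "b \<le> c"
  shows "(LINT t:{a..c}|lborel. f t) = (LINT t:{a..b}|lborel. f t) + (LINT t:{b..c}|lborel. f t)"
proof -
  have "set_integrable lborel {a..b} f" "set_integrable lborel {b..c} f"
    by (rule set_integrable_subset[OF f]; use assms in auto)+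
  then show ?thesis
    using f Henstock_Kurzweil_Integration.integral_combine[of a b c f] assms
    by (simp add: set_borel_integral_eq_integral)
qed

text \<open>Time is rounded down to a grid of mesh 1 / (n + 1); as paths are continuous, the rounded
  processes converge. Continuity is asked on the whole line, so processes living on [s, oo) are
  frozen by \<open>max s\<close> below.\<close>

lemma borel_measurable_continuous_process:
  fixes f :: "real \<Rightarrow> 'a \<Rightarrow> real^2"
  assumes m: "\<And>t. f t \<in> borel_measurable M" and c: "\<And>\<omega>. \<omega> \<in> space M \<Longrightarrow> continuous_on UNIV (\<lambda>t. f t \<omega>)"
  shows "(\<lambda>p. f (fst p) (snd p)) \<in> borel_measurable (borel \<Otimes>\<^sub>M M)"
proof (rule borel_measurable_LIMSEQ_metric)
  let ?t = "\<lambda>n t. real_of_int \<lfloor>real (Suc n) * t\<rfloor> / real (Suc n)"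
  show "(\<lambda>p. f (?t n (fst p)) (snd p)) \<in> borel_measurable (borel \<Otimes>\<^sub>M M)" for n
    by (rule measurable_compose_countable[where f="\<lambda>i p. f (real_of_int i / real (Suc n)) (snd p)"])
       (auto intro!: measurable_compose[OF measurable_snd m])
  fix p assume "p \<in> space (borel \<Otimes>\<^sub>M M :: (real \<times> 'a) measure)"
  then have p: "snd p \<in> space M" by (auto simp: space_pair_measure)
  have "(\<lambda>n. ?t n (fst p)) \<longlonglongrightarrow> fst p"
  proof (rule tendsto_sandwich)
    have "(\<lambda>n. fst p - inverse (real (Suc n))) \<longlonglongrightarrow> fst p - 0" by (intro tendsto_intros LIMSEQ_inverse_real_of_nat)
    then show "(\<lambda>n. fst p - inverse (real (Suc n))) \<longlonglongrightarrow> fst p" by simp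
    have "fst p - inverse (real (Suc n)) \<le> ?t n (fst p)" for n
    proof -
      have "real (Suc n) * fst p - 1 \<le> of_int \<lfloor>real (Suc n) * fst p\<rfloor>" by linarith
      then have "(real (Suc n) * fst p - 1) / real (Suc n) \<le> ?t n (fst p)" by (rule divide_right_mono) simp
      then show ?thesis by (simp add: diff_divide_distrib inverse_eq_divide del: of_nat_Suc)
    qed
    then show "\<forall>\<^sub>F n in sequentially. fst p - inverse (real (Suc n)) \<le> ?t n (fst p)" by simp
    have "?t n (fst p) \<le> fst p" for n
      by (simp add: divide_le_eq mult.commute del: of_nat_Suc)
    then show "\<forall>\<^sub>F n in sequentially. ?t n (fst p) \<le> fst p" by simp
  qed auto
  then show "(\<lambda>n. f (?t n (fst p)) (snd p)) \<longlonglongrightarrow> f (fst p) (snd p)"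
    by (rule continuous_on_tendsto_compose[OF c[OF p]]) auto
qed

text \<open>\<open>\<beta>\<close> measures a drift of order 1 / sqrt (t - s), singular but
  integrable at the start. It bounds the potential and not just \<open>bs_K\<close>, because the
  exchange of integrals later requires the norm inside the integral.\<close>

locale sde =
  fixes \<nu> s :: real and \<mu> :: "real \<Rightarrow> (real^2) measure" and M :: "'a measure"
    and Fl :: "real \<Rightarrow> 'a measure" and W X :: "real \<Rightarrow> 'a \<Rightarrow> real^2" and \<beta> :: real
  assumes nu: "0 < \<nu>" and sol: "weak_solution \<nu> s \<mu> M Fl W X"
    and lawX: "\<And>t. s \<le> t \<Longrightarrow> distr M borel (X t) = \<mu> t"
    and \<beta>: "0 \<le> \<beta>" "\<And>t x. s < t \<Longrightarrow> bs_potential (\<mu> t) x \<le> ennreal (\<beta> / sqrt (t - s))"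
begin

lemmas sol_conjs = sol[unfolded weak_solution_def]

lemma prob: "prob_space M"
  by (rule sol_conjs[THEN conjunct1])

lemma subalg: "s \<le> t \<Longrightarrow> subalgebra M (Fl t)"
  using sol_conjs[THEN conjunct2, THEN conjunct1] by blast

lemma Fl_mono: "s \<le> r \<Longrightarrow> r \<le> t \<Longrightarrow> sets (Fl r) \<subseteq> sets (Fl t)"
  using sol_conjs[THEN conjunct2, THEN conjunct2, THEN conjunct1] by blast

lemma W_adapted: "s \<le> t \<Longrightarrow> W t \<in> borel_measurable (Fl t)"
  using sol_conjs[THEN conjunct2, THEN conjunct2, THEN conjunct2, THEN conjunct1] by blast

lemma W_cont: "\<omega> \<in> space M \<Longrightarrow> continuous_on {s..} (\<lambda>t. W t \<omega>)"
  using sol_conjs[THEN conjunct2, THEN conjunct2, THEN conjunct2, THEN conjunct2, THEN conjunct1] by blast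

lemma W_law: "s \<le> r \<Longrightarrow> r < t \<Longrightarrow> distr M borel (\<lambda>\<omega>. W t \<omega> - W r \<omega>) = gauss2 (t - r)"
  using sol_conjs[THEN conjunct2, THEN conjunct2, THEN conjunct2, THEN conjunct2, THEN conjunct2, THEN conjunct2, THEN conjunct1] by blast

lemma W_indep: "s \<le> r \<Longrightarrow> r < t \<Longrightarrow> A \<in> sets (Fl r) \<Longrightarrow> B \<in> sets borel \<Longrightarrow>
     measure M (A \<inter> {\<omega>\<in>space M. W t \<omega> - W r \<omega> \<in> B}) = measure M A * measure M {\<omega>\<in>space M. W t \<omega> - W r \<omega> \<in> B}"
  using sol_conjs[THEN conjunct2, THEN conjunct2, THEN conjunct2, THEN conjunct2, THEN conjunct2, THEN conjunct2, THEN conjunct1] by blast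

lemma X_adapted: "s \<le> t \<Longrightarrow> X t \<in> borel_measurable (Fl t)"
  using sol_conjs[THEN conjunct2, THEN conjunct2, THEN conjunct2, THEN conjunct2, THEN conjunct2, THEN conjunct2, THEN conjunct2, THEN conjunct1] by blast

lemma X_cont: "\<omega> \<in> space M \<Longrightarrow> continuous_on {s..} (\<lambda>t. X t \<omega>)"
  using sol_conjs[THEN conjunct2, THEN conjunct2, THEN conjunct2, THEN conjunct2, THEN conjunct2, THEN conjunct2, THEN conjunct2, THEN conjunct2, THEN conjunct1] by blast

lemma X_eq: "AE \<omega> in M. \<forall>t\<ge>s. set_integrable lborel {s..t} (\<lambda>\<tau>. bs_K (\<mu> \<tau>) (X \<tau> \<omega>)) \<and>
        X t \<omega> = X s \<omega> + (LINT \<tau>:{s..t}|lborel. bs_K (\<mu> \<tau>) (X \<tau> \<omega>)) + sqrt (2 * \<nu>) *\<^sub>R (W t \<omega> - W s \<omega>)"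
  by (rule sol_conjs[THEN conjunct2, THEN conjunct2, THEN conjunct2, THEN conjunct2, THEN conjunct2, THEN conjunct2, THEN conjunct2, THEN conjunct2, THEN conjunct2])

sublocale prob_space M by (rule prob)

lemma space_Fl: "s \<le> t \<Longrightarrow> space (Fl t) = space M"
  using subalg by (simp add: subalgebra_def)

lemma Fl_measurable: "s \<le> t \<Longrightarrow> f \<in> measurable (Fl t) N \<Longrightarrow> f \<in> measurable M N"
  using measurable_from_subalg[OF subalg] .

lemma Fl_measurable_mono:
  assumes "s \<le> r" "r \<le> t" "f \<in> measurable (Fl r) N" shows "f \<in> measurable (Fl t) N"
proof -
  have "subalgebra (Fl t) (Fl r)" using assms Fl_mono[of r t] space_Fl[of r] space_Fl[of t] by (simp add: subalgebra_def)
  then show ?thesis using assms(3) by (rule measurable_from_subalg)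
qed

lemma X_measurable: "s \<le> t \<Longrightarrow> X t \<in> borel_measurable M"
  and W_measurable: "s \<le> t \<Longrightarrow> W t \<in> borel_measurable M"
  using Fl_measurable X_adapted W_adapted by blast+

lemma sets_mu: "s \<le> t \<Longrightarrow> sets (\<mu> t) = sets borel"
  using lawX[of t] by (metis sets_distr)

lemma prob_mu: "s \<le> t \<Longrightarrow> prob_space (\<mu> t)"
  using lawX[of t] prob_space_distr[OF X_measurable[of t]] by simp

text \<open>The Gaussian of variance v is the law of a Brownian increment over a time of length v,
  hence of mass 1.\<close>

lemma prob_gauss2: "0 < v \<Longrightarrow> prob_space (gauss2 v)"
  using W_law[of s "s + v"] prob_space_distr[of "\<lambda>\<omega>. W (s + v) \<omega> - W s \<omega>" borel] W_measurable[of s] W_measurable[of "s + v"]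
  by simp

lemma norm_drift_le: "s < t \<Longrightarrow> norm (bs_K (\<mu> t) x) \<le> \<beta> / sqrt (t - s)"
  using \<beta> sets_mu[of t] by (intro norm_bs_K_le) auto

text \<open>Independence of the increment from the past as a product formula: on \<open>Fl r\<close>
  times the Borel sets, the pair of \<omega> and the increment has a product law. The noise is
  averaged out while every dependence on the past stays untouched.\<close>

lemma increment_integral:
  fixes f :: "'a \<times> (real^2) \<Rightarrow> real"
  assumes r: "s \<le> r" "r < t" and f[measurable]: "f \<in> borel_measurable (Fl r \<Otimes>\<^sub>M borel)"
    and b: "\<And>p. \<bar>f p\<bar> \<le> c"
  shows "(\<integral>\<omega>. f (\<omega>, W t \<omega> - W r \<omega>) \<partial>M) = (\<integral>\<omega>. \<integral>z. f (\<omega>, z) \<partial>gauss2 (t - r) \<partial>M)"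
proof -
  \<comment> \<open>The product structure holds only for the restriction to \<open>Fl r\<close>; a
    larger sigma-algebra may see the increment itself.\<close>
  let ?Mr = "restr_to_subalg M (Fl r)" and ?D = "\<lambda>\<omega>. W t \<omega> - W r \<omega>"
  note sub = subalg[OF r(1)]
  have [measurable]: "?D \<in> borel_measurable M" using r W_measurable[of r] W_measurable[of t] by simp
  have setsr: "sets ?Mr = sets (Fl r)" using sub by (rule sets_restr_to_subalg)
  interpret Mr: prob_space ?Mr
  proof (rule prob_spaceI)
    have "space M \<in> sets (Fl r)" using sets.top[of "Fl r"] space_Fl[OF r(1)] by simp
    then show "emeasure ?Mr (space ?Mr) = 1"
      by (simp add: space_restr_to_subalg emeasure_restr_to_subalg[OF sub] emeasure_space_1)
  qed
  interpret G: prob_space "gauss2 (t - r)" using r by (intro prob_gauss2) simp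
  interpret P: pair_sigma_finite ?Mr "gauss2 (t - r)" ..
  have idm: "(\<lambda>\<omega>. \<omega>) \<in> measurable M (Fl r)"
    by (rule Fl_measurable[OF r(1)]) simp
  have pm[measurable]: "(\<lambda>\<omega>. (\<omega>, ?D \<omega>)) \<in> measurable M (Fl r \<Otimes>\<^sub>M borel)"
    using idm by (intro measurable_Pair) auto
  have setsp: "sets (?Mr \<Otimes>\<^sub>M gauss2 (t - r)) = sets (Fl r \<Otimes>\<^sub>M borel)"
    by (intro sets_pair_measure_cong setsr) simp
  have eq: "?Mr \<Otimes>\<^sub>M gauss2 (t - r) = distr M (Fl r \<Otimes>\<^sub>M borel) (\<lambda>\<omega>. (\<omega>, ?D \<omega>))"
  proof (rule pair_measure_eqI)
    show "sigma_finite_measure ?Mr" "sigma_finite_measure (gauss2 (t - r))" by unfold_locales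
    show "sets (?Mr \<Otimes>\<^sub>M gauss2 (t - r)) = sets (distr M (Fl r \<Otimes>\<^sub>M borel) (\<lambda>\<omega>. (\<omega>, ?D \<omega>)))" using setsp by simp
    fix A B assume AB: "A \<in> sets ?Mr" "B \<in> sets (gauss2 (t - r))"
    then have A: "A \<in> sets (Fl r)" and B[measurable]: "B \<in> sets borel" using setsr by auto
    have AM[measurable]: "A \<in> sets M" using A sub by (auto simp: subalgebra_def)
    have gB: "emeasure (gauss2 (t - r)) B = emeasure M {\<omega>\<in>space M. ?D \<omega> \<in> B}"
      unfolding W_law[OF r, symmetric] by (subst emeasure_distr) (auto simp: vimage_def Int_def conj_commute)
    have "emeasure (distr M (Fl r \<Otimes>\<^sub>M borel) (\<lambda>\<omega>. (\<omega>, ?D \<omega>))) (A \<times> B) = emeasure M (A \<inter> {\<omega>\<in>space M. ?D \<omega> \<in> B})"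
      using A B sets.sets_into_space[OF AM] by (subst emeasure_distr) (auto intro!: arg_cong2[where f=emeasure])
    also have "\<dots> = emeasure M A * emeasure M {\<omega>\<in>space M. ?D \<omega> \<in> B}"
      using W_indep[OF r A B] by (simp add: emeasure_eq_measure ennreal_mult'' [symmetric])
    also have "\<dots> = emeasure ?Mr A * emeasure (gauss2 (t - r)) B"
      using A by (simp add: gB emeasure_restr_to_subalg[OF sub])
    finally show "emeasure ?Mr A * emeasure (gauss2 (t - r)) B = emeasure (distr M (Fl r \<Otimes>\<^sub>M borel) (\<lambda>\<omega>. (\<omega>, ?D \<omega>))) (A \<times> B)" ..
  qed
  have fm: "f \<in> borel_measurable (?Mr \<Otimes>\<^sub>M gauss2 (t - r))"
    using f measurable_cong_sets[OF setsp refl] by blast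
  interpret PP: prob_space "?Mr \<Otimes>\<^sub>M gauss2 (t - r)"
    unfolding eq by (rule prob_space_distr) measurable
  have int: "integrable (?Mr \<Otimes>\<^sub>M gauss2 (t - r)) f"
    by (rule PP.integrable_const_bound[of _ c]) (use b fm in auto)
  have "(\<integral>\<omega>. f (\<omega>, ?D \<omega>) \<partial>M) = (\<integral>p. f p \<partial>distr M (Fl r \<Otimes>\<^sub>M borel) (\<lambda>\<omega>. (\<omega>, ?D \<omega>)))"
    by (rule integral_distr[symmetric]) measurable
  also have "\<dots> = (\<integral>\<omega>. \<integral>z. f (\<omega>, z) \<partial>gauss2 (t - r) \<partial>?Mr)"
    unfolding eq[symmetric] by (rule P.integral_fst'[OF int, symmetric])
  also have "\<dots> = (\<integral>\<omega>. \<integral>z. f (\<omega>, z) \<partial>gauss2 (t - r) \<partial>M)"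
  proof (rule integral_subalgebra2[OF sub])
    have "f \<in> borel_measurable (Fl r \<Otimes>\<^sub>M gauss2 (t - r))"
      using f by (simp cong: measurable_cong_sets sets_pair_measure_cong)
    then show "(\<lambda>\<omega>. \<integral>z. f (\<omega>, z) \<partial>gauss2 (t - r)) \<in> borel_measurable (Fl r)"
      by (intro G.borel_measurable_lebesgue_integral) (simp add: split_beta')
  qed
  finally show ?thesis .
qed
end

section \<open>Mild formulation\<close>

text \<open>With \<open>D\<close> the gradient of \<phi>, this is the gradient at time v of the
  semigroup generated by \<nu> times the Laplacian, since sqrt (2 \<nu>) z has covariance 2 \<nu>
  v.\<close>

definition heat_gradient :: "real \<Rightarrow> (real^2 \<Rightarrow> real^2) \<Rightarrow> real \<Rightarrow> real^2 \<Rightarrow> real^2" where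
  "heat_gradient \<nu> D v x = (\<integral>z. D (x + sqrt (2 * \<nu>) *\<^sub>R z) \<partial>gauss2 v)"

text \<open>Duhamel's formula tested with \<phi>. The integrand is prescribed on the open interval
  only: at T the variance degenerates, and at t0 the drift may be singular; \<open>g\<close> is an
  integrable version. Every t0 >= r is allowed so that uniqueness can be iterated, and
  \<open>b\<close> is a separate argument so that linear and nonlinear equations are covered
  alike.\<close>

definition mild_solution :: "real \<Rightarrow> (real \<Rightarrow> real^2 \<Rightarrow> real^2) \<Rightarrow> (real \<Rightarrow> (real^2) measure) \<Rightarrow> real \<Rightarrow> bool" where
  "mild_solution \<nu> b n r \<longleftrightarrow> (\<forall>t0 T \<phi> D. r \<le> t0 \<and> t0 < T \<and> C1_test \<phi> D \<longrightarrow>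
     (\<exists>g. set_integrable lborel {t0..T} g \<and>
       (\<forall>\<tau>. t0 < \<tau> \<and> \<tau> < T \<longrightarrow> g \<tau> = (\<integral>x. heat_gradient \<nu> D (T - \<tau>) x \<bullet> b \<tau> x \<partial>n \<tau>)) \<and>
       (\<integral>x. \<phi> x \<partial>n T) = (\<integral>x. (\<integral>z. \<phi> (x + sqrt (2 * \<nu>) *\<^sub>R z) \<partial>gauss2 (T - t0)) \<partial>n t0)
          + (LINT \<tau>:{t0..T}|lborel. g \<tau>)))"

lemma measurable_heat_gradient:
  assumes "0 < v" "prob_space (gauss2 v)" and [measurable]: "D \<in> borel_measurable borel"
  shows "heat_gradient \<nu> D v \<in> borel_measurable borel"
proof -
  interpret prob_space "gauss2 v" by fact
  have "(\<lambda>x. \<integral>z. D (x + sqrt (2 * \<nu>) *\<^sub>R z) \<partial>gauss2 v) \<in> borel_measurable borel"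
    by measurable
  then show ?thesis by (simp add: heat_gradient_def[abs_def])
qed

lemma measurable_heat:
  fixes \<phi> :: "real^2 \<Rightarrow> real"
  assumes "prob_space (gauss2 v)" and [measurable]: "\<phi> \<in> borel_measurable borel"
  shows "(\<lambda>x. \<integral>z. \<phi> (x + c *\<^sub>R z) \<partial>gauss2 v) \<in> borel_measurable borel"
proof -
  interpret prob_space "gauss2 v" by fact
  show ?thesis by measurable
qed

context sde
begin

text \<open>The drift is an expectation of k (x - X t), and X is jointly measurable because its
  paths are continuous; this yields measurability jointly in time and space.\<close>

lemma measurable_bs_K: "(\<lambda>p. bs_K (\<mu> (max s (fst p))) (snd p)) \<in> borel_measurable (borel \<Otimes>\<^sub>M borel)"
proof -
  have c: "continuous_on UNIV (\<lambda>t. X (max s t) \<omega>)" if "\<omega> \<in> space M" for \<omega>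
    by (rule continuous_on_compose2[OF X_cont[OF that]]) (auto intro!: continuous_intros)
  have [measurable]: "(\<lambda>p. X (max s (fst p)) (snd p)) \<in> borel_measurable (borel \<Otimes>\<^sub>M M)"
    by (rule borel_measurable_continuous_process[where f="\<lambda>t. X (max s t)"]) (auto simp: c intro: X_measurable)
  have eq: "bs_K (\<mu> (max s (fst p))) (snd p) = (\<integral>\<omega>. bs_k (snd p - X (max s (fst p)) \<omega>) \<partial>M)" for p :: "real \<times> (real^2)"
    unfolding bs_K_def by (subst lawX[symmetric], simp, subst integral_distr) (auto intro: X_measurable)
  have "(\<lambda>(p :: real \<times> (real^2), \<omega>). X (max s (fst p)) \<omega>) \<in> borel_measurable ((borel \<Otimes>\<^sub>M borel) \<Otimes>\<^sub>M M)"
    using measurable_compose[of "\<lambda>q :: (real \<times> (real^2)) \<times> 'a. (fst (fst q), snd q)" "(borel \<Otimes>\<^sub>M borel) \<Otimes>\<^sub>M M" "borel \<Otimes>\<^sub>M M" "\<lambda>p. X (max s (fst p)) (snd p)" borel]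
    by (simp add: split_beta')
  then have "(\<lambda>(p :: real \<times> (real^2), \<omega>). bs_k (snd p - X (max s (fst p)) \<omega>)) \<in> borel_measurable ((borel \<Otimes>\<^sub>M borel) \<Otimes>\<^sub>M M)"
    by (simp add: split_beta')
  then show ?thesis unfolding eq by (rule borel_measurable_lebesgue_integral)
qed

lemma measurable_bs_K_at: "s \<le> t \<Longrightarrow> bs_K (\<mu> t) \<in> borel_measurable borel"
  using measurable_compose[OF measurable_Pair1'[of t borel borel] measurable_bs_K] by (simp add: max_def)

text \<open>Subtracting the equation at t from that at T moves the future noise to the left and
  leaves an absolutely continuous function of t on the right. One null set serves all t and
  T.\<close>

lemma path_identity:
  "AE \<omega> in M. \<forall>t T. s \<le> t \<and> t \<le> T \<longrightarrow> set_integrable lborel {t..T} (\<lambda>\<tau>. bs_K (\<mu> \<tau>) (X \<tau> \<omega>)) \<and>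
     X t \<omega> + sqrt (2 * \<nu>) *\<^sub>R (W T \<omega> - W t \<omega>) = X T \<omega> - (LINT \<tau>:{t..T}|lborel. bs_K (\<mu> \<tau>) (X \<tau> \<omega>))"
  using X_eq
proof (rule eventually_mono, intro allI impI)
  fix \<omega> t T
  let ?f = "\<lambda>\<tau>. bs_K (\<mu> \<tau>) (X \<tau> \<omega>)"
  assume h: "\<forall>t\<ge>s. set_integrable lborel {s..t} ?f \<and>
        X t \<omega> = X s \<omega> + (LINT \<tau>:{s..t}|lborel. ?f \<tau>) + sqrt (2 * \<nu>) *\<^sub>R (W t \<omega> - W s \<omega>)" and t: "s \<le> t \<and> t \<le> T"
  have i: "set_integrable lborel {s..T} ?f" using h t by (meson order_trans)
  have 1: "X T \<omega> = X s \<omega> + (LINT \<tau>:{s..T}|lborel. ?f \<tau>) + sqrt (2 * \<nu>) *\<^sub>R (W T \<omega> - W s \<omega>)"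
    "X t \<omega> = X s \<omega> + (LINT \<tau>:{s..t}|lborel. ?f \<tau>) + sqrt (2 * \<nu>) *\<^sub>R (W t \<omega> - W s \<omega>)"
    using h t by (meson order_trans)+
  have 2: "(LINT \<tau>:{s..T}|lborel. ?f \<tau>) = (LINT \<tau>:{s..t}|lborel. ?f \<tau>) + (LINT \<tau>:{t..T}|lborel. ?f \<tau>)"
    using t by (intro set_integral_split[OF i]) auto
  have 3: "set_integrable lborel {t..T} ?f" by (rule set_integrable_subset[OF i]) (use t in auto)
  show "set_integrable lborel {t..T} ?f \<and> X t \<omega> + sqrt (2 * \<nu>) *\<^sub>R (W T \<omega> - W t \<omega>) = X T \<omega> - (LINT \<tau>:{t..T}|lborel. ?f \<tau>)"
    using 3 unfolding 1 2 by (simp add: algebra_simps)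
qed

text \<open>The chain rule is applied path by path, then expectation and Fubini. At a fixed \<tau>
  the weight, the position and the drift are known, while the increment of W up to T is independent
  of them; averaging over it turns D (Y \<tau>) into the heat gradient.\<close>

lemma mild_formula:
  assumes r: "s \<le> r" "r \<le> t0" "t0 < T" and T: "C1_test \<phi> D"
    and \<rho>: "\<rho> \<in> borel_measurable (Fl r)" and \<rho>01: "\<And>\<omega>. 0 \<le> \<rho> \<omega>" "\<And>\<omega>. \<rho> \<omega> \<le> (1::real)"
  shows "\<exists>g. set_integrable lborel {t0..T} g \<and>
       (\<forall>\<tau>. t0 < \<tau> \<and> \<tau> < T \<longrightarrow> g \<tau> = (\<integral>\<omega>. \<rho> \<omega> * (heat_gradient \<nu> D (T - \<tau>) (X \<tau> \<omega>) \<bullet> bs_K (\<mu> \<tau>) (X \<tau> \<omega>)) \<partial>M)) \<and>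
       (\<integral>\<omega>. \<rho> \<omega> * \<phi> (X T \<omega>) \<partial>M) = (\<integral>\<omega>. \<rho> \<omega> * (\<integral>z. \<phi> (X t0 \<omega> + sqrt (2 * \<nu>) *\<^sub>R z) \<partial>gauss2 (T - t0)) \<partial>M)
          + (LINT \<tau>:{t0..T}|lborel. g \<tau>)"
proof -
  let ?c = "sqrt (2 * \<nu>)"
  have st0: "s \<le> t0" "s \<le> T" using r by auto
  note [measurable] = C1_testD(6,7)[OF T]
  have [measurable]: "\<rho> \<in> borel_measurable M" using \<rho> r(1) Fl_measurable by blast
  obtain L where L: "0 < L" "\<And>x. norm (D x) \<le> L" using C1_test_bound[OF T] by blast
  define Y where "Y \<tau> \<omega> = X (max s \<tau>) \<omega> + ?c *\<^sub>R (W T \<omega> - W (max s \<tau>) \<omega>)" for \<tau> \<omega>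
  have cont: "continuous_on UNIV (\<lambda>t. X (max s t) \<omega>)" "continuous_on UNIV (\<lambda>t. W (max s t) \<omega>)" if "\<omega> \<in> space M" for \<omega>
    by (rule continuous_on_compose2[OF X_cont[OF that]] continuous_on_compose2[OF W_cont[OF that]]; auto intro!: continuous_intros)+
  have [measurable]: "(\<lambda>p. X (max s (fst p)) (snd p)) \<in> borel_measurable (borel \<Otimes>\<^sub>M M)"
    by (rule borel_measurable_continuous_process[where f="\<lambda>t. X (max s t)"]) (auto simp: cont intro: X_measurable)
  have [measurable]: "(\<lambda>p. W (max s (fst p)) (snd p)) \<in> borel_measurable (borel \<Otimes>\<^sub>M M)"
    by (rule borel_measurable_continuous_process[where f="\<lambda>t. W (max s t)"]) (auto simp: cont intro: W_measurable)
  have [measurable]: "W T \<in> borel_measurable M" "X T \<in> borel_measurable M" "X t0 \<in> borel_measurable M" "W t0 \<in> borel_measurable M"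
    using st0 by (auto intro: W_measurable X_measurable)
  have bm[measurable]: "(\<lambda>p. bs_K (\<mu> (max s (fst p))) (X (max s (fst p)) (snd p))) \<in> borel_measurable (borel \<Otimes>\<^sub>M M)"
    using measurable_compose[of "\<lambda>p. (fst p, X (max s (fst p)) (snd p))" "borel \<Otimes>\<^sub>M M" "borel \<Otimes>\<^sub>M borel" _ borel, OF _ measurable_bs_K]
    by simp
  \<comment> \<open>Freezing by \<open>max s\<close> and cutting off by the indicator make the
    integrand jointly measurable on the whole time axis, as Fubini requires.\<close>
  define G where "G \<tau> \<omega> = indicator {t0..T} \<tau> * (\<rho> \<omega> * (D (Y \<tau> \<omega>) \<bullet> bs_K (\<mu> (max s \<tau>)) (X (max s \<tau>) \<omega>)))" for \<tau> \<omega>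
  have Gm: "(\<lambda>p. G (fst p) (snd p)) \<in> borel_measurable (borel \<Otimes>\<^sub>M M)"
    unfolding G_def Y_def by measurable
  have dot: "\<bar>D y \<bullet> v\<bar> \<le> L * norm v" for y v
    using Cauchy_Schwarz_ineq2[of "D y" v] mult_right_mono[OF L(2)[of y], of "norm v"] by simp
  have Gb: "\<bar>G \<tau> \<omega>\<bar> \<le> indicator {t0..T} \<tau> * (L * (\<beta> / sqrt (\<tau> - s)))" if "s < \<tau>" for \<tau> \<omega>
  proof -
    have "\<bar>\<rho> \<omega> * (D (Y \<tau> \<omega>) \<bullet> bs_K (\<mu> (max s \<tau>)) (X (max s \<tau>) \<omega>))\<bar> \<le> 1 * (L * (\<beta> / sqrt (\<tau> - s)))"
      unfolding abs_mult
    proof (rule mult_mono)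
      show "\<bar>\<rho> \<omega>\<bar> \<le> 1" using \<rho>01[of \<omega>] by simp
      have "\<bar>D (Y \<tau> \<omega>) \<bullet> bs_K (\<mu> (max s \<tau>)) (X (max s \<tau>) \<omega>)\<bar> \<le> L * norm (bs_K (\<mu> (max s \<tau>)) (X (max s \<tau>) \<omega>))" by (rule dot)
      also have "\<dots> \<le> L * (\<beta> / sqrt (\<tau> - s))"
        using norm_drift_le[OF that] that L(1) by (intro mult_left_mono) (auto simp: max_def)
      finally show "\<bar>D (Y \<tau> \<omega>) \<bullet> bs_K (\<mu> (max s \<tau>)) (X (max s \<tau>) \<omega>)\<bar> \<le> L * (\<beta> / sqrt (\<tau> - s))" .
    qed auto
    then show ?thesis by (simp add: G_def indicator_def)
  qed
  let ?w = "\<lambda>\<tau>. indicator {t0..T} \<tau> * (L * (\<beta> / sqrt (\<tau> - s)))"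
  have wi: "integrable lborel ?w"
  proof -
    have "set_integrable lborel {t0..T} (\<lambda>t. 1 / sqrt (t - s))"
      by (rule set_integrable_subset[OF set_integral_inverse_sqrt(1)[OF st0(2)]]) (use r in auto)
    then have "integrable lborel (\<lambda>t. (L * \<beta>) * (indicator {t0..T} t * (1 / sqrt (t - s))))"
      unfolding set_integrable_def real_scaleR_def by (rule integrable_mult_right)
    then show ?thesis by (simp add: ac_simps)
  qed
  interpret P: pair_sigma_finite lborel M ..
  have Gm': "(\<lambda>p. G (fst p) (snd p)) \<in> borel_measurable (lborel \<Otimes>\<^sub>M M)"
    using Gm by (simp cong: measurable_cong_sets sets_pair_measure_cong)
  have Gm1[measurable]: "G \<tau> \<in> borel_measurable M" for \<tau>
    using measurable_compose[OF measurable_Pair1'[of \<tau> lborel M] Gm'] by simp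
  \<comment> \<open>For t0 = s the drift bound is silent at \<tau> = s; this single time is
    discarded.\<close>
  have AEs: "AE \<tau> in lborel. \<tau> \<noteq> s" by (rule AE_lborel_singleton)
  have GI: "integrable (lborel \<Otimes>\<^sub>M M) (case_prod G)"
  proof (rule P.Fubini_integrable)
    show "case_prod G \<in> borel_measurable (lborel \<Otimes>\<^sub>M M)" using Gm' by (simp add: split_beta')
    show "integrable lborel (\<lambda>\<tau>. \<integral>\<omega>. norm (case (\<tau>, \<omega>) of (x, xa) \<Rightarrow> G x xa) \<partial>M)"
    proof (rule Bochner_Integration.integrable_bound[OF wi])
      have "(\<lambda>(\<tau>, \<omega>). norm (G \<tau> \<omega>)) \<in> borel_measurable (lborel \<Otimes>\<^sub>M M)" using Gm' by (simp add: split_beta')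
      then show "(\<lambda>\<tau>. \<integral>\<omega>. norm (case (\<tau>, \<omega>) of (x, xa) \<Rightarrow> G x xa) \<partial>M) \<in> borel_measurable lborel"
        by (simp add: borel_measurable_lebesgue_integral)
      show "AE \<tau> in lborel. norm (\<integral>\<omega>. norm (case (\<tau>, \<omega>) of (x, xa) \<Rightarrow> G x xa) \<partial>M) \<le> norm (?w \<tau>)"
        using AEs
      proof (rule eventually_mono)
        fix \<tau> assume "\<tau> \<noteq> s"
        show "norm (\<integral>\<omega>. norm (case (\<tau>, \<omega>) of (x, xa) \<Rightarrow> G x xa) \<partial>M) \<le> norm (?w \<tau>)"
        proof (cases "s < \<tau>")
          case True
          have "(\<integral>\<omega>. \<bar>G \<tau> \<omega>\<bar> \<partial>M) \<le> ?w \<tau>"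
            using Gb[OF True] by (intro integral_le_const integrable_const_bound[of _ "?w \<tau>"]) auto
          moreover have "0 \<le> (\<integral>\<omega>. \<bar>G \<tau> \<omega>\<bar> \<partial>M)" by simp
          ultimately show ?thesis by (simp only: prod.case real_norm_def)
        next
          case False
          then have "G \<tau> = (\<lambda>_. 0)" using r \<open>\<tau> \<noteq> s\<close> by (auto simp: G_def fun_eq_iff)
          then show ?thesis by simp
        qed
      qed
    qed
    show "AE \<tau> in lborel. integrable M (\<lambda>\<omega>. case (\<tau>, \<omega>) of (x, xa) \<Rightarrow> G x xa)"
      using AEs
    proof (rule eventually_mono)
      fix \<tau> assume "\<tau> \<noteq> s"
      show "integrable M (\<lambda>\<omega>. case (\<tau>, \<omega>) of (x, xa) \<Rightarrow> G x xa)"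
      proof (cases "s < \<tau>")
        case True
        show ?thesis using Gb[OF True] by (simp, intro integrable_const_bound[of _ "?w \<tau>"]) auto
      next
        case False
        then have "G \<tau> = (\<lambda>_. 0)" using r \<open>\<tau> \<noteq> s\<close> by (auto simp: G_def fun_eq_iff)
        then show ?thesis by simp
      qed
    qed
  qed
  define g where "g \<tau> = (\<integral>\<omega>. \<rho> \<omega> * (D (Y \<tau> \<omega>) \<bullet> bs_K (\<mu> (max s \<tau>)) (X (max s \<tau>) \<omega>)) \<partial>M)" for \<tau>
  have gG: "indicator {t0..T} \<tau> *\<^sub>R g \<tau> = (\<integral>\<omega>. G \<tau> \<omega> \<partial>M)" for \<tau>
    unfolding g_def G_def by simp
  have g_int: "set_integrable lborel {t0..T} g"
    unfolding set_integrable_def gG using P.integrable_fst[OF GI] .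
  have g_eq: "g \<tau> = (\<integral>\<omega>. \<rho> \<omega> * (heat_gradient \<nu> D (T - \<tau>) (X \<tau> \<omega>) \<bullet> bs_K (\<mu> \<tau>) (X \<tau> \<omega>)) \<partial>M)"
    if \<tau>: "t0 < \<tau>" "\<tau> < T" for \<tau>
  proof -
    have s\<tau>: "s < \<tau>" "s \<le> \<tau>" "max s \<tau> = \<tau>" using \<tau> st0 by auto
    have [measurable]: "\<rho> \<in> borel_measurable (Fl \<tau>)" "X \<tau> \<in> borel_measurable (Fl \<tau>)"
      using Fl_measurable_mono[OF r(1) _ \<rho>, of \<tau>] X_adapted[OF s\<tau>(2)] r \<tau> by auto
    have [measurable]: "bs_K (\<mu> \<tau>) \<in> borel_measurable borel" using measurable_bs_K_at s\<tau> by auto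
    interpret G2: prob_space "gauss2 (T - \<tau>)" using \<tau> by (intro prob_gauss2) simp
    let ?f = "\<lambda>p. \<rho> (fst p) * (D (X \<tau> (fst p) + ?c *\<^sub>R snd p) \<bullet> bs_K (\<mu> \<tau>) (X \<tau> (fst p)))"
    have "g \<tau> = (\<integral>\<omega>. ?f (\<omega>, W T \<omega> - W \<tau> \<omega>) \<partial>M)"
      unfolding g_def Y_def by (simp add: s\<tau>)
    also have "\<dots> = (\<integral>\<omega>. \<integral>z. ?f (\<omega>, z) \<partial>gauss2 (T - \<tau>) \<partial>M)"
    proof (rule increment_integral[OF s\<tau>(2) \<tau>(2)])
      show "?f \<in> borel_measurable (Fl \<tau> \<Otimes>\<^sub>M borel)" by measurable
      fix p
      have "\<bar>?f p\<bar> \<le> 1 * (L * (\<beta> / sqrt (\<tau> - s)))"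
        unfolding abs_mult
      proof (rule mult_mono)
        show "\<bar>\<rho> (fst p)\<bar> \<le> 1" using \<rho>01[of "fst p"] by simp
        show "\<bar>D (X \<tau> (fst p) + ?c *\<^sub>R snd p) \<bullet> bs_K (\<mu> \<tau>) (X \<tau> (fst p))\<bar> \<le> L * (\<beta> / sqrt (\<tau> - s))"
          using norm_drift_le[OF s\<tau>(1)] L(1) by (intro order_trans[OF dot] mult_left_mono) auto
      qed auto
      then show "\<bar>?f p\<bar> \<le> L * (\<beta> / sqrt (\<tau> - s))" by simp
    qed
    also have "\<dots> = (\<integral>\<omega>. \<rho> \<omega> * (heat_gradient \<nu> D (T - \<tau>) (X \<tau> \<omega>) \<bullet> bs_K (\<mu> \<tau>) (X \<tau> \<omega>)) \<partial>M)"
    proof (rule Bochner_Integration.integral_cong[OF refl])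
      fix \<omega>
      have "integrable (gauss2 (T - \<tau>)) (\<lambda>z. D (X \<tau> \<omega> + ?c *\<^sub>R z))"
        by (rule G2.integrable_const_bound[of _ L]) (auto simp: L)
      then show "(\<integral>z. ?f (\<omega>, z) \<partial>gauss2 (T - \<tau>)) = \<rho> \<omega> * (heat_gradient \<nu> D (T - \<tau>) (X \<tau> \<omega>) \<bullet> bs_K (\<mu> \<tau>) (X \<tau> \<omega>))"
        by (simp add: heat_gradient_def)
    qed
    finally show ?thesis .
  qed
  have "(\<integral>\<omega>. \<rho> \<omega> * \<phi> (X T \<omega>) \<partial>M) - (\<integral>\<omega>. \<rho> \<omega> * \<phi> (Y t0 \<omega>) \<partial>M) = (\<integral>\<omega>. \<rho> \<omega> * \<phi> (X T \<omega>) - \<rho> \<omega> * \<phi> (Y t0 \<omega>) \<partial>M)"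
  proof (rule Bochner_Integration.integral_diff[symmetric])
    have b: "\<bar>\<rho> \<omega> * \<phi> x\<bar> \<le> 1" for \<omega> x
      using \<rho>01[of \<omega>] C1_testD(4)[OF T, of x] by (simp add: abs_mult mult_le_one)
    have "(\<lambda>\<omega>. Y t0 \<omega>) \<in> borel_measurable M" unfolding Y_def using st0 by (simp add: max_def)
    then show "integrable M (\<lambda>\<omega>. \<rho> \<omega> * \<phi> (X T \<omega>))" "integrable M (\<lambda>\<omega>. \<rho> \<omega> * \<phi> (Y t0 \<omega>))"
      using b by (auto intro!: integrable_const_bound[of _ 1])
  qed
  also have "\<dots> = (\<integral>\<omega>. (\<integral>\<tau>. G \<tau> \<omega> \<partial>lborel) \<partial>M)"
  proof (rule integral_cong_AE)
    show "(\<lambda>\<omega>. \<integral>\<tau>. G \<tau> \<omega> \<partial>lborel) \<in> borel_measurable M" using P.integrable_snd[OF GI] by auto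
    have [measurable]: "(\<lambda>\<omega>. Y t0 \<omega>) \<in> borel_measurable M" unfolding Y_def using st0 by (simp add: max_def)
    show "(\<lambda>\<omega>. \<rho> \<omega> * \<phi> (X T \<omega>) - \<rho> \<omega> * \<phi> (Y t0 \<omega>)) \<in> borel_measurable M" by measurable
    show "AE \<omega> in M. \<rho> \<omega> * \<phi> (X T \<omega>) - \<rho> \<omega> * \<phi> (Y t0 \<omega>) = (\<integral>\<tau>. G \<tau> \<omega> \<partial>lborel)"
      using path_identity
    proof (rule eventually_mono)
      fix \<omega>
      let ?f = "\<lambda>\<tau>. bs_K (\<mu> \<tau>) (X \<tau> \<omega>)"
      assume h: "\<forall>t T. s \<le> t \<and> t \<le> T \<longrightarrow> set_integrable lborel {t..T} ?f \<and>
        X t \<omega> + ?c *\<^sub>R (W T \<omega> - W t \<omega>) = X T \<omega> - (LINT \<tau>:{t..T}|lborel. ?f \<tau>)"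
      have i: "set_integrable lborel {t0..T} ?f" using h st0(1) r(3) by simp
      have Yt: "Y t \<omega> = X T \<omega> - (LINT \<tau>:{t..T}|lborel. ?f \<tau>)" if "t0 \<le> t" "t \<le> T" for t
      proof -
        have "s \<le> t \<and> t \<le> T" using that st0 by auto
        with h show ?thesis unfolding Y_def by (simp add: max_def)
      qed
      have "\<phi> (Y T \<omega>) - \<phi> (Y t0 \<omega>) = (LINT \<tau>:{t0..T}|lborel. D (Y \<tau> \<omega>) \<bullet> ?f \<tau>)"
        using C1_test_chain_rule(2)[OF T less_imp_le[OF r(3)] i, of "\<lambda>t. Y t \<omega>" "X T \<omega>"] Yt by blast
      moreover have "Y T \<omega> = X T \<omega>" unfolding Y_def using st0 by (simp add: max_def)
      moreover have "(\<integral>\<tau>. G \<tau> \<omega> \<partial>lborel) = \<rho> \<omega> * (LINT \<tau>:{t0..T}|lborel. D (Y \<tau> \<omega>) \<bullet> ?f \<tau>)"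
        unfolding set_lebesgue_integral_def integral_mult_right_zero[symmetric]
        using st0 by (intro Bochner_Integration.integral_cong) (auto simp: G_def indicator_def max_def)
      ultimately show "\<rho> \<omega> * \<phi> (X T \<omega>) - \<rho> \<omega> * \<phi> (Y t0 \<omega>) = (\<integral>\<tau>. G \<tau> \<omega> \<partial>lborel)"
        by (simp add: right_diff_distrib[symmetric])
    qed
  qed
  also have "\<dots> = (\<integral>\<tau>. (\<integral>\<omega>. G \<tau> \<omega> \<partial>M) \<partial>lborel)"
    by (rule P.Fubini_integral[OF GI])
  also have "\<dots> = (LINT \<tau>:{t0..T}|lborel. g \<tau>)"
    unfolding set_lebesgue_integral_def gG ..
  also have "(\<integral>\<omega>. \<rho> \<omega> * \<phi> (Y t0 \<omega>) \<partial>M) = (\<integral>\<omega>. \<rho> \<omega> * (\<integral>z. \<phi> (X t0 \<omega> + ?c *\<^sub>R z) \<partial>gauss2 (T - t0)) \<partial>M)"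
  proof -
    have [measurable]: "\<rho> \<in> borel_measurable (Fl t0)" "X t0 \<in> borel_measurable (Fl t0)"
      using Fl_measurable_mono[OF r(1) r(2) \<rho>] X_adapted[OF st0(1)] by auto
    let ?f = "\<lambda>p. \<rho> (fst p) * \<phi> (X t0 (fst p) + ?c *\<^sub>R snd p)"
    have "(\<integral>\<omega>. \<rho> \<omega> * \<phi> (Y t0 \<omega>) \<partial>M) = (\<integral>\<omega>. ?f (\<omega>, W T \<omega> - W t0 \<omega>) \<partial>M)"
      unfolding Y_def using st0 by (simp add: max_def)
    also have "\<dots> = (\<integral>\<omega>. \<integral>z. ?f (\<omega>, z) \<partial>gauss2 (T - t0) \<partial>M)"
    proof (rule increment_integral[OF st0(1) r(3)])
      show "?f \<in> borel_measurable (Fl t0 \<Otimes>\<^sub>M borel)" by measurable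
      show "\<bar>?f p\<bar> \<le> 1" for p
        using \<rho>01[of "fst p"] C1_testD(4)[OF T] by (simp add: abs_mult mult_le_one)
    qed
    finally show ?thesis by simp
  qed
  finally show ?thesis
    by (intro exI[of _ g]) (auto simp: g_int g_eq algebra_simps)
qed

text \<open>The weighted laws are not normalised, and their drift remains that of the full law
  \<open>\<mu> t\<close>. With this drift frozen, they solve a linear equation.\<close>

lemma mild_weighted:
  assumes r: "s \<le> r" and \<rho>: "\<rho> \<in> borel_measurable (Fl r)" and \<rho>01: "\<And>\<omega>. 0 \<le> \<rho> \<omega>" "\<And>\<omega>. \<rho> \<omega> \<le> (1::real)"
  shows "mild_solution \<nu> (\<lambda>t. bs_K (\<mu> t)) (\<lambda>t. distr (density M (\<lambda>\<omega>. ennreal (\<rho> \<omega>))) borel (X t)) r"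
  unfolding mild_solution_def
proof (intro allI impI, elim conjE)
  fix t0 T \<phi> D assume a: "r \<le> t0" "t0 < T" "C1_test \<phi> D"
  note [measurable] = C1_testD(6,7)[OF a(3)]
  have [measurable]: "\<rho> \<in> borel_measurable M" using \<rho> r Fl_measurable by blast
  have i: "(\<integral>x. f x \<partial>distr (density M (\<lambda>\<omega>. ennreal (\<rho> \<omega>))) borel (X t)) = (\<integral>\<omega>. \<rho> \<omega> * f (X t \<omega>) \<partial>M)"
    if [measurable]: "f \<in> borel_measurable borel" and "s \<le> t" for f :: "real^2 \<Rightarrow> real" and t
  proof -
    have [measurable]: "X t \<in> borel_measurable M" using that X_measurable by blast
    have "(\<integral>x. f x \<partial>distr (density M (\<lambda>\<omega>. ennreal (\<rho> \<omega>))) borel (X t)) = (\<integral>\<omega>. f (X t \<omega>) \<partial>density M (\<lambda>\<omega>. ennreal (\<rho> \<omega>)))"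
      by (rule integral_distr) auto
    also have "\<dots> = (\<integral>\<omega>. \<rho> \<omega> *\<^sub>R f (X t \<omega>) \<partial>M)" using \<rho>01 by (intro integral_density) auto
    finally show ?thesis by simp
  qed
  obtain g where g: "set_integrable lborel {t0..T} g"
    "\<And>\<tau>. t0 < \<tau> \<Longrightarrow> \<tau> < T \<Longrightarrow> g \<tau> = (\<integral>\<omega>. \<rho> \<omega> * (heat_gradient \<nu> D (T - \<tau>) (X \<tau> \<omega>) \<bullet> bs_K (\<mu> \<tau>) (X \<tau> \<omega>)) \<partial>M)"
    "(\<integral>\<omega>. \<rho> \<omega> * \<phi> (X T \<omega>) \<partial>M) = (\<integral>\<omega>. \<rho> \<omega> * (\<integral>z. \<phi> (X t0 \<omega> + sqrt (2 * \<nu>) *\<^sub>R z) \<partial>gauss2 (T - t0)) \<partial>M)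
          + (LINT \<tau>:{t0..T}|lborel. g \<tau>)"
    using mild_formula[OF r a \<rho> \<rho>01] by blast
  have h: "(\<lambda>x. \<integral>z. \<phi> (x + sqrt (2 * \<nu>) *\<^sub>R z) \<partial>gauss2 (T - t0)) \<in> borel_measurable borel"
    using a by (intro measurable_heat prob_gauss2) auto
  have gr: "(\<lambda>x. heat_gradient \<nu> D (T - \<tau>) x \<bullet> bs_K (\<mu> \<tau>) x) \<in> borel_measurable borel" if "t0 < \<tau>" "\<tau> < T" for \<tau>
  proof -
    have [measurable]: "heat_gradient \<nu> D (T - \<tau>) \<in> borel_measurable borel"
      using that by (intro measurable_heat_gradient prob_gauss2) auto
    have [measurable]: "bs_K (\<mu> \<tau>) \<in> borel_measurable borel" using that a r by (intro measurable_bs_K_at) auto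
    show ?thesis by measurable
  qed
  show "\<exists>g. set_integrable lborel {t0..T} g \<and>
       (\<forall>\<tau>. t0 < \<tau> \<and> \<tau> < T \<longrightarrow> g \<tau> = (\<integral>x. heat_gradient \<nu> D (T - \<tau>) x \<bullet> bs_K (\<mu> \<tau>) x \<partial>distr (density M (\<lambda>\<omega>. ennreal (\<rho> \<omega>))) borel (X \<tau>))) \<and>
       (\<integral>x. \<phi> x \<partial>distr (density M (\<lambda>\<omega>. ennreal (\<rho> \<omega>))) borel (X T)) =
       (\<integral>x. (\<integral>z. \<phi> (x + sqrt (2 * \<nu>) *\<^sub>R z) \<partial>gauss2 (T - t0)) \<partial>distr (density M (\<lambda>\<omega>. ennreal (\<rho> \<omega>))) borel (X t0))
          + (LINT \<tau>:{t0..T}|lborel. g \<tau>)"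
  proof (intro exI[of _ g] conjI allI impI)
    show "set_integrable lborel {t0..T} g" by (rule g)
    show "g \<tau> = (\<integral>x. heat_gradient \<nu> D (T - \<tau>) x \<bullet> bs_K (\<mu> \<tau>) x \<partial>distr (density M (\<lambda>\<omega>. ennreal (\<rho> \<omega>))) borel (X \<tau>))"
      if "t0 < \<tau> \<and> \<tau> < T" for \<tau>
      using that a r g(2) by (subst i[OF gr]) auto
    show "(\<integral>x. \<phi> x \<partial>distr (density M (\<lambda>\<omega>. ennreal (\<rho> \<omega>))) borel (X T)) =
       (\<integral>x. (\<integral>z. \<phi> (x + sqrt (2 * \<nu>) *\<^sub>R z) \<partial>gauss2 (T - t0)) \<partial>distr (density M (\<lambda>\<omega>. ennreal (\<rho> \<omega>))) borel (X t0))
          + (LINT \<tau>:{t0..T}|lborel. g \<tau>)"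
      using a r g(3) by (subst i, simp, simp, subst i[OF h]) auto
  qed
qed

end

section \<open>Uniqueness of mild solutions\<close>

lemma measurable_bs_K_fixed:
  assumes "prob_space n" "sets n = sets borel"
  shows "bs_K n \<in> borel_measurable borel"
proof -
  interpret prob_space n by fact
  note [measurable_cong] = assms(2)
  show ?thesis unfolding bs_K_def[abs_def] by measurable
qed

text \<open>Fubini moves the kernel from \<open>n\<close> onto the field \<open>V\<close>; the
  uniform bound on the potential of \<open>n\<close> provides absolute integrability.\<close>

lemma inner_bs_K_swap:
  fixes V :: "real^2 \<Rightarrow> real^2"
  assumes n: "prob_space n" "sets n = sets borel" and m: "prob_space m" "sets m = sets borel"
    and a: "\<And>x. bs_potential n x \<le> ennreal a" "0 \<le> a"
    and [measurable]: "V \<in> borel_measurable borel" and V: "\<And>x. norm (V x) \<le> 1"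
  shows "(\<integral>x. V x \<bullet> bs_K n x \<partial>m) = (\<integral>y. (\<integral>x. V x \<bullet> bs_k (x - y) \<partial>m) \<partial>n)"
proof -
  interpret n: prob_space n by fact
  interpret m: prob_space m by fact
  interpret P: pair_sigma_finite m n ..
  note [measurable_cong] = n(2) m(2)
  have kb: "norm (V x \<bullet> bs_k (x - y)) \<le> norm (bs_k (x - y))" for x y
    using Cauchy_Schwarz_ineq2[of "V x" "bs_k (x - y)"] mult_right_mono[OF V[of x], of "norm (bs_k (x - y))"] by simp
  have ik: "integrable n (\<lambda>y. bs_k (x - y))" for x
    by (rule integrable_bs_k[OF n(2) le_less_trans[OF a(1)]]) simp
  have ik': "integrable n (\<lambda>y. V x \<bullet> bs_k (x - y))" for x
    using ik[of x] by simp
  have nb: "(\<integral>y. norm (V x \<bullet> bs_k (x - y)) \<partial>n) \<le> a" for x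
  proof -
    have "(\<integral>y. norm (V x \<bullet> bs_k (x - y)) \<partial>n) \<le> (\<integral>y. norm (bs_k (x - y)) \<partial>n)"
      by (intro integral_mono integrable_norm ik ik' kb)
    also have "ennreal \<dots> = bs_potential n x"
      unfolding bs_potential_def norm_bs_k[symmetric]
      by (rule nn_integral_eq_integral[symmetric]) (auto intro!: integrable_norm ik)
    then have "(\<integral>y. norm (bs_k (x - y)) \<partial>n) \<le> a" using a(1)[of x] a(2) by (metis ennreal_le_iff)
    finally show ?thesis .
  qed
  have I: "integrable (m \<Otimes>\<^sub>M n) (case_prod (\<lambda>x y. V x \<bullet> bs_k (x - y)))"
  proof (rule P.Fubini_integrable)
    show "integrable m (\<lambda>x. \<integral>y. norm (case (x, y) of (x, y) \<Rightarrow> V x \<bullet> bs_k (x - y)) \<partial>n)"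
      using nb by (intro m.integrable_const_bound[of _ a]) auto
  qed (auto simp: ik')
  have "(\<integral>x. V x \<bullet> bs_K n x \<partial>m) = (\<integral>x. (\<integral>y. V x \<bullet> bs_k (x - y) \<partial>n) \<partial>m)"
    unfolding bs_K_def using ik by simp
  also have "\<dots> = (\<integral>y. (\<integral>x. V x \<bullet> bs_k (x - y) \<partial>m) \<partial>n)"
    by (rule P.Fubini_integral[OF I, symmetric])
  finally show ?thesis .
qed

text \<open>The drift term is quadratic in the law. Telescoping leaves V . K(n1) integrated against
  n1 - n2, and V . (K(n1) - K(n2)) integrated against n2. As the kernel is unbounded, total
  variation does not control K(n1) - K(n2) pointwise; Fubini rewrites the second part as a bounded
  function integrated against n1 - n2.\<close>

lemma nonlinear_drift_diff:
  fixes V :: "real^2 \<Rightarrow> real^2"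
  assumes n1: "prob_space n1" "sets n1 = sets borel" and n2: "prob_space n2" "sets n2 = sets borel"
    and a1: "\<And>x. bs_potential n1 x \<le> ennreal a1" "0 \<le> a1"
    and a2: "\<And>x. bs_potential n2 x \<le> ennreal a2" "0 \<le> a2"
    and N: "\<And>A. A \<in> sets borel \<Longrightarrow> \<bar>measure n1 A - measure n2 A\<bar> \<le> N"
    and V[measurable]: "V \<in> borel_measurable borel" and Vb: "\<And>x. norm (V x) \<le> 1"
  shows "\<bar>(\<integral>x. V x \<bullet> bs_K n1 x \<partial>n1) - (\<integral>x. V x \<bullet> bs_K n2 x \<partial>n2)\<bar> \<le> 3 * (a1 + a2) * N"
proof -
  interpret n1: prob_space n1 by fact
  interpret n2: prob_space n2 by fact
  note [measurable_cong] = n1(2) n2(2)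
  have f: "finite_measure n1" "finite_measure n2" by unfold_locales
  have [measurable]: "bs_K n1 \<in> borel_measurable borel" "bs_K n2 \<in> borel_measurable borel"
    using n1 n2 by (auto intro: measurable_bs_K_fixed)
  have Vd: "\<bar>V x \<bullet> w\<bar> \<le> norm w" for x w
    using Cauchy_Schwarz_ineq2[of "V x" w] mult_right_mono[OF Vb[of x], of "norm w"] by simp
  have 1: "\<bar>(\<integral>x. V x \<bullet> bs_K n1 x \<partial>n1) - (\<integral>x. V x \<bullet> bs_K n1 x \<partial>n2)\<bar> \<le> 3 * a1 * N"
  proof (rule integral_diff_le[OF f n1(2) n2(2) N])
    show "\<bar>V x \<bullet> bs_K n1 x\<bar> \<le> a1" for x
      using Vd[of x "bs_K n1 x"] norm_bs_K_le[OF n1(2) a1(1) a1(2), of x] by linarith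
  qed auto
  \<comment> \<open>Bounded by the potential of \<open>n2\<close>, since the norm of the kernel is
    symmetric in x and y.\<close>
  let ?q = "\<lambda>y. \<integral>x. V x \<bullet> bs_k (x - y) \<partial>n2"
  have q: "\<bar>?q y\<bar> \<le> a2" for y
  proof (cases "integrable n2 (\<lambda>x. V x \<bullet> bs_k (x - y))")
    case True
    have "ennreal \<bar>?q y\<bar> \<le> (\<integral>\<^sup>+x. ennreal (norm (V x \<bullet> bs_k (x - y))) \<partial>n2)"
      using integral_norm_bound_ennreal[OF True] by simp
    also have "\<dots> \<le> (\<integral>\<^sup>+x. ennreal (1 / (2 * pi * norm (y - x))) \<partial>n2)"
    proof (intro nn_integral_mono ennreal_leI)
      fix x
      show "norm (V x \<bullet> bs_k (x - y)) \<le> 1 / (2 * pi * norm (y - x))"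
        using Vd[of x "bs_k (x - y)"] by (simp add: norm_bs_k norm_minus_commute)
    qed
    also have "\<dots> \<le> ennreal a2" using a2(1)[of y] by (simp add: bs_potential_def)
    finally show ?thesis using a2(2) by simp
  next
    case False
    then show ?thesis using a2 by (simp add: not_integrable_integral_eq)
  qed
  have [measurable]: "?q \<in> borel_measurable borel" by measurable
  have 2: "\<bar>(\<integral>x. V x \<bullet> bs_K n1 x \<partial>n2) - (\<integral>x. V x \<bullet> bs_K n2 x \<partial>n2)\<bar> \<le> 3 * a2 * N"
    unfolding inner_bs_K_swap[OF n1 n2 a1 V Vb] inner_bs_K_swap[OF n2 n2 a2 V Vb]
    by (rule integral_diff_le[OF f n1(2) n2(2) N _ q]) auto
  from 1 2 show ?thesis by (simp add: algebra_simps)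
qed

lemma mild_solutionD:
  assumes "mild_solution \<nu> b n r" "r \<le> t0" "t0 < T" "C1_test \<phi> D"
  shows "\<exists>g. set_integrable lborel {t0..T} g \<and>
       (\<forall>\<tau>. t0 < \<tau> \<and> \<tau> < T \<longrightarrow> g \<tau> = (\<integral>x. heat_gradient \<nu> D (T - \<tau>) x \<bullet> b \<tau> x \<partial>n \<tau>)) \<and>
       (\<integral>x. \<phi> x \<partial>n T) = (\<integral>x. (\<integral>z. \<phi> (x + sqrt (2 * \<nu>) *\<^sub>R z) \<partial>gauss2 (T - t0)) \<partial>n t0)
          + (LINT \<tau>:{t0..T}|lborel. g \<tau>)"
  by (rule assms(1)[unfolded mild_solution_def, rule_format]) (use assms in auto)

text \<open>Starting from the trivial bound 1, each pass through Duhamel's formula halves a bound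
  valid on the whole interval. \<open>C\<close> is the bounded part of the drift difference and
  \<open>\<eta>\<close> the critical part: a small \<open>\<delta>\<close> subdues the former,
  whereas \<open>\<eta>\<close> has to be small by itself.\<close>

lemma mild_contraction:
  fixes n1 n2 :: "real \<Rightarrow> (real^2) measure"
  assumes nu: "0 < \<nu>" and G: "\<And>v. 0 < v \<Longrightarrow> prob_space (gauss2 v)"
    and m1: "mild_solution \<nu> b1 n1 r" and m2: "mild_solution \<nu> b2 n2 r"
    and t0: "r \<le> t0" and f1: "\<And>t. r \<le> t \<Longrightarrow> finite_measure (n1 t)" "\<And>t. r \<le> t \<Longrightarrow> sets (n1 t) = sets borel" "\<And>t. r \<le> t \<Longrightarrow> measure (n1 t) UNIV \<le> 1"
    and f2: "\<And>t. r \<le> t \<Longrightarrow> finite_measure (n2 t)" "\<And>t. r \<le> t \<Longrightarrow> sets (n2 t) = sets borel" "\<And>t. r \<le> t \<Longrightarrow> measure (n2 t) UNIV \<le> 1"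
    and init: "n1 t0 = n2 t0"
    and drift: "\<And>\<tau> N V. t0 < \<tau> \<Longrightarrow> \<tau> \<le> t0 + \<delta> \<Longrightarrow> 0 \<le> N \<Longrightarrow>
       (\<And>A. A \<in> sets borel \<Longrightarrow> \<bar>measure (n1 \<tau>) A - measure (n2 \<tau>) A\<bar> \<le> N) \<Longrightarrow>
       V \<in> borel_measurable borel \<Longrightarrow> (\<And>x. norm (V x) \<le> 1) \<Longrightarrow>
       \<bar>(\<integral>x. V x \<bullet> b1 \<tau> x \<partial>n1 \<tau>) - (\<integral>x. V x \<bullet> b2 \<tau> x \<partial>n2 \<tau>)\<bar> \<le> (C + \<eta> / sqrt (\<tau> - t0)) * N"
    and C: "0 \<le> C" "0 \<le> \<eta>" and small: "(2 * C * sqrt \<delta> + 4 * sqrt 2 * \<eta>) / sqrt (2 * \<nu>) \<le> 1 / 2"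
    and T: "t0 \<le> T" "T \<le> t0 + \<delta>"
  shows "n1 T = n2 T"
proof -
  have iter: "\<bar>measure (n1 T) A - measure (n2 T) A\<bar> \<le> (1/2) ^ k"
    if "t0 < T" "T \<le> t0 + \<delta>" "A \<in> sets borel" for T A k
    using that
  proof (induction k arbitrary: T A)
    case 0
    have rT: "r \<le> T" using t0 0 by simp
    interpret n1: finite_measure "n1 T" using f1 rT by simp
    interpret n2: finite_measure "n2 T" using f2 rT by simp
    have "measure (n1 T) A \<le> 1" "measure (n2 T) A \<le> 1"
      using n1.bounded_measure[of A] n2.bounded_measure[of A] f1(3)[OF rT] f2(3)[OF rT]
        sets_eq_imp_space_eq[OF f1(2)[OF rT]] sets_eq_imp_space_eq[OF f2(2)[OF rT]] by auto
    moreover have "0 \<le> measure (n1 T) A" "0 \<le> measure (n2 T) A" by auto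
    ultimately show ?case unfolding power_0 by linarith
  next
    case (Suc k)
    let ?N = "(1/2::real) ^ k"
    have rT: "r \<le> T" using t0 Suc.prems by simp
    show ?case
    proof (rule measure_diff_le_from_C1_test[OF f1(1)[OF rT] f2(1)[OF rT] f1(2)[OF rT] f2(2)[OF rT] _ Suc.prems(3)])
      fix \<phi> D assume CT: "C1_test \<phi> D"
      note Dm = C1_testD(7)[OF CT]
      obtain g1 where g1: "set_integrable lborel {t0..T} g1"
         "\<And>\<tau>. t0 < \<tau> \<Longrightarrow> \<tau> < T \<Longrightarrow> g1 \<tau> = (\<integral>x. heat_gradient \<nu> D (T - \<tau>) x \<bullet> b1 \<tau> x \<partial>n1 \<tau>)"
         "(\<integral>x. \<phi> x \<partial>n1 T) = (\<integral>x. (\<integral>z. \<phi> (x + sqrt (2 * \<nu>) *\<^sub>R z) \<partial>gauss2 (T - t0)) \<partial>n1 t0) + (LINT \<tau>:{t0..T}|lborel. g1 \<tau>)"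
        using mild_solutionD[OF m1 t0 Suc.prems(1) CT] by blast
      obtain g2 where g2: "set_integrable lborel {t0..T} g2"
         "\<And>\<tau>. t0 < \<tau> \<Longrightarrow> \<tau> < T \<Longrightarrow> g2 \<tau> = (\<integral>x. heat_gradient \<nu> D (T - \<tau>) x \<bullet> b2 \<tau> x \<partial>n2 \<tau>)"
         "(\<integral>x. \<phi> x \<partial>n2 T) = (\<integral>x. (\<integral>z. \<phi> (x + sqrt (2 * \<nu>) *\<^sub>R z) \<partial>gauss2 (T - t0)) \<partial>n2 t0) + (LINT \<tau>:{t0..T}|lborel. g2 \<tau>)"
        using mild_solutionD[OF m2 t0 Suc.prems(1) CT] by blast
      let ?c = "sqrt (2 * \<nu>)" and ?q = "sqrt (2 / (T - t0))"
      have c: "0 < ?c" using nu by simp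
      \<comment> \<open>Gradient gain times drift coefficient times the bound \<open>?N\<close> of
        the previous pass; the product of the two singularities is split by
        \<open>inverse_sqrt_product_le\<close> so that it can be integrated.\<close>
      define w where "w \<tau> = (?N / ?c) * ((C + \<eta> * ?q) * (1 / sqrt (T - \<tau>)) + \<eta> * ?q * (1 / sqrt (\<tau> - t0)))" for \<tau>
      have gb: "\<bar>g1 \<tau> - g2 \<tau>\<bar> \<le> w \<tau>" if \<tau>: "t0 < \<tau>" "\<tau> < T" for \<tau>
      proof -
        let ?s = "sqrt (T - \<tau>)"
        have s: "0 < ?s" using \<tau> by simp
        \<comment> \<open>By the gradient bound this rescaled field has norm at most 1, the form
          that \<open>drift\<close> accepts.\<close>
        let ?V = "\<lambda>x. (?c * ?s) *\<^sub>R heat_gradient \<nu> D (T - \<tau>) x"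
        have Vm: "?V \<in> borel_measurable borel"
          using measurable_heat_gradient[of "T - \<tau>" D \<nu>] G[of "T - \<tau>"] Dm \<tau> by simp
        have Vb: "norm (?V x) \<le> 1" for x
        proof -
          have "norm (heat_gradient \<nu> D (T - \<tau>) x) \<le> 1 / (?c * ?s)"
            unfolding heat_gradient_def using G \<tau> c by (intro gauss2_gradient_bound[OF _ _ CT]) auto
          then have "(?c * ?s) * norm (heat_gradient \<nu> D (T - \<tau>) x) \<le> (?c * ?s) * (1 / (?c * ?s))"
            using c s by (intro mult_left_mono) auto
          then show ?thesis using c s nu by (simp add: abs_mult)
        qed
        have "\<bar>(\<integral>x. ?V x \<bullet> b1 \<tau> x \<partial>n1 \<tau>) - (\<integral>x. ?V x \<bullet> b2 \<tau> x \<partial>n2 \<tau>)\<bar> \<le> (C + \<eta> / sqrt (\<tau> - t0)) * ?N"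
        proof (rule drift[OF \<tau>(1) _ _ _ Vm Vb])
          show "\<tau> \<le> t0 + \<delta>" using \<tau> Suc.prems by simp
          show "\<bar>measure (n1 \<tau>) A - measure (n2 \<tau>) A\<bar> \<le> ?N" if "A \<in> sets borel" for A
            using Suc.IH[of \<tau> A] \<tau> Suc.prems that by simp
        qed simp
        moreover have "(\<integral>x. ?V x \<bullet> b1 \<tau> x \<partial>n1 \<tau>) - (\<integral>x. ?V x \<bullet> b2 \<tau> x \<partial>n2 \<tau>) = (?c * ?s) * (g1 \<tau> - g2 \<tau>)"
          using g1(2)[OF \<tau>] g2(2)[OF \<tau>] by (simp add: right_diff_distrib)
        ultimately have "(?c * ?s) * \<bar>g1 \<tau> - g2 \<tau>\<bar> \<le> (C + \<eta> / sqrt (\<tau> - t0)) * ?N"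
          using c s nu by (simp add: abs_mult)
        then have "\<bar>g1 \<tau> - g2 \<tau>\<bar> \<le> (C + \<eta> / sqrt (\<tau> - t0)) * ?N / (?c * ?s)"
          using c s by (subst pos_le_divide_eq) (auto simp: mult.commute)
        also have "\<dots> = (?N / ?c) * (C * (1 / ?s) + \<eta> * (1 / sqrt (\<tau> - t0) * (1 / ?s)))"
          using c s by (simp add: divide_simps)
        also have "\<dots> \<le> (?N / ?c) * (C * (1 / ?s) + \<eta> * (?q * (1 / sqrt (\<tau> - t0) + 1 / ?s)))"
          using c C inverse_sqrt_product_le[of t0 T \<tau>] \<tau> by (intro mult_left_mono add_left_mono) auto
        also have "\<dots> = w \<tau>" unfolding w_def by (simp add: algebra_simps)
        finally show ?thesis .
      qed
      have t0T: "t0 \<le> T" using Suc.prems by simp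
      note iS = set_integral_inverse_sqrt[OF t0T]
      have wi: "set_integrable lborel {t0..T} w" unfolding w_def
        by (intro set_integrable_mult_right set_integral_add iS)
      have wI: "(LINT \<tau>:{t0..T}|lborel. w \<tau>) = (?N / ?c) * ((C + \<eta> * ?q) * (2 * sqrt (T - t0)) + \<eta> * ?q * (2 * sqrt (T - t0)))"
        unfolding w_def
        by (simp only: set_integral_mult_right iS(2,4)
          set_integral_add(2)[OF set_integrable_mult_right[OF iS(3)] set_integrable_mult_right[OF iS(1)]])
      have gi: "set_integrable lborel {t0..T} (\<lambda>\<tau>. g1 \<tau> - g2 \<tau>)" using g1(1) g2(1) by (rule set_integral_diff)
      have "(\<integral>x. \<phi> x \<partial>n1 T) - (\<integral>x. \<phi> x \<partial>n2 T) = (LINT \<tau>:{t0..T}|lborel. g1 \<tau> - g2 \<tau>)"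
        using g1(3) g2(3) set_integral_diff(2)[OF g1(1) g2(1)] by (simp add: init)
      also have "\<bar>\<dots>\<bar> \<le> (LINT \<tau>:{t0..T}|lborel. \<bar>g1 \<tau> - g2 \<tau>\<bar>)"
        using set_integral_norm_bound[OF gi] by simp
      also have "\<dots> \<le> (LINT \<tau>:{t0..T}|lborel. w \<tau>)"
      proof (rule set_integral_mono_AE[OF set_integrable_abs[OF gi] wi])
        have "AE \<tau> in lborel. \<tau> \<noteq> t0 \<and> \<tau> \<noteq> T" using AE_lborel_singleton[of t0] AE_lborel_singleton[of T] by eventually_elim auto
        then show "AE \<tau>\<in>{t0..T} in lborel. \<bar>g1 \<tau> - g2 \<tau>\<bar> \<le> w \<tau>"
          by (rule eventually_mono) (auto intro!: gb)
      qed
      also have "\<dots> \<le> ?N / 2"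
      proof -
        \<comment> \<open>The length of the interval cancels; what remains of the critical part is 4
          sqrt 2 \<eta>.\<close>
        have "?q * sqrt (T - t0) = sqrt 2" unfolding real_sqrt_mult[symmetric] using Suc.prems(1) by (simp only: times_divide_eq_left nonzero_mult_div_cancel_right right_minus_eq less_imp_neq[symmetric] not_False_eq_True)
        then have "(C + \<eta> * ?q) * (2 * sqrt (T - t0)) + \<eta> * ?q * (2 * sqrt (T - t0)) = 2 * C * sqrt (T - t0) + 4 * sqrt 2 * \<eta>"
          by (simp add: algebra_simps)
        also have "\<dots> \<le> 2 * C * sqrt \<delta> + 4 * sqrt 2 * \<eta>"
          using C Suc.prems by (intro add_right_mono mult_left_mono) auto
        finally have "(?N / ?c) * ((C + \<eta> * ?q) * (2 * sqrt (T - t0)) + \<eta> * ?q * (2 * sqrt (T - t0))) \<le> (?N / ?c) * (2 * C * sqrt \<delta> + 4 * sqrt 2 * \<eta>)"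
          using c by (intro mult_left_mono) auto
        also have "\<dots> = ?N * ((2 * C * sqrt \<delta> + 4 * sqrt 2 * \<eta>) / ?c)" by simp
        also have "\<dots> \<le> ?N * (1 / 2)" using small by (intro mult_left_mono) auto
        finally show ?thesis unfolding wI by simp
      qed
      finally show "\<bar>(\<integral>x. \<phi> x \<partial>n1 T) - (\<integral>x. \<phi> x \<partial>n2 T)\<bar> \<le> (1/2) ^ Suc k" by simp
    qed
  qed
  show ?thesis
  proof (cases "T = t0")
    case False
    then have T': "t0 < T" "r \<le> T" using T t0 by auto
    interpret n1: finite_measure "n1 T" using f1 T' by simp
    interpret n2: finite_measure "n2 T" using f2 T' by simp
    have "measure (n1 T) A = measure (n2 T) A" if "A \<in> sets borel" for A
    proof -
      have "(\<lambda>k. (1/2::real) ^ k) \<longlonglongrightarrow> 0" by (intro LIMSEQ_power_zero) auto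
      then have "\<bar>measure (n1 T) A - measure (n2 T) A\<bar> \<le> 0"
        by (rule LIMSEQ_le_const) (use iter[OF T'(1) T(2) that] in auto)
      then show ?thesis by simp
    qed
    then show ?thesis using f1(2) f2(2) T'
      by (intro measure_eqI) (auto simp: n1.emeasure_eq_measure n2.emeasure_eq_measure)
  qed (simp add: init)
qed

section \<open>Smallness of the drift near a time with bounded density\<close>

context sde
begin

text \<open>The singularity of the drift at the start is integrable, with integral 2 \<beta> sqrt (t
  - s): the drift moves the particle by no more than the diffusive length scale, up to a
  constant.\<close>

lemma displacement_bound:
  assumes t: "s < t"
  shows "AE \<omega> in M. norm (X t \<omega> - (X s \<omega> + sqrt (2 * \<nu>) *\<^sub>R (W t \<omega> - W s \<omega>))) \<le> 2 * \<beta> * sqrt (t - s)"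
  using path_identity
proof (rule eventually_mono)
  fix \<omega>
  let ?f = "\<lambda>\<tau>. bs_K (\<mu> \<tau>) (X \<tau> \<omega>)"
  assume h: "\<forall>t T. s \<le> t \<and> t \<le> T \<longrightarrow> set_integrable lborel {t..T} ?f \<and>
        X t \<omega> + sqrt (2 * \<nu>) *\<^sub>R (W T \<omega> - W t \<omega>) = X T \<omega> - (LINT \<tau>:{t..T}|lborel. ?f \<tau>)"
  have i: "set_integrable lborel {s..t} ?f" and e: "X s \<omega> + sqrt (2 * \<nu>) *\<^sub>R (W t \<omega> - W s \<omega>) = X t \<omega> - (LINT \<tau>:{s..t}|lborel. ?f \<tau>)"
    using h t by (auto intro: less_imp_le)
  note iS = set_integral_inverse_sqrt(1,2)[OF less_imp_le[OF t]]
  have "norm (X t \<omega> - (X s \<omega> + sqrt (2 * \<nu>) *\<^sub>R (W t \<omega> - W s \<omega>))) = norm (LINT \<tau>:{s..t}|lborel. ?f \<tau>)"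
    unfolding e by simp
  also have "\<dots> \<le> (LINT \<tau>:{s..t}|lborel. norm (?f \<tau>))" by (rule set_integral_norm_bound[OF i])
  also have "\<dots> \<le> (LINT \<tau>:{s..t}|lborel. \<beta> * (1 / sqrt (\<tau> - s)))"
  proof (rule set_integral_mono_AE[OF set_integrable_norm[OF i] set_integrable_mult_right[OF iS(1)]])
    show "AE \<tau>\<in>{s..t} in lborel. norm (?f \<tau>) \<le> \<beta> * (1 / sqrt (\<tau> - s))"
      using AE_lborel_singleton[of s] by (rule eventually_mono) (auto intro!: norm_drift_le)
  qed
  also have "\<dots> = 2 * \<beta> * sqrt (t - s)" unfolding set_integral_mult_right iS(2) by simp
  finally show "norm (X t \<omega> - (X s \<omega> + sqrt (2 * \<nu>) *\<^sub>R (W t \<omega> - W s \<omega>))) \<le> 2 * \<beta> * sqrt (t - s)" .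
qed

text \<open>The free motion \<open>X s + sqrt (2 * \<nu>) *\<^sub>R (W t - W s)\<close> keeps the density bound of its initial law, and the drift
  moves it by \<open>O(sqrt (t - s))\<close> only.\<close>

lemma measure_cball_le:
  assumes t: "s < t" and R: "0 \<le> R" and L: "0 \<le> \<Lambda>" "\<And>y r. 0 \<le> r \<Longrightarrow> measure (\<mu> s) (cball y r) \<le> \<Lambda> * (pi * r\<^sup>2)"
  shows "measure (\<mu> t) (cball x R) \<le> \<Lambda> * (pi * (R + 2 * \<beta> * sqrt (t - s))\<^sup>2)"
proof -
  let ?c = "sqrt (2 * \<nu>)"
  define R' where "R' = R + 2 * \<beta> * sqrt (t - s)"
  have R': "0 \<le> R'" using R \<beta>(1) t by (simp add: R'_def)
  have [measurable]: "cball y q \<in> sets borel" for y :: "real^2" and q by (simp add: borel_closed)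
  have [measurable]: "X s \<in> borel_measurable M" "X t \<in> borel_measurable M" "W s \<in> borel_measurable M" "W t \<in> borel_measurable M"
    using t by (auto intro: X_measurable W_measurable)
  have [measurable]: "X s \<in> borel_measurable (Fl s)" using X_adapted by simp
  interpret G: prob_space "gauss2 (t - s)" using t by (intro prob_gauss2) simp
  interpret P: pair_sigma_finite M "gauss2 (t - s)" ..
  interpret PP: pair_prob_space M "gauss2 (t - s)" ..
  let ?Y = "\<lambda>\<omega>. X s \<omega> + ?c *\<^sub>R (W t \<omega> - W s \<omega>)"
  have "measure (\<mu> t) (cball x R) = measure M {\<omega>\<in>space M. X t \<omega> \<in> cball x R}"
    unfolding lawX[OF less_imp_le[OF t], symmetric] by (subst measure_distr) (auto simp: vimage_def Int_def conj_commute)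
  also have "\<dots> \<le> measure M {\<omega>\<in>space M. ?Y \<omega> \<in> cball x R'}"
  proof (rule finite_measure_mono_AE)
    show "AE \<omega> in M. \<omega> \<in> {\<omega>\<in>space M. X t \<omega> \<in> cball x R} \<longrightarrow> \<omega> \<in> {\<omega>\<in>space M. ?Y \<omega> \<in> cball x R'}"
      using displacement_bound[OF t]
    proof (rule eventually_mono, intro impI)
      fix \<omega> assume a: "norm (X t \<omega> - ?Y \<omega>) \<le> 2 * \<beta> * sqrt (t - s)" and b: "\<omega> \<in> {\<omega>\<in>space M. X t \<omega> \<in> cball x R}"
      have "dist x (?Y \<omega>) \<le> dist x (X t \<omega>) + dist (X t \<omega>) (?Y \<omega>)" by (rule dist_triangle)
      then show "\<omega> \<in> {\<omega>\<in>space M. ?Y \<omega> \<in> cball x R'}" using a b by (simp add: R'_def dist_norm)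
    qed
  qed measurable
  also have "\<dots> = (\<integral>\<omega>. indicator (cball x R') (?Y \<omega>) \<partial>M)"
  proof -
    have eq: "(\<integral>\<omega>. indicat_real (cball x R') (?Y \<omega>) \<partial>M) = (\<integral>\<omega>. indicat_real {\<omega>\<in>space M. ?Y \<omega> \<in> cball x R'} \<omega> \<partial>M)"
      by (rule Bochner_Integration.integral_cong) (auto simp: indicator_def)
    show ?thesis unfolding eq by (subst Bochner_Integration.integral_indicator) (auto intro!: arg_cong[where f="measure M"])
  qed
  also have "\<dots> = (\<integral>\<omega>. \<integral>z. indicator (cball x R') (X s \<omega> + ?c *\<^sub>R z) \<partial>gauss2 (t - s) \<partial>M)"
    using increment_integral[OF order_refl t, of "\<lambda>p. indicator (cball x R') (X s (fst p) + ?c *\<^sub>R snd p)" 1] by simp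
  \<comment> \<open>For fixed noise \<open>z\<close> the event says that \<open>X s\<close> lies in
    a translated ball of the same radius, so the ball bound for \<open>\<mu> s\<close> applies
    uniformly in \<open>z\<close>.\<close>
  also have "\<dots> = (\<integral>z. \<integral>\<omega>. indicator (cball x R') (X s \<omega> + ?c *\<^sub>R z) \<partial>M \<partial>gauss2 (t - s))"
  proof (rule P.Fubini_integral[symmetric])
    show "integrable (M \<Otimes>\<^sub>M gauss2 (t - s)) (\<lambda>(\<omega>, z). indicat_real (cball x R') (X s \<omega> + ?c *\<^sub>R z))"
      by (rule PP.P.integrable_const_bound[of _ 1]) (auto simp: split_beta')
  qed
  also have "\<dots> \<le> \<Lambda> * (pi * R'\<^sup>2)"
  proof (rule G.integral_le_const)
    have "(\<integral>\<omega>. indicat_real (cball x R') (X s \<omega> + ?c *\<^sub>R z) \<partial>M) = measure (\<mu> s) (cball (x - ?c *\<^sub>R z) R')" for z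
    proof -
      have "(\<integral>\<omega>. indicat_real (cball x R') (X s \<omega> + ?c *\<^sub>R z) \<partial>M) = (\<integral>\<omega>. indicat_real (cball (x - ?c *\<^sub>R z) R') (X s \<omega>) \<partial>M)"
        by (rule Bochner_Integration.integral_cong) (auto simp: indicator_def dist_norm algebra_simps)
      also have "\<dots> = (\<integral>y. indicat_real (cball (x - ?c *\<^sub>R z) R') y \<partial>\<mu> s)"
        unfolding lawX[OF order_refl, symmetric] by (subst integral_distr) auto
      also have "\<dots> = measure (\<mu> s) (cball (x - ?c *\<^sub>R z) R')"
        using sets_eq_imp_space_eq[OF sets_mu[OF order_refl]] by simp
      finally show ?thesis .
    qed
    then show "AE z in gauss2 (t - s). (\<integral>\<omega>. indicat_real (cball x R') (X s \<omega> + ?c *\<^sub>R z) \<partial>M) \<le> \<Lambda> * (pi * R'\<^sup>2)"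
      using L(2)[OF R'] by simp
    show "integrable (gauss2 (t - s)) (\<lambda>z. \<integral>\<omega>. indicat_real (cball x R') (X s \<omega> + ?c *\<^sub>R z) \<partial>M)"
    proof (rule G.integrable_const_bound[of _ 1])
      have "norm (\<integral>\<omega>. indicat_real (cball x R') (X s \<omega> + ?c *\<^sub>R z) \<partial>M) \<le> 1" for z
      proof -
        have "(\<integral>\<omega>. indicat_real (cball x R') (X s \<omega> + ?c *\<^sub>R z) \<partial>M) \<le> 1"
          by (intro integral_le_const integrable_const_bound[of _ 1]) (auto simp: indicator_le_1)
        then show ?thesis by (simp add: abs_le_iff order_trans[of _ 0])
      qed
      then show "AE z in gauss2 (t - s). norm (\<integral>\<omega>. indicat_real (cball x R') (X s \<omega> + ?c *\<^sub>R z) \<partial>M) \<le> 1" by simp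
    qed measurable
  qed
  finally show ?thesis unfolding R'_def .
qed

text \<open>In units of h = sqrt (t - s) the zones of \<open>bs_potential_le\<close> have radii e
  and R. Each of the three terms becomes at most \<eta> / (3 h): the core by small e, the far field
  by large R, the middle zone by short time, as its mass is O(h^2).\<close>

lemma bs_potential_small:
  assumes u: "\<And>t. s < t \<Longrightarrow> \<mu> t = density lborel (\<lambda>x. ennreal (u t x))" "\<And>t. s < t \<Longrightarrow> u t \<in> borel_measurable borel"
    "\<And>t. s < t \<Longrightarrow> AE x in lborel. u t x \<le> C / (t - s)" and C: "0 < C"
    and L: "0 \<le> \<Lambda>" "\<And>y r. 0 \<le> r \<Longrightarrow> measure (\<mu> s) (cball y r) \<le> \<Lambda> * (pi * r\<^sup>2)" and \<eta>: "0 < \<eta>"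
  shows "\<exists>\<delta>>0. \<forall>t x. s < t \<and> t \<le> s + \<delta> \<longrightarrow> bs_potential (\<mu> t) x \<le> ennreal (\<eta> / sqrt (t - s))"
proof -
  \<comment> \<open>\<open>R\<close> is fixed first, then \<open>e\<close>, then the time: the
    middle term contains both earlier choices and is tamed by h^2 <= \<delta>. The summand 1 in
    \<open>K\<close> keeps the divisor positive when \<Lambda> = 0.\<close>
  define R where "R = 1 + 1 / \<eta>"
  define e where "e = min R (\<eta> / (6 * C))"
  define K where "K = \<Lambda> * (R + 2 * \<beta>)\<^sup>2 + 1"
  define \<delta> where "\<delta> = 2 * e * \<eta> / (3 * K)"
  have R: "0 < R" "1 / R \<le> \<eta>" using \<eta> by (auto simp: R_def field_simps add_pos_pos)
  have e: "0 < e" "e \<le> R" "2 * C * e \<le> \<eta> / 3"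
  proof -
    show "0 < e" "e \<le> R" using R \<eta> C by (auto simp: e_def)
    have "e \<le> \<eta> / (6 * C)" by (simp add: e_def)
    then show "2 * C * e \<le> \<eta> / 3" using C by (simp add: field_simps)
  qed
  have K: "0 < K" using L(1) by (simp add: K_def add_nonneg_pos)
  have \<delta>: "0 < \<delta>" using e \<eta> K by (simp add: \<delta>_def)
  have "bs_potential (\<mu> t) x \<le> ennreal (\<eta> / sqrt (t - s))" if t: "s < t" "t \<le> s + \<delta>" for t x
  proof -
    define h where "h = sqrt (t - s)"
    have h: "0 < h" "h * h = t - s" "h * h \<le> \<delta>" using t by (auto simp: h_def)
    interpret mu: prob_space "\<mu> t" using prob_mu t by simp
    let ?m = "\<Lambda> * (pi * (R * h + 2 * \<beta> * h)\<^sup>2)"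
    have "bs_potential (\<mu> t) x \<le> ennreal (2 * (C / (t - s)) * (e * h) + ?m / (2 * pi * (e * h)) + 1 / (2 * pi * (R * h)))"
    proof (rule bs_potential_le[OF u(1) u(2) u(3) mu.prob_space_axioms])
      show "emeasure (\<mu> t) (cball x (R * h)) \<le> ennreal ?m"
        unfolding mu.emeasure_eq_measure h_def using R h t by (intro ennreal_leI measure_cball_le L) auto
    qed (use t C h e L in auto)
    also have "2 * (C / (t - s)) * (e * h) + ?m / (2 * pi * (e * h)) + 1 / (2 * pi * (R * h)) =
       (2 * C * e + \<Lambda> * (R + 2 * \<beta>)\<^sup>2 * (h * h) / (2 * e) + (1 / R) / (2 * pi)) / h"
    proof -
      have "2 * (C / (t - s)) * (e * h) = 2 * C * e / h" unfolding h(2)[symmetric] using h(1) by (simp add: field_simps)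
      moreover have "?m / (2 * pi * (e * h)) = \<Lambda> * (R + 2 * \<beta>)\<^sup>2 * (h * h) / (2 * e) / h"
      proof -
        have "(R * h + 2 * \<beta> * h)\<^sup>2 = (R + 2 * \<beta>)\<^sup>2 * (h * h)" by (simp add: power2_eq_square algebra_simps)
        then show ?thesis using h(1) e(1) by (simp add: field_simps)
      qed
      moreover have "1 / (2 * pi * (R * h)) = (1 / R) / (2 * pi) / h" by (simp add: field_simps)
      ultimately show ?thesis by (simp add: add_divide_distrib)
    qed
    also have "\<dots> \<le> \<eta> / h"
    proof (rule divide_right_mono)
      have "\<Lambda> * (R + 2 * \<beta>)\<^sup>2 * (h * h) / (2 * e) \<le> K * \<delta> / (2 * e)"
        using h e L(1) K t by (intro divide_right_mono mult_mono) (auto simp: K_def)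
      also have "\<dots> = \<eta> / 3" using K e(1) by (simp add: \<delta>_def)
      finally have 2: "\<Lambda> * (R + 2 * \<beta>)\<^sup>2 * (h * h) / (2 * e) \<le> \<eta> / 3" .
      have "(1 / R) / (2 * pi) \<le> \<eta> / 3"
        using R pi_gt3 \<eta> by (intro frac_le) auto
      with 2 e(3) show "2 * C * e + \<Lambda> * (R + 2 * \<beta>)\<^sup>2 * (h * h) / (2 * e) + (1 / R) / (2 * pi) \<le> \<eta>" by simp
    qed (use h in simp)
    finally show ?thesis unfolding h_def by (simp add: ennreal_leI)
  qed
  then show ?thesis using \<delta> by blast
qed
end

lemma measure_density_cball_le:
  fixes u :: "real^2 \<Rightarrow> real"
  assumes [measurable]: "u \<in> borel_measurable borel" and u: "AE x in lborel. u x \<le> \<Lambda>" "0 \<le> \<Lambda>" and r: "0 \<le> r"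
  shows "measure (density lborel (\<lambda>x. ennreal (u x))) (cball y r) \<le> \<Lambda> * (pi * r\<^sup>2)"
proof -
  have [measurable]: "cball y r \<in> sets borel" by (simp add: borel_closed)
  have "emeasure (density lborel (\<lambda>x. ennreal (u x))) (cball y r) = (\<integral>\<^sup>+x. ennreal (u x) * indicator (cball y r) x \<partial>lborel)"
    by (rule emeasure_density) auto
  also have "\<dots> \<le> (\<integral>\<^sup>+x. ennreal \<Lambda> * indicator (cball y r) x \<partial>lborel)"
    using u by (intro nn_integral_mono_AE) (auto elim!: eventually_mono intro!: mult_right_mono ennreal_leI)
  also have "\<dots> = ennreal \<Lambda> * emeasure lborel (cball y r)" by (rule nn_integral_cmult_indicator) simp
  also have "\<dots> = ennreal (\<Lambda> * (pi * r\<^sup>2))"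
    using r u(2) by (subst emeasure_cball) (auto simp: unit_ball_vol_2 ennreal_mult)
  finally show ?thesis using u(2) unfolding measure_def by (intro enn2real_leI) auto
qed

section \<open>Regular conditional distributions\<close>

text \<open>The test set is {g < f}; the integral of g over it is finite and can be
  cancelled.\<close>

lemma AE_le_if_nn_integral_le:
  fixes f g :: "'a \<Rightarrow> ennreal"
  assumes [measurable]: "f \<in> borel_measurable M" "g \<in> borel_measurable M" and fin: "(\<integral>\<^sup>+x. g x \<partial>M) < \<infinity>"
    and le: "\<And>A. A \<in> sets M \<Longrightarrow> (\<integral>\<^sup>+x. f x * indicator A x \<partial>M) \<le> (\<integral>\<^sup>+x. g x * indicator A x \<partial>M)"
  shows "AE x in M. f x \<le> g x"
proof -
  let ?A = "{x\<in>space M. g x < f x}"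
  have [measurable]: "?A \<in> sets M" by measurable
  have gA: "(\<integral>\<^sup>+x. g x * indicator ?A x \<partial>M) < \<infinity>"
    by (rule le_less_trans[OF nn_integral_mono fin]) (auto simp: indicator_def)
  have "(\<integral>\<^sup>+x. g x * indicator ?A x \<partial>M) + (\<integral>\<^sup>+x. (f x - g x) * indicator ?A x \<partial>M) = (\<integral>\<^sup>+x. f x * indicator ?A x \<partial>M)"
    by (subst nn_integral_add[symmetric]) (auto intro!: nn_integral_cong simp: indicator_def add_diff_inverse_ennreal less_imp_le)
  also have "\<dots> \<le> (\<integral>\<^sup>+x. g x * indicator ?A x \<partial>M) + 0" using le[of ?A] by simp
  finally have "(\<integral>\<^sup>+x. (f x - g x) * indicator ?A x \<partial>M) = 0"
    using gA by (subst (asm) ennreal_add_left_cancel_le) auto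
  then have "AE x in M. (f x - g x) * indicator ?A x = 0"
    by (subst (asm) nn_integral_0_iff_AE) auto
  then show ?thesis
    by (rule AE_mp) (auto intro!: AE_I2 simp: indicator_def not_less[symmetric] diff_eq_0_iff_ennreal split: if_splits)
qed

text \<open>For one threshold the conditional distribution function is a Radon-Nikodym derivative,
  monotone and bounded only almost everywhere. Countably many rational thresholds are treated and
  their versions repaired, so that the properties hold for every y.\<close>

lemma regular_conditional_cdf:
  fixes U :: "'a \<Rightarrow> real" and Y :: "'a \<Rightarrow> 'b"
  assumes Q: "prob_space Q" and Y[measurable]: "Y \<in> measurable Q N" and U[measurable]: "U \<in> borel_measurable Q"
    and U01: "\<And>\<omega>. \<omega> \<in> space Q \<Longrightarrow> 0 \<le> U \<omega> \<and> U \<omega> \<le> 1"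
  obtains F :: "'b \<Rightarrow> real \<Rightarrow> real" where
    "\<And>a. (\<lambda>y. F y a) \<in> borel_measurable N" "\<And>y a b. a \<le> b \<Longrightarrow> F y a \<le> F y b"
    "\<And>y a. 0 \<le> F y a" "\<And>y a. F y a \<le> 1"
    "\<And>y a. continuous (at_right a) (F y)" "\<And>y a. a < 0 \<Longrightarrow> F y a = 0" "\<And>y a. 1 \<le> a \<Longrightarrow> F y a = 1"
    "\<And>a A. A \<in> sets N \<Longrightarrow> measure Q {\<omega>\<in>space Q. Y \<omega> \<in> A \<and> U \<omega> \<le> a} = (\<integral>y. indicator A y * F y a \<partial>distr Q N Y)"
proof -
  interpret prob_space Q by fact
  let ?n = "distr Q N Y"
  interpret n: prob_space ?n by (rule prob_space_distr) measurable
  \<comment> \<open>The law of \<open>Y\<close> on the event {U <= d}. Its density with respect to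
    the law of \<open>Y\<close> is the conditional probability of that event.\<close>
  define L where "L d = distr (density Q (indicator {\<omega>\<in>space Q. U \<omega> \<le> real_of_rat d})) N Y" for d
  have Lem: "emeasure (L d) A = emeasure Q {\<omega>\<in>space Q. Y \<omega> \<in> A \<and> U \<omega> \<le> real_of_rat d}" if [measurable]: "A \<in> sets N" for d A
  proof -
    have "emeasure (L d) A = emeasure (density Q (indicator {\<omega>\<in>space Q. U \<omega> \<le> real_of_rat d})) (Y -` A \<inter> space Q)"
      unfolding L_def by (subst emeasure_distr) auto
    also have "\<dots> = (\<integral>\<^sup>+\<omega>. indicator {\<omega>\<in>space Q. U \<omega> \<le> real_of_rat d} \<omega> * indicator (Y -` A \<inter> space Q) \<omega> \<partial>Q)"
      by (rule emeasure_density) auto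
    also have "\<dots> = (\<integral>\<^sup>+\<omega>. indicator {\<omega>\<in>space Q. Y \<omega> \<in> A \<and> U \<omega> \<le> real_of_rat d} \<omega> \<partial>Q)"
      by (rule nn_integral_cong) (auto simp: indicator_def)
    also have "\<dots> = emeasure Q {\<omega>\<in>space Q. Y \<omega> \<in> A \<and> U \<omega> \<le> real_of_rat d}"
      by (rule nn_integral_indicator) measurable
    finally show ?thesis .
  qed
  have nem: "emeasure ?n A = emeasure Q {\<omega>\<in>space Q. Y \<omega> \<in> A}" if [measurable]: "A \<in> sets N" for A
    by (subst emeasure_distr) (auto intro!: arg_cong2[where f=emeasure])
  have setsL: "sets (L d) = sets ?n" for d by (simp add: L_def)
  have Lle: "emeasure (L d) A \<le> emeasure ?n A" if [measurable]: "A \<in> sets N" for d A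
    unfolding Lem[OF that] nem[OF that] by (rule emeasure_mono) auto
  define R where "R d = RN_deriv ?n (L d)" for d
  have [measurable]: "R d \<in> borel_measurable N" for d
    using borel_measurable_RN_deriv[of ?n "L d"] by (simp add: R_def)
  have dR: "density ?n (R d) = L d" for d
    unfolding R_def
  proof (rule n.density_RN_deriv)
    show "absolutely_continuous ?n (L d)"
      unfolding absolutely_continuous_def null_sets_def using Lle setsL by fastforce
  qed (rule setsL)
  have RA: "(\<integral>\<^sup>+y. R d y * indicator A y \<partial>?n) = emeasure (L d) A" if [measurable]: "A \<in> sets N" for d A
    by (subst dR[symmetric], subst emeasure_density) auto
  have R1: "AE y in ?n. R d y \<le> 1" for d
  proof (rule AE_le_if_nn_integral_le)
    show "(\<integral>\<^sup>+y. R d y * indicator A y \<partial>?n) \<le> (\<integral>\<^sup>+y. 1 * indicator A y \<partial>?n)" if "A \<in> sets ?n" for A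
      using RA[of A d] Lle[of A d] that by simp
  qed (auto simp: n.emeasure_eq_measure)
  have Rmono: "AE y in ?n. R d y \<le> R e y" if "d \<le> e" for d e
  proof (rule AE_le_if_nn_integral_le)
    show "(\<integral>\<^sup>+y. R d y * indicator A y \<partial>?n) \<le> (\<integral>\<^sup>+y. R e y * indicator A y \<partial>?n)" if "A \<in> sets ?n" for A
    proof -
      have A: "A \<in> sets N" using that by simp
      have "real_of_rat d \<le> real_of_rat e" using \<open>d \<le> e\<close> by (simp add: of_rat_less_eq)
      then show ?thesis unfolding RA[OF A] Lem[OF A] using A by (intro emeasure_mono) auto
    qed
    have "(\<integral>\<^sup>+y. R e y \<partial>?n) \<le> (\<integral>\<^sup>+y. 1 \<partial>?n)" using R1[of e] by (rule nn_integral_mono_AE)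
    then show "(\<integral>\<^sup>+y. R e y \<partial>?n) < \<infinity>" by (simp add: n.emeasure_eq_measure le_less_trans)
  qed auto
  \<comment> \<open>The forced values 0 and 1 reflect that U lies in [0, 1] and give the limits at
    both infinities for every y.\<close>
  define f where "f d y = (if d < 0 then 0 else if 1 \<le> d then 1 else min 1 (enn2real (R d y)))" for d y
  have f01: "0 \<le> f d y" "f d y \<le> 1" for d y by (auto simp: f_def)
  have [measurable]: "f d \<in> borel_measurable N" for d unfolding f_def[abs_def] by measurable
  have fR: "AE y in ?n. ennreal (f d y) = R d y" for d
  proof -
    consider "d < 0" | "1 \<le> d" | "0 \<le> d" "d < 1" by linarith
    then show ?thesis
    proof cases
      case 1
      have "emeasure (L d) (space N) = 0"
      proof -
        have "{\<omega>\<in>space Q. Y \<omega> \<in> space N \<and> U \<omega> \<le> real_of_rat d} = {}"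
          using U01 1 by (force simp: of_rat_less_0_iff[symmetric, where 'a=real] simp del: of_rat_less_0_iff)
        then show ?thesis using Lem[OF sets.top, of d] by (simp only: emeasure_empty)
      qed
      moreover have "(\<integral>\<^sup>+y. R d y \<partial>?n) = (\<integral>\<^sup>+y. R d y * indicator (space N) y \<partial>?n)"
        by (rule nn_integral_cong) simp
      ultimately have "(\<integral>\<^sup>+y. R d y \<partial>?n) = 0"
        using RA[OF sets.top, of d] by simp
      then have "AE y in ?n. R d y = 0" by (subst (asm) nn_integral_0_iff_AE) auto
      then show ?thesis using 1 by (auto simp: f_def)
    next
      case 2
      have "AE y in ?n. 1 \<le> R d y"
      proof (rule AE_le_if_nn_integral_le)
        have "(\<integral>\<^sup>+y. R d y \<partial>?n) \<le> (\<integral>\<^sup>+y. 1 \<partial>?n)" using R1[of d] by (rule nn_integral_mono_AE)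
        then show "(\<integral>\<^sup>+y. R d y \<partial>?n) < \<infinity>" by (simp add: n.emeasure_eq_measure le_less_trans)
        fix A assume "A \<in> sets ?n"
        then have A: "A \<in> sets N" by simp
        have "1 \<le> real_of_rat d" using 2 by simp
        then have "{\<omega>\<in>space Q. Y \<omega> \<in> A \<and> U \<omega> \<le> real_of_rat d} = {\<omega>\<in>space Q. Y \<omega> \<in> A}"
          using U01 by (fastforce intro: order_trans)
        then show "(\<integral>\<^sup>+y. 1 * indicator A y \<partial>?n) \<le> (\<integral>\<^sup>+y. R d y * indicator A y \<partial>?n)"
          using A by (simp add: RA Lem nem)
      qed auto
      with R1[of d] show ?thesis by eventually_elim (use 2 in \<open>auto simp: f_def antisym\<close>)
    next
      case 3
      from R1[of d] show ?thesis
      proof (rule eventually_mono)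
        fix y assume r: "R d y \<le> 1"
        then have fin: "R d y < top" by (rule le_less_trans) simp
        then have "enn2real (R d y) \<le> 1" using r by (metis enn2real_1 enn2real_mono ennreal_one_less_top)
        then show "ennreal (f d y) = R d y" using 3 fin by (simp add: f_def min_absorb2 ennreal_enn2real)
      qed
    qed
  qed
  \<comment> \<open>The running supremum is monotone in the threshold at every y. It agrees with
    \<open>f c\<close> almost everywhere, as only countably many inequalities are involved.\<close>
  define g where "g c y = (SUP d\<in>{..c}. f d y)" for c y
  have bddf: "bdd_above ((\<lambda>d. f d y) ` S)" for y S using f01 by (auto intro!: bdd_aboveI[of _ 1])
  have g01: "0 \<le> g c y" "g c y \<le> 1" for c y
  proof -
    show "g c y \<le> 1" unfolding g_def using f01 by (intro cSUP_least) auto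
    have "f c y \<le> g c y" unfolding g_def by (intro cSUP_upper bddf) auto
    then show "0 \<le> g c y" using f01[of c y] by linarith
  qed
  have gmono: "g c y \<le> g d y" if "c \<le> d" for c d y
    unfolding g_def using that by (intro cSUP_subset_mono bddf) auto
  have [measurable]: "g c \<in> borel_measurable N" for c
    unfolding g_def[abs_def] by (intro borel_measurable_cSUP bddf) auto
  have g0: "g c y = 0" if "c < 0" for c y
  proof -
    have "g c y = (SUP d\<in>{..c}. (0::real))" unfolding g_def using that by (intro SUP_cong) (auto simp: f_def)
    then show ?thesis by simp
  qed
  have g1: "g c y = 1" if "1 \<le> c" for c y
  proof (rule antisym[OF g01(2)])
    have "f c y \<le> g c y" unfolding g_def by (intro cSUP_upper bddf) auto
    then show "1 \<le> g c y" using that by (simp add: f_def)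
  qed
  have gf: "AE y in ?n. g c y = f c y" for c
  proof -
    have "AE y in ?n. \<forall>d\<in>{..c}. ennreal (f d y) \<le> ennreal (f c y)"
    proof (subst AE_ball_countable)
      show "\<forall>d\<in>{..c}. AE y in ?n. ennreal (f d y) \<le> ennreal (f c y)"
      proof
        fix d assume "d \<in> {..c}"
        then have "AE y in ?n. R d y \<le> R c y" by (intro Rmono) auto
        with fR[of d] fR[of c] show "AE y in ?n. ennreal (f d y) \<le> ennreal (f c y)" by eventually_elim auto
      qed
    qed auto
    then show ?thesis
    proof (rule eventually_mono)
      fix y assume "\<forall>d\<in>{..c}. ennreal (f d y) \<le> ennreal (f c y)"
      then have "\<forall>d\<in>{..c}. f d y \<le> f c y" using f01 by simp
      then show "g c y = f c y"
        unfolding g_def by (intro antisym cSUP_least cSUP_upper bddf) auto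
    qed
  qed
  have gI: "(\<integral>y. indicator A y * g c y \<partial>?n) = measure Q {\<omega>\<in>space Q. Y \<omega> \<in> A \<and> U \<omega> \<le> real_of_rat c}"
    if A[measurable]: "A \<in> sets N" for A c
  proof -
    have "(\<integral>y. indicator A y * g c y \<partial>?n) = enn2real (\<integral>\<^sup>+y. ennreal (indicator A y * g c y) \<partial>?n)"
      using g01 by (intro integral_eq_nn_integral) auto
    also have "(\<integral>\<^sup>+y. ennreal (indicator A y * g c y) \<partial>?n) = (\<integral>\<^sup>+y. R c y * indicator A y \<partial>?n)"
    proof (rule nn_integral_cong_AE)
      show "AE y in ?n. ennreal (indicator A y * g c y) = R c y * indicator A y"
        using gf[of c] fR[of c] by eventually_elim (auto simp: indicator_def)
    qed
    finally show ?thesis unfolding RA[OF A] Lem[OF A] measure_def .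
  qed
  define S where "S a = {c. a < real_of_rat c}" for a
  have Sne: "S a \<noteq> {}" for a using of_rat_dense[of a "a + 1"] by (auto simp: S_def)
  \<comment> \<open>The infimum runs over thresholds strictly above a: this right limit extends
    \<open>g\<close> to real thresholds and forces right continuity.\<close>
  define F where "F y a = (INF c\<in>S a. g c y)" for y a
  have bddg: "bdd_below ((\<lambda>d. g d y) ` T)" for y T using g01 by (auto intro!: bdd_belowI[of _ 0])
  have Fle: "F y a \<le> g c y" if "a < real_of_rat c" for y a c
    unfolding F_def using that by (intro cINF_lower bddg) (auto simp: S_def)
  have F0: "0 \<le> F y a" for y a unfolding F_def using g01 Sne by (intro cINF_greatest) auto
  have F1: "F y a \<le> 1" for y a
  proof -
    obtain c where "c \<in> S a" using Sne by blast
    then show ?thesis using Fle[of a c y] g01(2)[of c y] by (auto simp: S_def)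
  qed
  have Fmono: "F y a \<le> F y b" if "a \<le> b" for y a b
    unfolding F_def using that Sne by (intro cINF_superset_mono bddg) (auto simp: S_def)
  have Fex: "\<exists>c. a < real_of_rat c \<and> g c y < F y a + e" if "0 < e" for y a e
  proof -
    have "(INF c\<in>S a. g c y) < F y a + e" using that by (simp add: F_def)
    then show ?thesis using cINF_less_iff[OF Sne bddg] by (auto simp: S_def)
  qed
  have Frc: "continuous (at_right a) (F y)" for y a
  proof (subst continuous_at_right_real_increasing)
    show "\<forall>e>0. \<exists>d>0. F y (a + d) - F y a < e"
    proof (intro allI impI)
      fix e :: real assume "0 < e"
      then obtain c where c: "a < real_of_rat c" "g c y < F y a + e" using Fex by blast
      have "F y (a + (real_of_rat c - a) / 2) \<le> g c y" by (rule Fle) (use c in \<open>simp add: field_simps\<close>)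
      then show "\<exists>d>0. F y (a + d) - F y a < e" using c by (intro exI[of _ "(real_of_rat c - a) / 2"]) auto
    qed
  qed (rule Fmono)
  have Fneg: "F y a = 0" if a0: "a < 0" for y a
  proof -
    obtain c where c: "a < real_of_rat c" "real_of_rat c < 0" using of_rat_dense[OF a0] by blast
    then have "g c y = 0" by (intro g0) simp
    then show ?thesis using Fle[OF c(1), of y] F0[of y a] by simp
  qed
  have Fbig: "F y a = 1" if "1 \<le> a" for y a
  proof -
    have "F y a = (INF c\<in>S a. (1::real))" unfolding F_def
    proof (rule INF_cong[OF refl])
      fix c assume "c \<in> S a"
      then have "a < real_of_rat c" by (simp add: S_def)
      then have "1 < real_of_rat c" using that by linarith
      then show "g c y = 1" by (intro g1) simp
    qed
    then show ?thesis using Sne by simp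
  qed
  have Fm[measurable]: "(\<lambda>y. F y a) \<in> borel_measurable N" for a
    unfolding F_def by (intro borel_measurable_cINF_real) auto
  have FI: "measure Q {\<omega>\<in>space Q. Y \<omega> \<in> A \<and> U \<omega> \<le> a} = (\<integral>y. indicator A y * F y a \<partial>?n)" if A[measurable]: "A \<in> sets N" for A a
  proof -
    have "\<exists>c. a < real_of_rat c \<and> real_of_rat c < a + inverse (real (Suc k))" for k
      using of_rat_dense[of a "a + inverse (real (Suc k))"] by auto
    then obtain c0 where c0: "\<And>k. a < real_of_rat (c0 k)" "\<And>k. real_of_rat (c0 k) < a + inverse (real (Suc k))" by metis
    have c0lim: "(\<lambda>k. real_of_rat (c0 k)) \<longlonglongrightarrow> a"
    proof (rule tendsto_sandwich)
      show "\<forall>\<^sub>F k in sequentially. a \<le> real_of_rat (c0 k)" using c0(1) by (simp add: less_imp_le)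
      show "\<forall>\<^sub>F k in sequentially. real_of_rat (c0 k) \<le> a + inverse (real (Suc k))" using c0(2) by (simp add: less_imp_le)
      have "(\<lambda>k. a + inverse (real (Suc k))) \<longlonglongrightarrow> a + 0" by (intro tendsto_intros LIMSEQ_inverse_real_of_nat)
      then show "(\<lambda>k. a + inverse (real (Suc k))) \<longlonglongrightarrow> a" by simp
    qed simp
    have glim: "(\<lambda>k. g (c0 k) y) \<longlonglongrightarrow> F y a" for y
    proof (rule order_tendstoI)
      show "\<forall>\<^sub>F k in sequentially. l < g (c0 k) y" if "l < F y a" for l
        using less_le_trans[OF that Fle[OF c0(1)]] by simp
      fix u assume "F y a < u"
      then obtain c where c: "a < real_of_rat c" "g c y < u" using Fex[of "u - F y a" a y] by auto
      show "\<forall>\<^sub>F k in sequentially. g (c0 k) y < u"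
        using order_tendstoD(2)[OF c0lim c(1)]
      proof (rule eventually_mono)
        fix k assume "real_of_rat (c0 k) < real_of_rat c"
        then have "c0 k \<le> c" by (simp add: of_rat_less)
        then show "g (c0 k) y < u" using gmono[of "c0 k" c y] c(2) by simp
      qed
    qed
    have "(\<lambda>k. \<integral>y. indicator A y * g (c0 k) y \<partial>?n) \<longlonglongrightarrow> (\<integral>y. indicator A y * F y a \<partial>?n)"
      by (rule integral_dominated_convergence[where w="\<lambda>_. 1"])
         (auto intro!: tendsto_intros glim simp: abs_mult g01 mult_le_one indicator_le_1)
    moreover have "(\<lambda>k. measure Q {\<omega>\<in>space Q. Y \<omega> \<in> A \<and> U \<omega> \<le> real_of_rat (c0 k)}) \<longlonglongrightarrow> measure Q {\<omega>\<in>space Q. Y \<omega> \<in> A \<and> U \<omega> \<le> a}"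
    proof -
      have "(\<lambda>k. \<integral>\<omega>. indicat_real {\<omega>\<in>space Q. Y \<omega> \<in> A \<and> U \<omega> \<le> real_of_rat (c0 k)} \<omega> \<partial>Q)
         \<longlonglongrightarrow> (\<integral>\<omega>. indicat_real {\<omega>\<in>space Q. Y \<omega> \<in> A \<and> U \<omega> \<le> a} \<omega> \<partial>Q)"
      proof (rule integral_dominated_convergence[where w="\<lambda>_. 1"])
        show "AE \<omega> in Q. (\<lambda>k. indicat_real {\<omega>\<in>space Q. Y \<omega> \<in> A \<and> U \<omega> \<le> real_of_rat (c0 k)} \<omega>)
            \<longlonglongrightarrow> indicat_real {\<omega>\<in>space Q. Y \<omega> \<in> A \<and> U \<omega> \<le> a} \<omega>"
        proof (rule AE_I2)
          fix \<omega> assume "\<omega> \<in> space Q"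
          show "(\<lambda>k. indicat_real {\<omega>\<in>space Q. Y \<omega> \<in> A \<and> U \<omega> \<le> real_of_rat (c0 k)} \<omega>)
            \<longlonglongrightarrow> indicat_real {\<omega>\<in>space Q. Y \<omega> \<in> A \<and> U \<omega> \<le> a} \<omega>"
          proof (cases "U \<omega> \<le> a")
            case True
            then have "U \<omega> \<le> real_of_rat (c0 k)" for k using c0(1)[of k] by simp
            then show ?thesis using True by (simp add: indicator_def)
          next
            case False
            then have "\<forall>\<^sub>F k in sequentially. real_of_rat (c0 k) < U \<omega>"
              using order_tendstoD(2)[OF c0lim] by simp
            then have "\<forall>\<^sub>F k in sequentially. indicat_real {\<omega>\<in>space Q. Y \<omega> \<in> A \<and> U \<omega> \<le> real_of_rat (c0 k)} \<omega> = 0"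
              by (rule eventually_mono) (simp add: indicator_def)
            then show ?thesis using False by (simp add: tendsto_eventually indicator_def)
          qed
        qed
      qed auto
      then show ?thesis by (simp add: Int_absorb2 Collect_conj_eq)
    qed
    ultimately show ?thesis unfolding gI[OF A] using LIMSEQ_unique by blast
  qed
  show thesis by (rule that[OF Fm Fmono F0 F1 Frc Fneg Fbig FI])
qed

text \<open>Every \<open>F y\<close> is a distribution function and so defines a measure without
  exceptional y. The identity holds on half-lines by construction, on rectangles by uniqueness of
  distribution functions, and on all product sets because rectangles generate them.\<close>

lemma regular_conditional_real:
  fixes U :: "'a \<Rightarrow> real" and Y :: "'a \<Rightarrow> 'b"
  assumes Q: "prob_space Q" and Y[measurable]: "Y \<in> measurable Q N" and U[measurable]: "U \<in> borel_measurable Q"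
    and U01: "\<And>\<omega>. \<omega> \<in> space Q \<Longrightarrow> 0 \<le> U \<omega> \<and> U \<omega> \<le> 1"
  obtains q where "q \<in> measurable N (prob_algebra borel)"
    "\<And>S. S \<in> sets (N \<Otimes>\<^sub>M borel) \<Longrightarrow> emeasure Q {\<omega>\<in>space Q. (Y \<omega>, U \<omega>) \<in> S} = (\<integral>\<^sup>+y. emeasure (q y) {x. (y, x) \<in> S} \<partial>distr Q N Y)"
proof -
  interpret prob_space Q by fact
  let ?n = "distr Q N Y"
  interpret n: prob_space ?n by (rule prob_space_distr) measurable
  obtain F :: "'b \<Rightarrow> real \<Rightarrow> real" where F:
    "\<And>a. (\<lambda>y. F y a) \<in> borel_measurable N" "\<And>y a b. a \<le> b \<Longrightarrow> F y a \<le> F y b"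
    "\<And>y a. 0 \<le> F y a" "\<And>y a. F y a \<le> 1"
    "\<And>y a. continuous (at_right a) (F y)" "\<And>y a. a < 0 \<Longrightarrow> F y a = 0" "\<And>y a. 1 \<le> a \<Longrightarrow> F y a = 1"
    "\<And>a A. A \<in> sets N \<Longrightarrow> measure Q {\<omega>\<in>space Q. Y \<omega> \<in> A \<and> U \<omega> \<le> a} = (\<integral>y. indicator A y * F y a \<partial>?n)"
    by (rule regular_conditional_cdf[OF Q Y U U01]) (assumption | blast)+
  note [measurable] = F(1)
  have lim0: "(F y \<longlongrightarrow> 0) at_bot" for y
    by (rule tendsto_eventually) (use F(6) in \<open>auto simp: eventually_at_bot_dense intro!: exI[of _ 0]\<close>)
  have lim1: "(F y \<longlongrightarrow> 1) at_top" for y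
    by (rule tendsto_eventually) (use F(7) in \<open>auto simp: eventually_at_top_linorder intro!: exI[of _ 1]\<close>)
  define q where "q y = interval_measure (F y)" for y
  have qr: "real_distribution (q y)" for y
    unfolding q_def by (rule real_distribution_interval_measure[OF F(2) F(5) lim0 lim1])
  have qIic: "emeasure (q y) {..a} = ennreal (F y a)" for y a
    unfolding q_def by (rule emeasure_interval_measure_Iic[OF F(2) F(5) lim0])
  have qp: "prob_space (q y)" for y using qr unfolding real_distribution_def by blast
  have qs[simp, measurable_cong]: "sets (q y) = sets borel" for y by (simp add: q_def)
  have qm[measurable]: "q \<in> measurable N (prob_algebra borel)"
  proof (rule measurable_prob_algebra_generated[where \<Omega>=UNIV and G="range atMost"])
    show "sets (borel :: real measure) = sigma_sets UNIV (range atMost)" by (simp add: borel_eq_atMost)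
    show "Int_stable (range atMost :: real set set)" by (auto simp: Int_stable_def)
    show "(\<lambda>y. emeasure (q y) A) \<in> borel_measurable N" if A: "A \<in> range atMost" for A
    proof -
      obtain a where "A = {..a}" using A by blast
      then show ?thesis by (simp add: qIic)
    qed
  qed (auto simp: qp)
  have qsub[measurable]: "q \<in> measurable N (subprob_algebra borel)" using qm by (rule measurable_prob_algebraD)
  have ne: "space N \<noteq> {}" using n.not_empty by simp
  have rect: "emeasure Q {\<omega>\<in>space Q. Y \<omega> \<in> A \<and> U \<omega> \<in> C} = (\<integral>\<^sup>+y. indicator A y * emeasure (q y) C \<partial>?n)"
    if A[measurable]: "A \<in> sets N" and C[measurable]: "C \<in> sets borel" for A C
  proof -
    let ?A = "{\<omega>\<in>space Q. Y \<omega> \<in> A}"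
    let ?m1 = "distr (density Q (indicator ?A)) borel U" and ?m2 = "density ?n (indicator A) \<bind> q"
    have [measurable]: "?A \<in> sets Q" by measurable
    have e1: "emeasure ?m1 C = emeasure Q {\<omega>\<in>space Q. Y \<omega> \<in> A \<and> U \<omega> \<in> C}" if [measurable]: "C \<in> sets borel" for C
    proof -
      have "emeasure ?m1 C = emeasure (density Q (indicator ?A)) (U -` C \<inter> space Q)"
        by (subst emeasure_distr) auto
      also have "\<dots> = (\<integral>\<^sup>+\<omega>. indicator ?A \<omega> * indicator (U -` C \<inter> space Q) \<omega> \<partial>Q)"
        by (rule emeasure_density) auto
      also have "\<dots> = (\<integral>\<^sup>+\<omega>. indicator {\<omega>\<in>space Q. Y \<omega> \<in> A \<and> U \<omega> \<in> C} \<omega> \<partial>Q)"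
        by (rule nn_integral_cong) (auto simp: indicator_def)
      also have "\<dots> = emeasure Q {\<omega>\<in>space Q. Y \<omega> \<in> A \<and> U \<omega> \<in> C}"
        by (rule nn_integral_indicator) measurable
      finally show ?thesis .
    qed
    have e2: "emeasure ?m2 C = (\<integral>\<^sup>+y. indicator A y * emeasure (q y) C \<partial>?n)" if [measurable]: "C \<in> sets borel" for C
    proof -
      have "emeasure ?m2 C = (\<integral>\<^sup>+y. emeasure (q y) C \<partial>density ?n (indicator A))"
        using ne by (intro emeasure_bind[where N=borel]) auto
      also have "\<dots> = (\<integral>\<^sup>+y. indicator A y * emeasure (q y) C \<partial>?n)"
        by (rule nn_integral_density) auto
      finally show ?thesis .
    qed
    have s2: "sets ?m2 = sets borel" using ne by (intro sets_bind) auto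
    have "finite_measure ?m1"
      using e1[of UNIV] by (intro finite_measureI) (simp add: emeasure_eq_measure)
    then have fin1: "finite_borel_measure ?m1"
      by (simp add: finite_borel_measure_def finite_borel_measure_axioms_def)
    have "finite_measure ?m2"
    proof (rule finite_measureI)
      have "emeasure ?m2 UNIV \<le> (\<integral>\<^sup>+y. 1 \<partial>?n)"
        unfolding e2[OF sets.top[of "borel :: real measure", unfolded space_borel]]
        using prob_space.emeasure_le_1[OF qp] by (intro nn_integral_mono) (auto simp: indicator_def)
      also have "\<dots> = 1" using n.emeasure_space_1 by simp
      finally show "emeasure ?m2 (space ?m2) \<noteq> \<infinity>" using sets_eq_imp_space_eq[OF s2] by (auto simp: top_unique)
    qed
    then have fin2: "finite_borel_measure ?m2"
      using s2 by (simp add: finite_borel_measure_def finite_borel_measure_axioms_def)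
    have "cdf ?m1 = cdf ?m2"
    proof (rule ext)
      fix a
      have "emeasure ?m2 {..a} = (\<integral>\<^sup>+y. ennreal (indicator A y * F y a) \<partial>?n)"
        by (subst e2) (auto intro!: nn_integral_cong simp: qIic indicator_def)
      also have "\<dots> = ennreal (\<integral>y. indicator A y * F y a \<partial>?n)"
        by (rule nn_integral_eq_integral)
           (auto intro!: n.integrable_const_bound[of _ 1] simp: F(3,4) abs_mult mult_le_one indicator_le_1)
      also have "\<dots> = emeasure ?m1 {..a}"
        by (subst e1) (auto simp: F(8)[OF A, symmetric] emeasure_eq_measure)
      finally show "cdf ?m1 a = cdf ?m2 a" by (simp add: cdf_def measure_def)
    qed
    then have "?m1 = ?m2" by (rule cdf_unique'[OF fin1 fin2])
    then show ?thesis using e1[OF C] e2[OF C] by simp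
  qed
  let ?J1 = "distr Q (N \<Otimes>\<^sub>M borel) (\<lambda>\<omega>. (Y \<omega>, U \<omega>))"
  \<comment> \<open>The law of a pair whose first entry has the law of \<open>Y\<close> and whose
    second entry is drawn from \<open>q y\<close>.\<close>
  let ?J2 = "?n \<bind> (\<lambda>y. distr (q y) (N \<Otimes>\<^sub>M borel) (\<lambda>x. (y, x)))"
  have km: "(\<lambda>y. distr (q y) (N \<Otimes>\<^sub>M borel) (\<lambda>x. (y, x))) \<in> measurable ?n (subprob_algebra (N \<Otimes>\<^sub>M borel))"
    by (rule measurable_distr2[where M=borel]) auto
  have J2e: "emeasure ?J2 S = (\<integral>\<^sup>+y. emeasure (q y) {x. (y, x) \<in> S} \<partial>?n)" if S[measurable]: "S \<in> sets (N \<Otimes>\<^sub>M borel)" for S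
  proof -
    have "emeasure ?J2 S = (\<integral>\<^sup>+y. emeasure (distr (q y) (N \<Otimes>\<^sub>M borel) (\<lambda>x. (y, x))) S \<partial>?n)"
      using ne by (intro emeasure_bind[OF _ km]) auto
    also have "\<dots> = (\<integral>\<^sup>+y. emeasure (q y) {x. (y, x) \<in> S} \<partial>?n)"
    proof (rule nn_integral_cong)
      fix y assume "y \<in> space ?n"
      then have y[simp]: "y \<in> space N" by simp
      have "(\<lambda>x. (y, x)) -` S \<inter> space (q y) = {x. (y, x) \<in> S}" by (auto simp: q_def)
      then show "emeasure (distr (q y) (N \<Otimes>\<^sub>M borel) (\<lambda>x. (y, x))) S = emeasure (q y) {x. (y, x) \<in> S}"
        by (subst emeasure_distr) auto
    qed
    finally show ?thesis .
  qed
  have "?J1 = ?J2"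
  proof (rule measure_eqI_generator_eq[OF Int_stable_pair_measure_generator[of N borel], where \<Omega>="space N \<times> UNIV" and A="\<lambda>i. space N \<times> UNIV"])
    show "{a \<times> b |a b. a \<in> sets N \<and> b \<in> sets borel} \<subseteq> Pow (space N \<times> UNIV)" by (auto dest: sets.sets_into_space)
    show "sets ?J1 = sigma_sets (space N \<times> UNIV) {a \<times> b |a b. a \<in> sets N \<and> b \<in> sets borel}"
      by (simp add: sets_pair_measure)
    have "sets ?J2 = sets (N \<Otimes>\<^sub>M borel)" using ne by (intro sets_bind) auto
    then show "sets ?J2 = sigma_sets (space N \<times> UNIV) {a \<times> b |a b. a \<in> sets N \<and> b \<in> sets borel}"
      by (simp add: sets_pair_measure)
    have "space N \<times> UNIV \<in> {a \<times> b |a b. a \<in> sets N \<and> b \<in> sets borel}"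
      by (simp only: mem_Collect_eq, intro exI[of _ "space N"] exI[of _ UNIV]) simp
    then show "range (\<lambda>i. space N \<times> UNIV) \<subseteq> {a \<times> b |a b. a \<in> sets N \<and> b \<in> sets borel}" by blast
    show "emeasure ?J1 (space N \<times> UNIV) \<noteq> \<infinity>" for i :: nat
      by (subst emeasure_distr) (auto simp: emeasure_eq_measure)
    fix S assume "S \<in> {a \<times> b |a b. a \<in> sets N \<and> b \<in> sets (borel :: real measure)}"
    then obtain A C where S: "S = A \<times> C" and [measurable]: "A \<in> sets N" "C \<in> sets borel" by auto
    have "emeasure ?J1 S = emeasure Q {\<omega>\<in>space Q. Y \<omega> \<in> A \<and> U \<omega> \<in> C}"
      unfolding S by (subst emeasure_distr) (auto intro!: arg_cong2[where f=emeasure])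
    also have "\<dots> = (\<integral>\<^sup>+y. indicator A y * emeasure (q y) C \<partial>?n)" by (rule rect) auto
    also have "\<dots> = (\<integral>\<^sup>+y. emeasure (q y) {x. (y, x) \<in> S} \<partial>?n)"
      unfolding S by (rule nn_integral_cong) (auto simp: indicator_def)
    also have "\<dots> = emeasure ?J2 S" unfolding S by (rule J2e[symmetric]) auto
    finally show "emeasure ?J1 S = emeasure ?J2 S" .
  qed auto
  then have eq: "emeasure ?J1 S = emeasure ?J2 S" for S by simp
  show thesis
  proof (rule that[OF qm])
    fix S assume [measurable]: "S \<in> sets (N \<Otimes>\<^sub>M (borel :: real measure))"
    have "emeasure Q {\<omega>\<in>space Q. (Y \<omega>, U \<omega>) \<in> S} = emeasure ?J1 S"
      by (subst emeasure_distr) (auto intro!: arg_cong2[where f=emeasure])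
    then show "emeasure Q {\<omega>\<in>space Q. (Y \<omega>, U \<omega>) \<in> S} = (\<integral>\<^sup>+y. emeasure (q y) {x. (y, x) \<in> S} \<partial>?n)"
      unfolding eq by (simp add: J2e)
  qed
qed

section \<open>Coding of continuous paths by real numbers\<close>

text \<open>Digits 0 and 1 in base 3 can be read off without ambiguity. It suffices that decoding is defined and measurable on all
  reals and inverts encoding on continuous paths; the range of the encoding need not be identified.\<close>

definition ternary_digit :: "nat \<Rightarrow> real \<Rightarrow> bool" where
  "ternary_digit k x \<longleftrightarrow> \<lfloor>3 ^ Suc k * x\<rfloor> mod 3 = 1"

definition ternary_sum :: "(nat \<Rightarrow> bool) \<Rightarrow> real" where
  "ternary_sum b = (\<Sum>i. of_bool (b i) * (1/3) ^ Suc i)"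

lemma ternary_geometric: "(\<lambda>i. (1/3::real) ^ Suc i) sums (1/2)"
  using sums_mult[OF geometric_sums[of "1/3::real"], of "1/3"] by simp

lemma ternary_sum_summable: "summable (\<lambda>i. of_bool (b i) * (1/3::real) ^ Suc i)"
  by (rule summable_comparison_test'[OF sums_summable[OF ternary_geometric], of 0]) (auto simp: of_bool_def)

lemma ternary_sum_bounds: "0 \<le> ternary_sum b" "ternary_sum b \<le> 1/2"
proof -
  show "0 \<le> ternary_sum b" unfolding ternary_sum_def by (rule suminf_nonneg[OF ternary_sum_summable]) simp
  have "ternary_sum b \<le> (\<Sum>i. (1/3::real) ^ Suc i)" unfolding ternary_sum_def
    by (rule suminf_le[OF _ ternary_sum_summable sums_summable[OF ternary_geometric]]) (auto simp: of_bool_def)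
  then show "ternary_sum b \<le> 1/2" using sums_unique[OF ternary_geometric] by simp
qed

text \<open>Multiplication by 3^(k+1) shifts the digits. The tail becomes a number in [0, 1/2],
  which cannot carry into the integer part, and modulo 3 all earlier digits disappear.\<close>

lemma ternary_digit_sum: "ternary_digit k (ternary_sum b) = b k"
proof -
  let ?a = "\<lambda>i. of_bool (b i) * (1/3::real) ^ Suc i"
  have "ternary_sum b = (\<Sum>i. ?a (i + Suc k)) + (\<Sum>i<Suc k. ?a i)"
    unfolding ternary_sum_def by (rule suminf_split_initial_segment[OF ternary_sum_summable])
  also have "(\<Sum>i. ?a (i + Suc k)) = (1/3) ^ Suc k * ternary_sum (\<lambda>i. b (i + Suc k))"
    unfolding ternary_sum_def by (subst suminf_mult[symmetric, OF ternary_sum_summable]) (simp add: power_add ac_simps)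
  finally have "3 ^ Suc k * ternary_sum b = ternary_sum (\<lambda>i. b (i + Suc k)) + 3 ^ Suc k * (\<Sum>i<Suc k. ?a i)"
    by (simp add: distrib_left power_divide mult.assoc[symmetric] del: power_Suc sum.lessThan_Suc)
  also have "3 ^ Suc k * (\<Sum>i<Suc k. ?a i) = real_of_int (\<Sum>i<Suc k. of_bool (b i) * 3 ^ (k - i))"
    unfolding sum_distrib_left of_int_sum
  proof (rule sum.cong[OF refl])
    fix i assume "i \<in> {..<Suc k}"
    then have "Suc k = Suc i + (k - i)" by simp
    then have "(3::real) ^ Suc k = 3 ^ Suc i * 3 ^ (k - i)" by (metis power_add)
    then show "3 ^ Suc k * ?a i = real_of_int (of_bool (b i) * 3 ^ (k - i))"
      by (simp add: power_divide of_bool_def del: power_Suc)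
  qed
  finally have eq: "3 ^ Suc k * ternary_sum b = ternary_sum (\<lambda>i. b (i + Suc k)) + real_of_int (\<Sum>i<Suc k. of_bool (b i) * 3 ^ (k - i))" .
  have "\<lfloor>3 ^ Suc k * ternary_sum b\<rfloor> = (\<Sum>i<Suc k. of_bool (b i) * 3 ^ (k - i))"
    unfolding eq using ternary_sum_bounds[of "\<lambda>i. b (i + Suc k)"] by (intro floor_unique) auto
  also have "\<dots> = (\<Sum>i<k. of_bool (b i) * 3 ^ (k - i)) + of_bool (b k)" by simp
  also have "(\<dots>) mod 3 = of_bool (b k)"
  proof -
    have "(3::int) dvd (\<Sum>i<k. of_bool (b i) * 3 ^ (k - i))"
      by (intro dvd_sum dvd_mult dvd_power) auto
    then show ?thesis by (auto simp: mod_add_left_eq[symmetric] of_bool_def)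
  qed
  finally show ?thesis by (auto simp: ternary_digit_def of_bool_def)
qed

lemma measurable_ternary_digit [measurable]: "Measurable.pred borel (ternary_digit k)"
  unfolding ternary_digit_def by measurable

lemma measurable_ternary_sum:
  assumes [measurable]: "\<And>k. Measurable.pred M (\<lambda>w. b w k)"
  shows "(\<lambda>w. ternary_sum (b w)) \<in> borel_measurable M"
  unfolding ternary_sum_def by measurable

section \<open>Measurability on path space and the code of a path\<close>

lemma space_Omega_space [simp]: "space (Omega_space r) = Omega r"
  unfolding Omega_space_def by (subst space_measure_of) auto

lemma sets_Omega_space: "sets (Omega_space r) = sigma_sets (Omega r)
     {{w \<in> Omega r. w \<tau> \<in> B} | \<tau> B. r \<le> \<tau> \<and> B \<in> sets (borel :: (real^2) measure)}"
  unfolding Omega_space_def by (subst sets_measure_of) auto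

lemma measurable_Omega_coord:
  assumes "r \<le> t" shows "(\<lambda>w. w t) \<in> borel_measurable (Omega_space r)"
proof (rule measurableI)
  fix B :: "(real^2) set" assume "B \<in> sets borel"
  then show "(\<lambda>w. w t) -` B \<inter> space (Omega_space r) \<in> sets (Omega_space r)"
    unfolding sets_Omega_space using assms
    by (intro sigma_sets.Basic) (auto simp: vimage_def Int_def conj_commute intro!: exI[of _ t] exI[of _ B])
qed auto

lemma measurable_into_Omega:
  assumes "\<And>x. x \<in> space M \<Longrightarrow> f x \<in> Omega r" "\<And>t. r \<le> t \<Longrightarrow> (\<lambda>x. f x t) \<in> borel_measurable M"
  shows "f \<in> measurable M (Omega_space r)"
  unfolding Omega_space_def
proof (rule measurable_measure_of)
  fix y assume "y \<in> {{w \<in> Omega r. w \<tau> \<in> B} | \<tau> B. r \<le> \<tau> \<and> B \<in> sets (borel :: (real^2) measure)}"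
  then obtain \<tau> B where y: "y = {w \<in> Omega r. w \<tau> \<in> B}" "r \<le> \<tau>" "B \<in> sets borel" by auto
  have "f -` y \<inter> space M = (\<lambda>x. f x \<tau>) -` B \<inter> space M" using assms(1) y by auto
  then show "f -` y \<inter> space M \<in> sets M" using assms(2)[OF y(2)] y(3) by (simp add: measurable_sets)
qed (use assms(1) in auto)

text \<open>Each bit decides whether one coordinate at one dyadic time lies below one rational; the
  tuples are enumerated by \<open>from_nat\<close>. For a continuous path these answers determine
  everything.\<close>

definition path_bit :: "real \<Rightarrow> (real \<Rightarrow> real^2) \<Rightarrow> nat \<Rightarrow> bool" where
  "path_bit r w k = (case from_nat k :: bool \<times> nat \<times> nat \<times> rat of (b, j, n, c) \<Rightarrow>
     w (r + real j / 2 ^ n) $ (if b then 1 else 2) \<le> real_of_rat c)"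

text \<open>A Dedekind cut read off from the digits. The infimum is taken in the extended reals to
  be total: reals that encode no path receive some value too, and measurability is kept.\<close>

definition coord_of :: "real \<Rightarrow> bool \<Rightarrow> nat \<Rightarrow> nat \<Rightarrow> real" where
  "coord_of x b j n = real_of_ereal (INF c::rat. if ternary_digit (to_nat (b, j, n, c)) x then ereal (real_of_rat c) else \<infinity>)"

definition dyadic_val :: "real \<Rightarrow> nat \<Rightarrow> nat \<Rightarrow> real^2" where
  "dyadic_val x j n = coord_of x True j n *\<^sub>R axis 1 1 + coord_of x False j n *\<^sub>R axis 2 1"

text \<open>Uniform continuity on bounded sets of dyadic times, with countable quantifiers so that
  the condition is measurable. It also forces different representations of one dyadic time to yield
  the same value, as their times are at distance 0, below every 2^-l.\<close>

definition good_code :: "real \<Rightarrow> bool" where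
  "good_code x \<longleftrightarrow> (\<forall>K m::nat. \<exists>l::nat. \<forall>(j::nat) (n::nat) (j'::nat) (n'::nat).
     real j / 2 ^ n \<le> real K \<and> real j' / 2 ^ n' \<le> real K \<and> \<bar>real j / 2 ^ n - real j' / 2 ^ n'\<bar> < 1 / 2 ^ l \<longrightarrow>
     norm (dyadic_val x j n - dyadic_val x j' n') \<le> 1 / 2 ^ m)"

definition dyadic_index :: "nat \<Rightarrow> real \<Rightarrow> nat" where
  "dyadic_index n u = nat \<lfloor>2 ^ n * max 0 u\<rfloor>"

text \<open>Reals that are no good code are sent to the zero path, so that every real decodes into
  \<open>Omega r\<close>. The clipping at 0 in \<open>dyadic_index\<close> freezes the path before
  r, as \<open>Omega\<close> demands.\<close>

definition decode_path :: "real \<Rightarrow> real \<Rightarrow> real \<Rightarrow> real^2" where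
  "decode_path r x t = (if good_code x then lim (\<lambda>n. dyadic_val x (dyadic_index n (t - r)) n) else 0)"

lemma dyadic_index_bounds:
  "real (dyadic_index n u) / 2 ^ n \<le> max 0 u" "max 0 u - 1 / 2 ^ n \<le> real (dyadic_index n u) / 2 ^ n"
proof -
  let ?m = "2 ^ n * max 0 u"
  have nn: "real (dyadic_index n u) = of_int \<lfloor>?m\<rfloor>" unfolding dyadic_index_def by simp
  have "of_int \<lfloor>?m\<rfloor> \<le> ?m" "?m - 1 \<le> of_int \<lfloor>?m\<rfloor>" by linarith+
  then show "real (dyadic_index n u) / 2 ^ n \<le> max 0 u" "max 0 u - 1 / 2 ^ n \<le> real (dyadic_index n u) / 2 ^ n"
    unfolding nn using divide_right_mono[of "of_int \<lfloor>?m\<rfloor>" ?m "2 ^ n"] divide_right_mono[of "?m - 1" "of_int \<lfloor>?m\<rfloor>" "2 ^ n"]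
    by (simp_all add: diff_divide_distrib)
qed

lemma dyadic_index_tendsto: "(\<lambda>n. real (dyadic_index n u) / 2 ^ n) \<longlonglongrightarrow> max 0 u"
proof (rule tendsto_sandwich)
  have "(\<lambda>n. max 0 u - (1/2) ^ n) \<longlonglongrightarrow> max 0 u - 0" by (intro tendsto_intros LIMSEQ_power_zero) auto
  then show "(\<lambda>n. max 0 u - 1 / 2 ^ n) \<longlonglongrightarrow> max 0 u" by (simp add: power_divide)
qed (auto simp: dyadic_index_bounds)

lemma coord_of_encode: "coord_of (ternary_sum (path_bit r w)) b j n = w (r + real j / 2 ^ n) $ (if b then 1 else 2)"
proof -
  let ?v = "w (r + real j / 2 ^ n) $ (if b then 1 else 2)"
  have "(INF c::rat. if ?v \<le> real_of_rat c then ereal (real_of_rat c) else \<infinity>) = ereal ?v"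
  proof (rule antisym)
    show "ereal ?v \<le> (INF c::rat. if ?v \<le> real_of_rat c then ereal (real_of_rat c) else \<infinity>)"
      by (rule INF_greatest) auto
    show "(INF c::rat. if ?v \<le> real_of_rat c then ereal (real_of_rat c) else \<infinity>) \<le> ereal ?v"
    proof (rule ereal_le_epsilon2)
      fix e :: real assume "0 < e"
      then obtain c where c: "?v < real_of_rat c" "real_of_rat c < ?v + e" using of_rat_dense[of ?v "?v + e"] by auto
      have "(INF c::rat. if ?v \<le> real_of_rat c then ereal (real_of_rat c) else \<infinity>) \<le> (if ?v \<le> real_of_rat c then ereal (real_of_rat c) else \<infinity>)"
        by (rule INF_lower) simp
      also have "\<dots> \<le> ereal ?v + ereal e" using c by simp
      finally show "(INF c::rat. if ?v \<le> real_of_rat c then ereal (real_of_rat c) else \<infinity>) \<le> ereal ?v + ereal e" .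
    qed
  qed
  then show ?thesis unfolding coord_of_def ternary_digit_sum path_bit_def by simp
qed

lemma dyadic_val_encode: "dyadic_val (ternary_sum (path_bit r w)) j n = w (r + real j / 2 ^ n)"
  unfolding dyadic_val_def coord_of_encode by (simp add: vec_eq_iff forall_2 axis_def)

lemma good_code_encode:
  assumes "w \<in> Omega r" shows "good_code (ternary_sum (path_bit r w))"
  unfolding good_code_def dyadic_val_encode
proof (intro allI)
  fix K m :: nat
  have "continuous_on {r..r + real K} w"
    using assms by (auto simp: Omega_def intro: continuous_on_subset)
  then have "uniformly_continuous_on {r..r + real K} w"
    by (rule compact_uniformly_continuous) simp
  then obtain d where d: "0 < d" "\<And>x x'. x \<in> {r..r + real K} \<Longrightarrow> x' \<in> {r..r + real K} \<Longrightarrow> dist x' x < d \<Longrightarrow> dist (w x') (w x) < 1 / 2 ^ m"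
    unfolding uniformly_continuous_on_def by (metis zero_less_divide_1_iff zero_less_numeral zero_less_power)
  obtain l where l: "(1/2::real) ^ l < d" using real_arch_pow_inv[OF d(1), of "1/2"] by auto
  show "\<exists>l. \<forall>j n j' n'. real j / 2 ^ n \<le> real K \<and> real j' / 2 ^ n' \<le> real K \<and> \<bar>real j / 2 ^ n - real j' / 2 ^ n'\<bar> < 1 / 2 ^ l \<longrightarrow>
     norm (w (r + real j / 2 ^ n) - w (r + real j' / 2 ^ n')) \<le> 1 / 2 ^ m"
  proof (intro exI[of _ l] allI impI, elim conjE)
    fix j n j' n' :: nat
    assume a: "real j / 2 ^ n \<le> real K" "real j' / 2 ^ n' \<le> real K" "\<bar>real j / 2 ^ n - real j' / 2 ^ n'\<bar> < 1 / 2 ^ l"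
    have "dist (w (r + real j / 2 ^ n)) (w (r + real j' / 2 ^ n')) < 1 / 2 ^ m"
      using a l by (intro d(2)) (auto simp: dist_real_def power_divide)
    then show "norm (w (r + real j / 2 ^ n) - w (r + real j' / 2 ^ n')) \<le> 1 / 2 ^ m" by (simp add: dist_norm)
  qed
qed

lemma decode_encode:
  assumes w: "w \<in> Omega r" shows "decode_path r (ternary_sum (path_bit r w)) = w"
proof
  fix t
  have c: "continuous_on {r..} w" and fr: "\<And>t. t < r \<Longrightarrow> w t = w r" using w by (auto simp: Omega_def)
  have "(\<lambda>n. w (r + real (dyadic_index n (t - r)) / 2 ^ n)) \<longlonglongrightarrow> w (r + max 0 (t - r))"
    by (rule continuous_on_tendsto_compose[OF c]) (auto intro!: tendsto_intros dyadic_index_tendsto)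
  moreover have "w (r + max 0 (t - r)) = w t" using fr[of t] by (auto simp: max_def)
  ultimately show "decode_path r (ternary_sum (path_bit r w)) t = w t"
    using good_code_encode[OF w] by (simp add: decode_path_def dyadic_val_encode limI)
qed

text \<open>The claim covers every real, including those that encode no path. For a good code the
  dyadic values form Cauchy sequences, and the modulus of continuity passes to the limit.\<close>

lemma decode_path_in_Omega: "decode_path r x \<in> Omega r"
proof (cases "good_code x")
  case True
  let ?a = "\<lambda>n t. real (dyadic_index n (t - r)) / 2 ^ n" and ?v = "\<lambda>n t. dyadic_val x (dyadic_index n (t - r)) n"
  have g: "\<exists>l::nat. \<forall>n n' t t'. t \<le> r + real K \<longrightarrow> t' \<le> r + real K \<longrightarrow> \<bar>?a n t - ?a n' t'\<bar> < 1 / 2 ^ l \<longrightarrow> norm (?v n t - ?v n' t') \<le> 1 / 2 ^ m" for K m :: nat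
  proof -
    obtain l where l: "\<And>j n j' n'. real j / 2 ^ n \<le> real K \<Longrightarrow> real j' / 2 ^ n' \<le> real K \<Longrightarrow> \<bar>real j / 2 ^ n - real j' / 2 ^ n'\<bar> < 1 / 2 ^ l \<Longrightarrow>
     norm (dyadic_val x j n - dyadic_val x j' n') \<le> 1 / 2 ^ m"
      using True unfolding good_code_def by blast
    have "?a n t \<le> real K" if "t \<le> r + real K" for n t
      using dyadic_index_bounds(1)[of n "t - r"] that by (simp add: max_def split: if_splits)
    then show ?thesis using l by blast
  qed
  have conv: "(\<lambda>n. ?v n t) \<longlonglongrightarrow> decode_path r x t" for t
  proof -
    obtain K :: nat where K: "t \<le> r + real K" using real_arch_simple[of "t - r"] by (auto simp: algebra_simps)
    have "Cauchy (\<lambda>n. ?v n t)"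
    proof (rule metric_CauchyI)
      fix e :: real assume "0 < e"
      then obtain m where m: "(1/2::real) ^ m < e" using real_arch_pow_inv[of e "1/2"] by auto
      obtain l where l: "\<And>n n'. \<bar>?a n t - ?a n' t\<bar> < 1 / 2 ^ l \<Longrightarrow> norm (?v n t - ?v n' t) \<le> 1 / 2 ^ m"
        using g[of K m] K by blast
      have "Cauchy (\<lambda>n. ?a n t)" by (rule LIMSEQ_imp_Cauchy[OF dyadic_index_tendsto])
      then obtain M where "\<forall>n\<ge>M. \<forall>n'\<ge>M. dist (?a n t) (?a n' t) < 1 / 2 ^ l"
        using metric_CauchyD[of "\<lambda>n. ?a n t" "1 / 2 ^ l"] by auto
      then have "dist (?v n t) (?v n' t) < e" if "n \<ge> M" "n' \<ge> M" for n n'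
        using l[of n n'] m that by (simp add: dist_real_def dist_norm power_divide)
      then show "\<exists>M. \<forall>n\<ge>M. \<forall>n'\<ge>M. dist (?v n t) (?v n' t) < e" by blast
    qed
    then show ?thesis using True by (simp add: decode_path_def Cauchy_convergent_iff convergent_LIMSEQ_iff)
  qed
  have "continuous_on {r..} (decode_path r x)"
    unfolding continuous_on_iff
  proof (intro ballI allI impI)
    fix t e :: real assume t: "t \<in> {r..}" and "0 < e"
    then obtain m where m: "(1/2::real) ^ m < e" using real_arch_pow_inv[of e "1/2"] by auto
    \<comment> \<open>One unit of room beyond t, so that all t' closer than 1 to t lie in the window
      where the modulus holds.\<close>
    obtain K :: nat where K: "t + 1 \<le> r + real K" using real_arch_simple[of "t + 1 - r"] by (auto simp: algebra_simps)
    obtain l where l: "\<And>n n' t t'. t \<le> r + real K \<Longrightarrow> t' \<le> r + real K \<Longrightarrow> \<bar>?a n t - ?a n' t'\<bar> < 1 / 2 ^ l \<Longrightarrow> norm (?v n t - ?v n' t') \<le> 1 / 2 ^ m"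
      using g[of K m] by blast
    have "dist (decode_path r x t') (decode_path r x t) < e" if t': "t' \<in> {r..}" "dist t' t < min 1 (1 / 2 ^ l)" for t'
    proof -
      have "(\<lambda>n. norm (?v n t' - ?v n t)) \<longlonglongrightarrow> norm (decode_path r x t' - decode_path r x t)"
        by (intro tendsto_intros conv)
      moreover have "\<forall>\<^sub>F n in sequentially. norm (?v n t' - ?v n t) \<le> 1 / 2 ^ m"
      proof -
        have "(\<lambda>n. \<bar>?a n t' - ?a n t\<bar>) \<longlonglongrightarrow> \<bar>max 0 (t' - r) - max 0 (t - r)\<bar>"
          by (intro tendsto_intros dyadic_index_tendsto)
        moreover have "\<bar>max 0 (t' - r) - max 0 (t - r)\<bar> < 1 / 2 ^ l" using t t' by (auto simp: dist_real_def max_def)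
        ultimately have "\<forall>\<^sub>F n in sequentially. \<bar>?a n t' - ?a n t\<bar> < 1 / 2 ^ l" by (rule order_tendstoD)
        then show ?thesis
        proof (rule eventually_mono)
          fix n assume "\<bar>?a n t' - ?a n t\<bar> < 1 / 2 ^ l"
          moreover have "dist t' t < 1" using t'(2) by (rule less_le_trans) simp
          ultimately show "norm (?v n t' - ?v n t) \<le> 1 / 2 ^ m" using K by (intro l) (auto simp: dist_real_def)
        qed
      qed
      ultimately have "norm (decode_path r x t' - decode_path r x t) \<le> 1 / 2 ^ m"
        by (intro tendsto_upperbound[of "\<lambda>n. norm (?v n t' - ?v n t)"]) auto
      then show ?thesis using m by (simp add: dist_norm power_divide)
    qed
    then show "\<exists>d>0. \<forall>t'\<in>{r..}. dist t' t < d \<longrightarrow> dist (decode_path r x t') (decode_path r x t) < e"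
      by (intro exI[of _ "min 1 (1 / 2 ^ l)"]) auto
  qed
  moreover have "decode_path r x t = decode_path r x r" if "t < r" for t
    using that by (simp add: decode_path_def dyadic_index_def max_def)
  ultimately show ?thesis by (simp add: Omega_def)
qed (simp add: decode_path_def[abs_def] Omega_def)

lemma measurable_dyadic_val [measurable]: "(\<lambda>x. dyadic_val x j n) \<in> borel_measurable borel"
  unfolding dyadic_val_def coord_of_def by measurable

lemma measurable_decode_path: "(\<lambda>x. decode_path r x t) \<in> borel_measurable borel"
proof -
  have [measurable]: "Measurable.pred borel good_code" unfolding good_code_def by measurable
  have [measurable]: "(\<lambda>x. lim (\<lambda>n. dyadic_val x (dyadic_index n (t - r)) n)) \<in> borel_measurable borel"
    by (rule borel_measurable_lim_metric) measurable
  show ?thesis unfolding decode_path_def by measurable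
qed

text \<open>A path can be recovered from the real number \<open>?U w\<close>. The conditional
  distribution of that number given \<open>w r\<close>, pushed forward by decoding, is the
  kernel.\<close>

lemma rcp_kernel_exists:
  assumes Q: "prob_space Q" "sets Q = sets (Omega_space r)"
  shows "\<exists>p. rcp_kernel Q r p"
proof -
  interpret prob_space Q by fact
  have spQ: "space Q = Omega r" using sets_eq_imp_space_eq[OF Q(2)] by simp
  have coord: "(\<lambda>w. w t) \<in> borel_measurable Q" if "r \<le> t" for t
    using measurable_Omega_coord[OF that] Q(2) by (simp cong: measurable_cong_sets)
  note Y[measurable] = coord[OF order_refl]
  let ?U = "\<lambda>w. ternary_sum (path_bit r w)"
  have U[measurable]: "?U \<in> borel_measurable Q"
  proof (rule measurable_ternary_sum)
    fix k
    obtain b j n c where k: "(from_nat k :: bool \<times> nat \<times> nat \<times> rat) = (b, j, n, c)" by (metis prod_cases4)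
    have [measurable]: "(\<lambda>w. w (r + real j / 2 ^ n)) \<in> borel_measurable Q" by (rule coord) simp
    have "(\<lambda>w. w (r + real j / 2 ^ n) $ (if b then 1 else 2)) \<in> borel_measurable Q"
      by (rule measurable_compose[OF \<open>(\<lambda>w. w (r + real j / 2 ^ n)) \<in> borel_measurable Q\<close>]) (auto intro!: borel_measurable_continuous_onI continuous_intros)
    then show "Measurable.pred Q (\<lambda>w. path_bit r w k)"
      unfolding path_bit_def k by simp
  qed
  have U01: "0 \<le> ?U w \<and> ?U w \<le> 1" for w using ternary_sum_bounds[of "path_bit r w"] by simp
  obtain q where q[measurable]: "q \<in> measurable borel (prob_algebra borel)"
    and qe: "\<And>S. S \<in> sets (borel \<Otimes>\<^sub>M borel) \<Longrightarrow> emeasure Q {w\<in>space Q. (w r, ?U w) \<in> S} =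
       (\<integral>\<^sup>+y. emeasure (q y) {x. (y, x) \<in> S} \<partial>distr Q borel (\<lambda>w. w r))"
    by (rule regular_conditional_real[OF Q(1) Y U U01]) blast
  have qs: "sets (q y) = sets borel" "prob_space (q y)" for y
    using measurable_space[OF q, of y] by (auto simp: space_prob_algebra)
  have qsp: "space (q y) = UNIV" for y using sets_eq_imp_space_eq[OF qs(1)[of y]] by simp
  \<comment> \<open>translating the decoded path makes it start at \<open>y\<close> for every \<open>y\<close>, not only almost every one\<close>
  define h where "h y x t = decode_path r x t - decode_path r x r + y" for y x t
  have hO: "h y x \<in> Omega r" for y x
    using decode_path_in_Omega[of r x] unfolding Omega_def h_def[abs_def] by (auto intro!: continuous_intros)
  have hr: "h y x r = y" for y x by (simp add: h_def)
  have hm: "case_prod h \<in> measurable (borel \<Otimes>\<^sub>M borel) (Omega_space r)"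
  proof (rule measurable_into_Omega)
    show "(\<lambda>p. case_prod h p t) \<in> borel_measurable (borel \<Otimes>\<^sub>M borel)" for t
    proof -
      note [measurable] = measurable_decode_path
      show ?thesis unfolding h_def split_beta' by measurable
    qed
  qed (auto simp: hO)
  have hm1[measurable]: "h y \<in> measurable borel (Omega_space r)" for y
    using measurable_compose[OF measurable_Pair1'[of y borel borel] hm] by simp
  have hm2: "h y \<in> measurable (q y) (Omega_space r)" for y
    using hm1[of y] qs(1)[of y] by (simp cong: measurable_cong_sets)
  define p where "p y = distr (q y) (Omega_space r) (h y)" for y
  have pm: "p \<in> measurable borel (prob_algebra (Omega_space r))"
    unfolding p_def[abs_def] using hm by (intro measurable_distr_prob_space2[OF q]) simp
  have coordset: "{w \<in> Omega r. w r \<in> A} \<in> sets (Omega_space r)" if "A \<in> sets borel" for A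
    using measurable_sets[OF measurable_Omega_coord[OF order_refl] that, of r] by (simp add: vimage_def Int_def conj_commute)
  have "rcp_kernel Q r p"
    unfolding rcp_kernel_def
  proof (intro conjI allI ballI)
    fix y
    show "prob_space (p y)" unfolding p_def by (rule prob_space.prob_space_distr[OF qs(2) hm2])
    show "sets (p y) = sets (Omega_space r)" by (simp add: p_def)
    have "emeasure (p y) {w \<in> Omega r. w r = y} = emeasure (q y) (h y -` {w \<in> Omega r. w r = y} \<inter> space (q y))"
      unfolding p_def using coordset[of "{y}"] by (intro emeasure_distr[OF hm2]) simp
    also have "h y -` {w \<in> Omega r. w r = y} \<inter> space (q y) = space (q y)" using hO hr by auto
    also have "emeasure (q y) (space (q y)) = 1" by (rule prob_space.emeasure_space_1[OF qs(2)])
    finally show "emeasure (p y) {w \<in> Omega r. w r = y} = 1" .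
  next
    fix B assume B: "B \<in> sets (Omega_space r)"
    show "(\<lambda>y. emeasure (p y) B) \<in> borel_measurable borel"
      using measurable_emeasure_subprob_algebra[OF B] measurable_prob_algebraD[OF pm] by (rule measurable_compose[rotated])
    fix A :: "(real^2) set" assume A[measurable]: "A \<in> sets borel"
    let ?S = "{z\<in>space (borel \<Otimes>\<^sub>M borel). fst z \<in> A \<and> case_prod h z \<in> B}"
    have S: "?S \<in> sets (borel \<Otimes>\<^sub>M borel)"
    proof -
      have "?S = (fst -` A \<inter> space (borel \<Otimes>\<^sub>M borel)) \<inter> (case_prod h -` B \<inter> space (borel \<Otimes>\<^sub>M borel))" by auto
      also have "\<dots> \<in> sets (borel \<Otimes>\<^sub>M borel)"
        by (intro sets.Int measurable_sets[OF hm B] measurable_sets[OF measurable_fst A])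
      finally show ?thesis .
    qed
    \<comment> \<open>On codes of actual paths the decoded start is already \<open>w r\<close>, so
      the translation is the identity and the law is unchanged.\<close>
    have "h (w r) (?U w) = w" if "w \<in> Omega r" for w
      unfolding h_def[abs_def] decode_encode[OF that] by simp
    then have "B \<inter> {w \<in> Omega r. w r \<in> A} = {w\<in>space Q. (w r, ?U w) \<in> ?S}"
      using sets.sets_into_space[OF B] by (auto simp: spQ space_pair_measure)
    then have "emeasure Q (B \<inter> {w \<in> Omega r. w r \<in> A}) = (\<integral>\<^sup>+y. emeasure (q y) {x. (y, x) \<in> ?S} \<partial>distr Q borel (\<lambda>w. w r))"
      using qe[OF S] by simp
    also have "\<dots> = (\<integral>\<^sup>+y. indicator A y * emeasure (p y) B \<partial>distr Q borel (\<lambda>w. w r))"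
    proof (rule nn_integral_cong)
      fix y
      have "emeasure (p y) B = emeasure (q y) (h y -` B \<inter> space (q y))"
        unfolding p_def by (rule emeasure_distr[OF hm2 B])
      then show "emeasure (q y) {x. (y, x) \<in> ?S} = indicator A y * emeasure (p y) B"
        by (auto simp: indicator_def qsp space_pair_measure vimage_def)
    qed
    finally show "emeasure Q (B \<inter> {w \<in> Omega r. w r \<in> A}) = (\<integral>\<^sup>+y. indicator A y * emeasure (p y) B \<partial>distr Q borel (\<lambda>w. w r))" .
  qed
  then show ?thesis by (rule exI[of _ p])
qed

section \<open>Flow property\<close>

lemma mild_solution_cong:
  assumes m: "mild_solution \<nu> b n r" and b: "\<And>t. r \<le> t \<Longrightarrow> b t = b' t" and n: "\<And>t. r \<le> t \<Longrightarrow> n t = n' t"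
  shows "mild_solution \<nu> b' n' r"
  unfolding mild_solution_def
proof (intro allI impI, elim conjE)
  fix t0 T \<phi> D assume a: "r \<le> t0" "t0 < T" "C1_test \<phi> D"
  have e: "n' t0 = n t0" "n' T = n T" using a n by auto
  have e': "n' \<tau> = n \<tau>" "b' \<tau> = b \<tau>" if "t0 < \<tau> \<and> \<tau> < T" for \<tau> using a that n[of \<tau>] b[of \<tau>] by auto
  show "\<exists>g. set_integrable lborel {t0..T} g \<and>
       (\<forall>\<tau>. t0 < \<tau> \<and> \<tau> < T \<longrightarrow> g \<tau> = (\<integral>x. heat_gradient \<nu> D (T - \<tau>) x \<bullet> b' \<tau> x \<partial>n' \<tau>)) \<and>
       (\<integral>x. \<phi> x \<partial>n' T) = (\<integral>x. (\<integral>z. \<phi> (x + sqrt (2 * \<nu>) *\<^sub>R z) \<partial>gauss2 (T - t0)) \<partial>n' t0)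
          + (LINT \<tau>:{t0..T}|lborel. g \<tau>)"
    using mild_solutionD[OF m a] by (simp add: e e' cong: conj_cong imp_cong)
qed

text \<open>Under a bounded drift the admissible step of \<open>mild_contraction\<close> depends on
  C and \<nu> only, so finitely many equal steps reach any time.\<close>

lemma mild_unique_bounded:
  fixes n1 n2 :: "real \<Rightarrow> (real^2) measure"
  assumes nu: "0 < \<nu>" and G: "\<And>v. 0 < v \<Longrightarrow> prob_space (gauss2 v)"
    and m1: "mild_solution \<nu> b1 n1 r" and m2: "mild_solution \<nu> b2 n2 r"
    and t1: "r \<le> t1" and f1: "\<And>t. r \<le> t \<Longrightarrow> finite_measure (n1 t)" "\<And>t. r \<le> t \<Longrightarrow> sets (n1 t) = sets borel" "\<And>t. r \<le> t \<Longrightarrow> measure (n1 t) UNIV \<le> 1"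
    and f2: "\<And>t. r \<le> t \<Longrightarrow> finite_measure (n2 t)" "\<And>t. r \<le> t \<Longrightarrow> sets (n2 t) = sets borel" "\<And>t. r \<le> t \<Longrightarrow> measure (n2 t) UNIV \<le> 1"
    and init: "n1 t1 = n2 t1"
    and drift: "\<And>\<tau> N V. t1 < \<tau> \<Longrightarrow> 0 \<le> N \<Longrightarrow>
       (\<And>A. A \<in> sets borel \<Longrightarrow> \<bar>measure (n1 \<tau>) A - measure (n2 \<tau>) A\<bar> \<le> N) \<Longrightarrow>
       V \<in> borel_measurable borel \<Longrightarrow> (\<And>x. norm (V x) \<le> 1) \<Longrightarrow>
       \<bar>(\<integral>x. V x \<bullet> b1 \<tau> x \<partial>n1 \<tau>) - (\<integral>x. V x \<bullet> b2 \<tau> x \<partial>n2 \<tau>)\<bar> \<le> C * N"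
    and C: "0 \<le> C" and t: "t1 \<le> t"
  shows "n1 t = n2 t"
proof -
  \<comment> \<open>Chosen so that 2 C sqrt d <= sqrt (2 \<nu>) / 2; the added 1 covers C =
    0.\<close>
  define d where "d = (sqrt (2 * \<nu>) / (4 * (C + 1)))\<^sup>2"
  have d: "0 < d" using nu C by (simp add: d_def)
  have sd: "sqrt d = sqrt (2 * \<nu>) / (4 * (C + 1))" using nu C by (simp add: d_def)
  have small: "(2 * C * sqrt d + 4 * sqrt 2 * 0) / sqrt (2 * \<nu>) \<le> 1 / 2"
    unfolding sd using nu C by (simp add: divide_simps)
  have step: "n1 t = n2 t" if "t1 \<le> t0" "n1 t0 = n2 t0" "t0 \<le> t" "t \<le> t0 + d" for t0 t
  proof (rule mild_contraction[OF nu G m1 m2 _ f1 f2 that(2) _ C order_refl small that(3,4)])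
    show "r \<le> t0" using t1 that by simp
    show "\<bar>(\<integral>x. V x \<bullet> b1 \<tau> x \<partial>n1 \<tau>) - (\<integral>x. V x \<bullet> b2 \<tau> x \<partial>n2 \<tau>)\<bar> \<le> (C + 0 / sqrt (\<tau> - t0)) * N"
      if "t0 < \<tau>" "\<tau> \<le> t0 + d" "0 \<le> N" "\<And>A. A \<in> sets borel \<Longrightarrow> \<bar>measure (n1 \<tau>) A - measure (n2 \<tau>) A\<bar> \<le> N"
        "V \<in> borel_measurable borel" "\<And>x. norm (V x) \<le> 1" for \<tau> N and V :: "real^2 \<Rightarrow> real^2"
      using drift[of \<tau> N V] that \<open>t1 \<le> t0\<close> by simp
  qed auto
  have "\<forall>t. t1 \<le> t \<and> t \<le> t1 + real k * d \<longrightarrow> n1 t = n2 t" for k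
  proof (induction k)
    case 0 then show ?case using init by (auto simp: antisym)
  next
    case (Suc k)
    show ?case
    proof (intro allI impI)
      fix t assume t: "t1 \<le> t \<and> t \<le> t1 + real (Suc k) * d"
      show "n1 t = n2 t"
      proof (cases "t \<le> t1 + real k * d")
        case True then show ?thesis using Suc t by blast
      next
        case False
        have "n1 (t1 + real k * d) = n2 (t1 + real k * d)" using Suc d by simp
        then show ?thesis using step[of "t1 + real k * d" t] False t d by (simp add: algebra_simps)
      qed
    qed
  qed
  moreover obtain k :: nat where "(t - t1) / d \<le> real k" using real_arch_simple by blast
  then have "t \<le> t1 + real k * d" using d by (simp add: field_simps)
  ultimately show ?thesis using t by blast
qed

section \<open>Density bounds of vorticity solutions and uniqueness of the restarted curve\<close>

lemma vorticity_density:
  assumes "vorticity_solution \<nu> s \<zeta> \<mu>"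
  shows "\<exists>u C. 0 < C \<and> (\<forall>t>s. \<mu> t = density lborel (\<lambda>x. ennreal (u t x)) \<and> u t \<in> borel_measurable borel \<and>
     (AE x in lborel. u t x \<le> C / (t - s)))"
proof -
  obtain u where u1: "\<forall>t>s. u t \<in> borel_measurable borel \<and> (\<forall>x. 0 \<le> u t x) \<and> \<mu> t = density lborel (\<lambda>x. ennreal (u t x))"
    and "\<exists>C. \<forall>t>s. AE x in lborel. \<bar>u t x\<bar> \<le> C * (t - s) powr (-1)"
    using assms unfolding vorticity_solution_def by (elim conjE exE) blast
  then obtain C where C: "\<forall>t>s. AE x in lborel. \<bar>u t x\<bar> \<le> C * (t - s) powr (-1)" by blast
  have "AE x in lborel. u t x \<le> max C 1 / (t - s)" if "s < t" for t
  proof -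
    have "AE x in lborel. \<bar>u t x\<bar> \<le> C * (t - s) powr (-1)" using C that by blast
    then show ?thesis
    proof (rule eventually_mono)
      fix x assume "\<bar>u t x\<bar> \<le> C * (t - s) powr (-1)"
      also have "\<dots> = C / (t - s)" using that by (simp add: powr_minus_divide)
      also have "\<dots> \<le> max C 1 / (t - s)" using that by (intro divide_right_mono) auto
      finally show "u t x \<le> max C 1 / (t - s)" by simp
    qed
  qed
  then show ?thesis using u1 by (intro exI[of _ u] exI[of _ "max C 1"]) auto
qed

lemma vorticity_prob:
  assumes "vorticity_solution \<nu> s \<zeta> \<mu>" "s \<le> t" shows "\<mu> t \<in> Prob2"
  using assms unfolding vorticity_solution_def by (elim conjE) blast

lemma vorticity_init:
  assumes "vorticity_solution \<nu> s \<zeta> \<mu>" shows "\<mu> s = \<zeta>"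
  using assms unfolding vorticity_solution_def by (elim conjE)

text \<open>The density bound C / (t - s) and total mass 1 give a potential of order sqrt (C / (t -
  s)) through \<open>bs_potential_le_sqrt\<close>; this fixes \<open>\<beta>\<close> as 3 sqrt
  C.\<close>

lemma sde_of_vorticity:
  assumes nu: "0 < \<nu>" and v: "vorticity_solution \<nu> s \<zeta> \<mu>" and w: "weak_solution \<nu> s \<mu> M Fl W X"
    and l: "\<And>t. s \<le> t \<Longrightarrow> distr M borel (X t) = \<mu> t"
  shows "\<exists>\<beta>. sde \<nu> s \<mu> M Fl W X \<beta>"
proof -
  obtain u C where C: "0 < C" and u: "\<forall>t>s. \<mu> t = density lborel (\<lambda>x. ennreal (u t x)) \<and> u t \<in> borel_measurable borel \<and>
     (AE x in lborel. u t x \<le> C / (t - s))" using vorticity_density[OF v] by blast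
  have "bs_potential (\<mu> t) x \<le> ennreal (3 * sqrt C / sqrt (t - s))" if t: "s < t" for t x
  proof -
    have "bs_potential (\<mu> t) x \<le> ennreal (3 * sqrt (C / (t - s)))"
    proof (rule bs_potential_le_sqrt)
      show "prob_space (\<mu> t)" using vorticity_prob[OF v, of t] t by (simp add: Prob2_def)
    qed (use u t C in auto)
    then show ?thesis by (simp add: real_sqrt_divide)
  qed
  then have "sde \<nu> s \<mu> M Fl W X (3 * sqrt C)" using nu w l C by (intro sde.intro) auto
  then show ?thesis by blast
qed

lemma (in sde) mild_law: "s \<le> r \<Longrightarrow> mild_solution \<nu> (\<lambda>t. bs_K (\<mu> t)) \<mu> r"
  using mild_weighted[of r "\<lambda>_. 1"] by (rule mild_solution_cong) (auto simp: density_1 lawX)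

text \<open>Up to r + d the old curve has bounded drift because r > s, while the restarted one has
  \<eta> / sqrt (\<tau> - r) with small \<eta>. After r + d both drifts are bounded, and steps of
  uniform length finish the argument.\<close>

lemma vorticity_flow:
  assumes v1: "vorticity_solution \<nu> s \<zeta> \<mu>1" and S1: "sde \<nu> s \<mu>1 M1 Fl1 W1 X1 \<beta>1"
    and v2: "vorticity_solution \<nu> r \<zeta>2 \<mu>2" and S2: "sde \<nu> r \<mu>2 M2 Fl2 W2 X2 \<beta>2"
    and r: "s < r" and init: "\<mu>2 r = \<mu>1 r" and t: "r \<le> t"
  shows "\<mu>1 t = \<mu>2 t"
proof -
  interpret S1: sde \<nu> s \<mu>1 M1 Fl1 W1 X1 \<beta>1 by fact
  interpret S2: sde \<nu> r \<mu>2 M2 Fl2 W2 X2 \<beta>2 by fact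
  note nu = S1.nu
  define A1 where "A1 = \<beta>1 / sqrt (r - s)"
  have A1: "0 \<le> A1" using S1.\<beta>(1) r by (simp add: A1_def)
  have a1: "bs_potential (\<mu>1 \<tau>) x \<le> ennreal A1" if "r \<le> \<tau>" for \<tau> x
  proof -
    have "bs_potential (\<mu>1 \<tau>) x \<le> ennreal (\<beta>1 / sqrt (\<tau> - s))" using that r by (intro S1.\<beta>(2)) simp
    also have "\<dots> \<le> ennreal A1" unfolding A1_def using that r S1.\<beta>(1) by (intro ennreal_leI divide_left_mono) auto
    finally show ?thesis .
  qed
  obtain u1 C1 where C1: "0 < C1" and u1: "\<forall>t>s. \<mu>1 t = density lborel (\<lambda>x. ennreal (u1 t x)) \<and> u1 t \<in> borel_measurable borel \<and>
     (AE x in lborel. u1 t x \<le> C1 / (t - s))" using vorticity_density[OF v1] by blast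
  obtain u2 C2 where C2: "0 < C2" and u2: "\<forall>t>r. \<mu>2 t = density lborel (\<lambda>x. ennreal (u2 t x)) \<and> u2 t \<in> borel_measurable borel \<and>
     (AE x in lborel. u2 t x \<le> C2 / (t - r))" using vorticity_density[OF v2] by blast
  \<comment> \<open>The restarted curve inherits the density bound of the old one through its
    initial value; this is where r > s enters the ball estimate.\<close>
  have cb: "measure (\<mu>2 r) (cball y q) \<le> C1 / (r - s) * (pi * q\<^sup>2)" if "0 \<le> q" for y q
    unfolding init using u1 r C1 that measure_density_cball_le[of "u1 r" "C1 / (r - s)" q y] by simp
  \<comment> \<open>The contraction meets 3 \<eta>, the 3 stemming from
    \<open>nonlinear_drift_diff\<close>. Then 4 sqrt 2 times 3 \<eta> is sqrt (2 \<nu>) / 4, half of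
    what is admissible; the choice of \<open>d\<close> leaves the other half to the bounded
    part.\<close>
  define \<eta> where "\<eta> = sqrt (2 * \<nu>) / (48 * sqrt 2)"
  have \<eta>: "0 < \<eta>" using nu by (simp add: \<eta>_def)
  obtain d0 where d0: "0 < d0" "\<And>t x. r < t \<Longrightarrow> t \<le> r + d0 \<Longrightarrow> bs_potential (\<mu>2 t) x \<le> ennreal (\<eta> / sqrt (t - r))"
    using S2.bs_potential_small[of u2 C2 "C1 / (r - s)" \<eta>] u2 C2 C1 r cb \<eta> by auto
  define d where "d = min d0 ((sqrt (2 * \<nu>) / (24 * (A1 + 1)))\<^sup>2)"
  have d: "0 < d" "d \<le> d0" using nu A1 d0 by (auto simp: d_def)
  have sd: "sqrt d \<le> sqrt (2 * \<nu>) / (24 * (A1 + 1))"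
    using nu A1 by (intro real_le_lsqrt) (auto simp: d_def)
  have small: "(2 * (3 * A1) * sqrt d + 4 * sqrt 2 * (3 * \<eta>)) / sqrt (2 * \<nu>) \<le> 1 / 2"
  proof -
    have "2 * (3 * A1) * sqrt d \<le> 2 * (3 * A1) * (sqrt (2 * \<nu>) / (24 * (A1 + 1)))"
      using A1 by (intro mult_left_mono sd) auto
    also have "\<dots> \<le> sqrt (2 * \<nu>) / 4" using A1 nu by (simp add: divide_simps)
    finally have "2 * (3 * A1) * sqrt d + 4 * sqrt 2 * (3 * \<eta>) \<le> sqrt (2 * \<nu>) / 4 + sqrt (2 * \<nu>) / 4"
      by (intro add_mono) (auto simp: \<eta>_def)
    then show ?thesis using nu by (simp add: divide_le_eq)
  qed
  have P1: "prob_space (\<mu>1 t)" "sets (\<mu>1 t) = sets borel" if "r \<le> t" for t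
    using that r S1.prob_mu[of t] S1.sets_mu[of t] by simp_all
  have P2: "prob_space (\<mu>2 t)" "sets (\<mu>2 t) = sets borel" if "r \<le> t" for t
    using that S2.prob_mu[of t] S2.sets_mu[of t] by simp_all
  have f1: "finite_measure (\<mu>1 t)" "measure (\<mu>1 t) UNIV \<le> 1" and f2: "finite_measure (\<mu>2 t)" "measure (\<mu>2 t) UNIV \<le> 1" if "r \<le> t" for t
    using P1[OF that] P2[OF that] by (auto intro: prob_space.finite_measure prob_space.prob_le_1)
  have m1: "mild_solution \<nu> (\<lambda>t. bs_K (\<mu>1 t)) \<mu>1 r" using r by (intro S1.mild_law) simp
  have m2: "mild_solution \<nu> (\<lambda>t. bs_K (\<mu>2 t)) \<mu>2 r" by (intro S2.mild_law) simp
  have first: "\<mu>1 t = \<mu>2 t" if "r \<le> t" "t \<le> r + d" for t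
  proof (rule mild_contraction[OF nu S1.prob_gauss2 m1 m2 order_refl f1(1) P1(2) f1(2) f2(1) P2(2) f2(2) init[symmetric] _ _ _ small that])
    fix \<tau> N and V :: "real^2 \<Rightarrow> real^2"
    assume h: "r < \<tau>" "\<tau> \<le> r + d" "\<And>A. A \<in> sets borel \<Longrightarrow> \<bar>measure (\<mu>1 \<tau>) A - measure (\<mu>2 \<tau>) A\<bar> \<le> N"
        "V \<in> borel_measurable borel" "\<And>x. norm (V x) \<le> 1"
    have "\<bar>(\<integral>x. V x \<bullet> bs_K (\<mu>1 \<tau>) x \<partial>\<mu>1 \<tau>) - (\<integral>x. V x \<bullet> bs_K (\<mu>2 \<tau>) x \<partial>\<mu>2 \<tau>)\<bar> \<le> 3 * (A1 + \<eta> / sqrt (\<tau> - r)) * N"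
      using h d \<eta> A1 P1[of \<tau>] P2[of \<tau>] by (intro nonlinear_drift_diff a1 d0) auto
    then show "\<bar>(\<integral>x. V x \<bullet> bs_K (\<mu>1 \<tau>) x \<partial>\<mu>1 \<tau>) - (\<integral>x. V x \<bullet> bs_K (\<mu>2 \<tau>) x \<partial>\<mu>2 \<tau>)\<bar> \<le> (3 * A1 + 3 * \<eta> / sqrt (\<tau> - r)) * N"
      by (simp add: distrib_left)
  qed (use A1 \<eta> in auto)
  define A2 where "A2 = \<beta>2 / sqrt d"
  have A2: "0 \<le> A2" using S2.\<beta>(1) d by (simp add: A2_def)
  have a2: "bs_potential (\<mu>2 \<tau>) x \<le> ennreal A2" if "r + d \<le> \<tau>" for \<tau> x
  proof -
    have "bs_potential (\<mu>2 \<tau>) x \<le> ennreal (\<beta>2 / sqrt (\<tau> - r))" using that d by (intro S2.\<beta>(2)) simp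
    also have "\<dots> \<le> ennreal A2" unfolding A2_def using that d S2.\<beta>(1) by (intro ennreal_leI divide_left_mono) auto
    finally show ?thesis .
  qed
  show ?thesis
  proof (cases "t \<le> r + d")
    case True then show ?thesis using first t by blast
  next
    case False
    show ?thesis
    proof (rule mild_unique_bounded[OF nu S1.prob_gauss2 m1 m2 _ f1(1) P1(2) f1(2) f2(1) P2(2) f2(2) first[of "r + d"], where C="3 * (A1 + A2)"])
      fix \<tau> N and V :: "real^2 \<Rightarrow> real^2"
      assume h: "r + d < \<tau>" "\<And>A. A \<in> sets borel \<Longrightarrow> \<bar>measure (\<mu>1 \<tau>) A - measure (\<mu>2 \<tau>) A\<bar> \<le> N"
        "V \<in> borel_measurable borel" "\<And>x. norm (V x) \<le> 1"
      show "\<bar>(\<integral>x. V x \<bullet> bs_K (\<mu>1 \<tau>) x \<partial>\<mu>1 \<tau>) - (\<integral>x. V x \<bullet> bs_K (\<mu>2 \<tau>) x \<partial>\<mu>2 \<tau>)\<bar> \<le> 3 * (A1 + A2) * N"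
        using h d A1 A2 P1[of \<tau>] P2[of \<tau>] by (intro nonlinear_drift_diff a1 a2) auto
    qed (use False d A1 A2 in auto)
  qed
qed

section \<open>The Markov property\<close>

text \<open>Domination keeps the derivative below 1 almost everywhere; truncation makes this true
  everywhere, as a weight for \<open>mild_weighted\<close> requires.\<close>

lemma bounded_Radon_Nikodym:
  assumes m: "finite_measure m" and s: "sets n = sets m" and le: "\<And>A. A \<in> sets m \<Longrightarrow> emeasure n A \<le> emeasure m A"
  shows "\<exists>f. f \<in> borel_measurable m \<and> (\<forall>x. 0 \<le> f x) \<and> (\<forall>x. f x \<le> (1::real)) \<and> n = density m (\<lambda>x. ennreal (f x))"
proof -
  interpret finite_measure m by fact
  let ?R = "RN_deriv m n"
  have d: "density m ?R = n"
  proof (rule density_RN_deriv[OF _ s])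
    show "absolutely_continuous m n" unfolding absolutely_continuous_def null_sets_def using le s by fastforce
  qed
  have R1: "AE x in m. ?R x \<le> 1"
  proof (rule AE_le_if_nn_integral_le)
    fix A assume A: "A \<in> sets m"
    have "(\<integral>\<^sup>+x. ?R x * indicator A x \<partial>m) = emeasure n A"
      by (subst (2) d[symmetric], subst emeasure_density) (auto simp: A)
    then show "(\<integral>\<^sup>+x. ?R x * indicator A x \<partial>m) \<le> (\<integral>\<^sup>+x. 1 * indicator A x \<partial>m)" using le[OF A] A by simp
  qed (auto simp: emeasure_eq_measure)
  let ?f = "\<lambda>x. min 1 (enn2real (?R x))"
  have "density m ?R = density m (\<lambda>x. ennreal (?f x))"
  proof (rule density_cong)
    show "AE x in m. ?R x = ennreal (?f x)"
      using R1
    proof (rule eventually_mono)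
      fix x assume r: "?R x \<le> 1"
      then have fin: "?R x < top" by (rule le_less_trans) simp
      then have "enn2real (?R x) \<le> 1" using r by (metis enn2real_1 enn2real_mono ennreal_one_less_top)
      then show "?R x = ennreal (?f x)" using fin by (simp add: min_absorb2 ennreal_enn2real)
    qed
  qed auto
  then show ?thesis using d by (intro exI[of _ ?f]) auto
qed

lemma linear_drift_diff:
  fixes V :: "real^2 \<Rightarrow> real^2"
  assumes f: "finite_measure n1" "finite_measure n2" and s: "sets n1 = sets borel" "sets n2 = sets borel"
    and N: "\<And>A. A \<in> sets borel \<Longrightarrow> \<bar>measure n1 A - measure n2 A\<bar> \<le> N"
    and [measurable]: "V \<in> borel_measurable borel" and V: "\<And>x. norm (V x) \<le> 1"
    and [measurable]: "b \<in> borel_measurable borel" and b: "\<And>x. norm (b x) \<le> c"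
  shows "\<bar>(\<integral>x. V x \<bullet> b x \<partial>n1) - (\<integral>x. V x \<bullet> b x \<partial>n2)\<bar> \<le> 3 * c * N"
proof (rule integral_diff_le[OF f s N])
  show "\<bar>V x \<bullet> b x\<bar> \<le> c" for x
    using Cauchy_Schwarz_ineq2[of "V x" "b x"] mult_right_mono[OF V[of x], of "norm (b x)"] b[of x] by simp
qed auto

lemma finite_weighted_law:
  assumes "prob_space M" and [measurable]: "\<rho> \<in> borel_measurable M" "X \<in> borel_measurable M"
    and \<rho>01: "\<And>\<omega>. 0 \<le> \<rho> \<omega>" "\<And>\<omega>. \<rho> \<omega> \<le> (1::real)"
  defines "n \<equiv> distr (density M (\<lambda>\<omega>. ennreal (\<rho> \<omega>))) borel (X :: _ \<Rightarrow> real^2)"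
  shows "finite_measure n" "sets n = sets borel" "measure n UNIV \<le> 1"
    "\<And>A. A \<in> sets borel \<Longrightarrow> emeasure n A = (\<integral>\<^sup>+\<omega>. ennreal (\<rho> \<omega>) * indicator A (X \<omega>) \<partial>M)"
    "\<And>A. A \<in> sets borel \<Longrightarrow> emeasure n A \<le> emeasure (distr M borel X) A"
proof -
  interpret prob_space M by fact
  show e: "emeasure n A = (\<integral>\<^sup>+\<omega>. ennreal (\<rho> \<omega>) * indicator A (X \<omega>) \<partial>M)" if [measurable]: "A \<in> sets borel" for A
  proof -
    have "emeasure n A = emeasure (density M (\<lambda>\<omega>. ennreal (\<rho> \<omega>))) (X -` A \<inter> space M)"
      unfolding n_def by (subst emeasure_distr) auto
    also have "\<dots> = (\<integral>\<^sup>+\<omega>. ennreal (\<rho> \<omega>) * indicator (X -` A \<inter> space M) \<omega> \<partial>M)"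
      by (rule emeasure_density) auto
    also have "\<dots> = (\<integral>\<^sup>+\<omega>. ennreal (\<rho> \<omega>) * indicator A (X \<omega>) \<partial>M)"
      by (rule nn_integral_cong) (auto simp: indicator_def)
    finally show ?thesis .
  qed
  show le: "emeasure n A \<le> emeasure (distr M borel X) A" if [measurable]: "A \<in> sets borel" for A
  proof -
    have "emeasure n A \<le> (\<integral>\<^sup>+\<omega>. indicator (X -` A \<inter> space M) \<omega> \<partial>M)"
      unfolding e[OF that] using \<rho>01 by (intro nn_integral_mono) (auto simp: indicator_def)
    also have "\<dots> = emeasure (distr M borel X) A" by (subst emeasure_distr) auto
    finally show ?thesis .
  qed
  show s: "sets n = sets borel" by (simp add: n_def)
  have "emeasure n UNIV \<le> 1"
    using le[of UNIV] prob_space.emeasure_le_1[OF prob_space_distr[of X borel], of UNIV] by (auto intro: order_trans)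
  then show "finite_measure n" "measure n UNIV \<le> 1"
    using sets_eq_imp_space_eq[OF s]
    by (auto intro!: finite_measureI simp: measure_def top_unique enn2real_leI)
qed

text \<open>Both weighted laws solve the same linear Fokker--Planck equation, whose drift is bounded from time \<open>r\<close> on.\<close>

lemma weighted_laws_agree:
  assumes S1: "sde \<nu> s \<mu>1 M1 Fl1 W1 X1 \<beta>1" and S2: "sde \<nu> r \<mu>2 M2 Fl2 W2 X2 \<beta>2" and r: "s < r"
    and flow: "\<And>t. r \<le> t \<Longrightarrow> \<mu>1 t = \<mu>2 t"
    and \<rho>1: "\<rho>1 \<in> borel_measurable (Fl1 r)" "\<And>\<omega>. 0 \<le> \<rho>1 \<omega>" "\<And>\<omega>. \<rho>1 \<omega> \<le> (1::real)"
    and \<rho>2: "\<rho>2 \<in> borel_measurable (Fl2 r)" "\<And>\<omega>. 0 \<le> \<rho>2 \<omega>" "\<And>\<omega>. \<rho>2 \<omega> \<le> (1::real)"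
    and init: "distr (density M1 (\<lambda>\<omega>. ennreal (\<rho>1 \<omega>))) borel (X1 r) = distr (density M2 (\<lambda>\<omega>. ennreal (\<rho>2 \<omega>))) borel (X2 r)"
    and t: "r \<le> t"
  shows "distr (density M1 (\<lambda>\<omega>. ennreal (\<rho>1 \<omega>))) borel (X1 t) = distr (density M2 (\<lambda>\<omega>. ennreal (\<rho>2 \<omega>))) borel (X2 t)"
proof -
  interpret S1: sde \<nu> s \<mu>1 M1 Fl1 W1 X1 \<beta>1 by fact
  interpret S2: sde \<nu> r \<mu>2 M2 Fl2 W2 X2 \<beta>2 by fact
  let ?n1 = "\<lambda>t. distr (density M1 (\<lambda>\<omega>. ennreal (\<rho>1 \<omega>))) borel (X1 t)"
  let ?n2 = "\<lambda>t. distr (density M2 (\<lambda>\<omega>. ennreal (\<rho>2 \<omega>))) borel (X2 t)"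
  have m1: "mild_solution \<nu> (\<lambda>t. bs_K (\<mu>1 t)) ?n1 r" using r \<rho>1 by (intro S1.mild_weighted) auto
  have "mild_solution \<nu> (\<lambda>t. bs_K (\<mu>2 t)) ?n2 r" using \<rho>2 by (intro S2.mild_weighted) auto
  then have m2: "mild_solution \<nu> (\<lambda>t. bs_K (\<mu>1 t)) ?n2 r" by (rule mild_solution_cong) (auto simp: flow)
  have [measurable]: "\<rho>1 \<in> borel_measurable M1" "\<rho>2 \<in> borel_measurable M2"
    using S1.Fl_measurable[OF _ \<rho>1(1)] S2.Fl_measurable[OF _ \<rho>2(1)] r by auto
  have f1: "finite_measure (?n1 t)" "sets (?n1 t) = sets borel" "measure (?n1 t) UNIV \<le> 1" if "r \<le> t" for t
    using that r \<rho>1 by (intro finite_weighted_law S1.prob S1.X_measurable; simp)+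
  have f2: "finite_measure (?n2 t)" "sets (?n2 t) = sets borel" "measure (?n2 t) UNIV \<le> 1" if "r \<le> t" for t
    using that \<rho>2 by (intro finite_weighted_law S2.prob S2.X_measurable; simp)+
  define A where "A = \<beta>1 / sqrt (r - s)"
  have A: "0 \<le> A" using S1.\<beta>(1) r by (simp add: A_def)
  have bA: "norm (bs_K (\<mu>1 \<tau>) x) \<le> A" if "r \<le> \<tau>" for \<tau> x
  proof -
    have "norm (bs_K (\<mu>1 \<tau>) x) \<le> \<beta>1 / sqrt (\<tau> - s)" using that r by (intro S1.norm_drift_le) simp
    also have "\<dots> \<le> A" unfolding A_def using that r S1.\<beta>(1) by (intro divide_left_mono) auto
    finally show ?thesis .
  qed
  show ?thesis
  proof (rule mild_unique_bounded[OF S1.nu S1.prob_gauss2 m1 m2 order_refl f1 f2 init, where C="3 * A"])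
    fix \<tau> N and V :: "real^2 \<Rightarrow> real^2"
    assume h: "r < \<tau>" "0 \<le> N" "\<And>B. B \<in> sets borel \<Longrightarrow> \<bar>measure (?n1 \<tau>) B - measure (?n2 \<tau>) B\<bar> \<le> N"
        "V \<in> borel_measurable borel" "\<And>x. norm (V x) \<le> 1"
    show "\<bar>(\<integral>x. V x \<bullet> bs_K (\<mu>1 \<tau>) x \<partial>?n1 \<tau>) - (\<integral>x. V x \<bullet> bs_K (\<mu>1 \<tau>) x \<partial>?n2 \<tau>)\<bar> \<le> 3 * A * N"
    proof (rule linear_drift_diff[OF f1(1) f2(1) f1(2) f2(2) h(3,4,5)])
      show "bs_K (\<mu>1 \<tau>) \<in> borel_measurable borel" using h r by (intro S1.measurable_bs_K_at) simp
      show "norm (bs_K (\<mu>1 \<tau>) x) \<le> A" for x using h by (intro bA) simp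
    qed (use h in auto)
  qed (use A t in auto)
qed

section \<open>The filtration on path space and conditional kernels\<close>

lemma space_F_sr [simp]: "space (F_sr s r) = Omega s"
  unfolding F_sr_def by (subst space_measure_of) auto

lemma sets_F_sr: "sets (F_sr s r) = sigma_sets (Omega s)
     {{w \<in> Omega s. w \<tau> \<in> B} | \<tau> B. s \<le> \<tau> \<and> \<tau> \<le> r \<and> B \<in> sets (borel :: (real^2) measure)}"
  unfolding F_sr_def by (subst sets_measure_of) auto

lemma sets_F_sr_subset: "sets (F_sr s r) \<subseteq> sets (Omega_space s)"
  unfolding sets_F_sr sets_Omega_space by (rule sigma_sets_mono') blast

lemma measurable_F_sr_coord:
  assumes "s \<le> t" "t \<le> r" shows "(\<lambda>w. w t) \<in> borel_measurable (F_sr s r)"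
proof (rule measurableI)
  fix B :: "(real^2) set" assume "B \<in> sets borel"
  then show "(\<lambda>w. w t) -` B \<inter> space (F_sr s r) \<in> sets (F_sr s r)"
    unfolding sets_F_sr using assms
    by (intro sigma_sets.Basic) (auto simp: vimage_def Int_def conj_commute intro!: exI[of _ t] exI[of _ B])
qed auto

lemma measurable_into_F_sr:
  assumes "\<And>x. x \<in> space M \<Longrightarrow> f x \<in> Omega s" "\<And>t. s \<le> t \<Longrightarrow> t \<le> r \<Longrightarrow> (\<lambda>x. f x t) \<in> borel_measurable M"
  shows "f \<in> measurable M (F_sr s r)"
  unfolding F_sr_def
proof (rule measurable_measure_of)
  fix y assume "y \<in> {{w \<in> Omega s. w \<tau> \<in> B} | \<tau> B. s \<le> \<tau> \<and> \<tau> \<le> r \<and> B \<in> sets (borel :: (real^2) measure)}"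
  then obtain \<tau> B where y: "y = {w \<in> Omega s. w \<tau> \<in> B}" "s \<le> \<tau>" "\<tau> \<le> r" "B \<in> sets borel" by auto
  have "f -` y \<inter> space M = (\<lambda>x. f x \<tau>) -` B \<inter> space M" using assms(1) y by auto
  then show "f -` y \<inter> space M \<in> sets M" using assms(2)[OF y(2,3)] y(4) by (simp add: measurable_sets)
qed (use assms(1) in auto)

text \<open>The generators involve the time s alone, and preimages under the initial position are
  already closed under complements and countable unions. This reduces r = s to the disintegration
  identity.\<close>

lemma sets_F_sr_initial:
  assumes "G \<in> sets (F_sr s s)" shows "\<exists>B\<in>sets borel. G = {w \<in> Omega s. w s \<in> B}"
  using assms unfolding sets_F_sr
proof (induction rule: sigma_sets.induct)
  case (Basic a)
  then obtain \<tau> B where "a = {w \<in> Omega s. w \<tau> \<in> B}" "s \<le> \<tau>" "\<tau> \<le> s" "B \<in> sets borel" by auto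
  then show ?case by (intro bexI[of _ B]) (auto dest: antisym)
next
  case Empty
  show ?case by (rule bexI[of _ "{}"]) auto
next
  case (Compl a)
  then obtain B where "B \<in> sets borel" "a = {w \<in> Omega s. w s \<in> B}" by blast
  then show ?case by (intro bexI[of _ "- B"]) auto
next
  case (Union a)
  have "\<forall>i. \<exists>B. B \<in> sets borel \<and> a i = {w \<in> Omega s. w s \<in> B}" using Union.IH by blast
  from choice[OF this] obtain B where "\<forall>i. B i \<in> sets borel \<and> a i = {w \<in> Omega s. w s \<in> B i}" by blast
  then show ?case by (intro bexI[of _ "\<Union>i. B i"]) auto
qed

lemma rcp_kernelD:
  assumes "rcp_kernel Q r p"
  shows "prob_space (p y)" "sets (p y) = sets (Omega_space r)"
    "B \<in> sets (Omega_space r) \<Longrightarrow> (\<lambda>y. emeasure (p y) B) \<in> borel_measurable borel"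
    "B \<in> sets (Omega_space r) \<Longrightarrow> A \<in> sets borel \<Longrightarrow> emeasure Q (B \<inter> {w \<in> Omega r. w r \<in> A}) =
        (\<integral>\<^sup>+ y. indicator A y * emeasure (p y) B \<partial>(distr Q borel (\<lambda>w. w r)))"
proof -
  note k = assms[unfolded rcp_kernel_def]
  show "prob_space (p y)" "sets (p y) = sets (Omega_space r)" using k[THEN conjunct1] by auto
  show "B \<in> sets (Omega_space r) \<Longrightarrow> (\<lambda>y. emeasure (p y) B) \<in> borel_measurable borel"
    using k[THEN conjunct2, THEN conjunct2, THEN conjunct1] by blast
  show "B \<in> sets (Omega_space r) \<Longrightarrow> A \<in> sets borel \<Longrightarrow> emeasure Q (B \<inter> {w \<in> Omega r. w r \<in> A}) =
        (\<integral>\<^sup>+ y. indicator A y * emeasure (p y) B \<partial>(distr Q borel (\<lambda>w. w r)))"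
    using k[THEN conjunct2, THEN conjunct2, THEN conjunct2] by blast
qed

lemma coord_set_Omega: "r \<le> t \<Longrightarrow> A \<in> sets borel \<Longrightarrow> {w \<in> Omega r. w t \<in> A} \<in> sets (Omega_space r)"
  using measurable_sets[OF measurable_Omega_coord, of r t A] by (simp add: vimage_def Int_def conj_commute)

text \<open>The kernel term is a function of \<open>w r\<close>, hence measurable for the past; a
  conditional expectation is then identified by its integrals over events of the past, which is
  \<open>eq\<close>.\<close>

lemma cond_exp_eq_kernel:
  assumes P: "prob_space P" "sets P = sets (Omega_space s)" and p: "rcp_kernel Q r p"
    and st: "s \<le> r" "r \<le> t" and A: "A \<in> sets borel"
    and eq: "\<And>G. G \<in> sets (F_sr s r) \<Longrightarrow> emeasure P (G \<inter> {w \<in> Omega s. w t \<in> A}) =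
       (\<integral>\<^sup>+w. indicator G w * emeasure (p (w r)) {w' \<in> Omega r. w' t \<in> A} \<partial>P)"
  shows "AE w in P. real_cond_exp P (F_sr s r) (indicator {w' \<in> Omega s. w' t \<in> A}) w =
              measure (p (w r)) {w' \<in> Omega r. w' t \<in> A}"
proof -
  interpret prob_space P by fact
  have spP: "space P = Omega s" using sets_eq_imp_space_eq[OF P(2)] by simp
  have sub: "subalgebra P (F_sr s r)" using sets_F_sr_subset[of s r] P(2) spP by (simp add: subalgebra_def)
  interpret finite_measure_subalgebra P "F_sr s r" by unfold_locales (rule sub)
  let ?T = "{w \<in> Omega s. w t \<in> A}" and ?B = "{w' \<in> Omega r. w' t \<in> A}"
  have B: "?B \<in> sets (Omega_space r)" using st A by (intro coord_set_Omega) auto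
  have T[measurable]: "?T \<in> sets P" using st A P(2) by (simp add: coord_set_Omega)
  let ?g = "\<lambda>w. measure (p (w r)) ?B"
  have [measurable]: "(\<lambda>y. emeasure (p y) ?B) \<in> borel_measurable borel" by (rule rcp_kernelD(3)[OF p B])
  have [measurable]: "(\<lambda>w. w r) \<in> borel_measurable (F_sr s r)" using st by (intro measurable_F_sr_coord) auto
  have gF: "?g \<in> borel_measurable (F_sr s r)" unfolding measure_def by measurable
  have gP[measurable]: "?g \<in> borel_measurable P" using measurable_from_subalg[OF sub gF] .
  have g1: "0 \<le> ?g w" "?g w \<le> 1" for w using prob_space.prob_le_1[OF rcp_kernelD(1)[OF p]] by auto
  have ge: "ennreal (?g w) = emeasure (p (w r)) ?B" for w
    using finite_measure.emeasure_eq_measure[OF prob_space.finite_measure[OF rcp_kernelD(1)[OF p]]] by simp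
  show ?thesis
  proof (rule real_cond_exp_charact)
    show "integrable P (indicat_real ?T)" by (rule integrable_const_bound[of _ 1]) auto
    show "integrable P ?g" using g1 by (intro integrable_const_bound[of _ 1]) auto
    show "?g \<in> borel_measurable (F_sr s r)" by (rule gF)
    fix G assume G: "G \<in> sets (F_sr s r)"
    have GP[measurable]: "G \<in> sets P" using G sub by (auto simp: subalgebra_def)
    have "(\<integral>w\<in>G. indicat_real ?T w \<partial>P) = (\<integral>w. indicat_real (G \<inter> ?T) w \<partial>P)"
      unfolding set_lebesgue_integral_def by (rule Bochner_Integration.integral_cong) (auto simp: indicator_def)
    also have "\<dots> = measure P (G \<inter> ?T)"
      using sets.sets_into_space[OF GP] by (subst Bochner_Integration.integral_indicator) (auto intro!: arg_cong[where f="measure P"])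
    also have "\<dots> = enn2real (\<integral>\<^sup>+w. ennreal (indicator G w * ?g w) \<partial>P)"
      unfolding measure_def[of P] eq[OF G]
      by (intro arg_cong[where f=enn2real] nn_integral_cong) (auto simp: ge indicator_def)
    also have "\<dots> = (\<integral>w. indicator G w * ?g w \<partial>P)"
      using g1 by (intro integral_eq_nn_integral[symmetric]) auto
    also have "\<dots> = (\<integral>w\<in>G. ?g w \<partial>P)" unfolding set_lebesgue_integral_def by simp
    finally show "(\<integral>w\<in>G. indicat_real ?T w \<partial>P) = (\<integral>w\<in>G. ?g w \<partial>P)" .
  qed
qed

text \<open>Extends the disintegration identity from indicators of the starting point to weights
  \<open>h\<close>, by showing that two measures on the plane coincide.\<close>

lemma rcp_kernel_weighted:
  assumes Q: "sets Q = sets (Omega_space r)" and p: "rcp_kernel Q r p" and B: "B \<in> sets (Omega_space r)"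
    and [measurable]: "h \<in> borel_measurable borel"
  shows "(\<integral>\<^sup>+w. h (w r) * indicator B w \<partial>Q) = (\<integral>\<^sup>+y. h y * emeasure (p y) B \<partial>distr Q borel (\<lambda>w. w r))"
proof -
  have spQ: "space Q = Omega r" using sets_eq_imp_space_eq[OF Q] by simp
  have [measurable]: "B \<in> sets Q" using B Q by simp
  have c[measurable]: "(\<lambda>w. w r) \<in> borel_measurable Q"
    using measurable_Omega_coord[OF order_refl] Q by (simp cong: measurable_cong_sets)
  note [measurable] = rcp_kernelD(3)[OF p B]
  have eq: "distr (density Q (indicator B)) borel (\<lambda>w. w r) = density (distr Q borel (\<lambda>w. w r)) (\<lambda>y. emeasure (p y) B)"
  proof (rule measure_eqI)
    fix A assume "A \<in> sets (distr (density Q (indicator B)) borel (\<lambda>w. w r))"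
    then have A[measurable]: "A \<in> sets borel" by simp
    have "emeasure (distr (density Q (indicator B)) borel (\<lambda>w. w r)) A = emeasure (density Q (indicator B)) ((\<lambda>w. w r) -` A \<inter> space Q)"
      by (subst emeasure_distr) auto
    also have "\<dots> = (\<integral>\<^sup>+w. indicator B w * indicator ((\<lambda>w. w r) -` A \<inter> space Q) w \<partial>Q)"
      by (rule emeasure_density) auto
    also have "\<dots> = (\<integral>\<^sup>+w. indicator (B \<inter> {w \<in> Omega r. w r \<in> A}) w \<partial>Q)"
      by (rule nn_integral_cong) (auto simp: indicator_def spQ)
    also have "\<dots> = emeasure Q (B \<inter> {w \<in> Omega r. w r \<in> A})"
      using B Q A by (intro nn_integral_indicator sets.Int) (auto simp: coord_set_Omega)
    also have "\<dots> = (\<integral>\<^sup>+ y. indicator A y * emeasure (p y) B \<partial>(distr Q borel (\<lambda>w. w r)))"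
      by (rule rcp_kernelD(4)[OF p B A])
    also have "\<dots> = emeasure (density (distr Q borel (\<lambda>w. w r)) (\<lambda>y. emeasure (p y) B)) A"
      by (subst emeasure_density) (auto intro!: nn_integral_cong simp: mult.commute)
    finally show "emeasure (distr (density Q (indicator B)) borel (\<lambda>w. w r)) A = emeasure (density (distr Q borel (\<lambda>w. w r)) (\<lambda>y. emeasure (p y) B)) A" .
  qed simp
  have "(\<integral>\<^sup>+w. h (w r) * indicator B w \<partial>Q) = (\<integral>\<^sup>+w. h (w r) \<partial>density Q (indicator B))"
    by (subst nn_integral_density) (auto intro!: nn_integral_cong simp: mult.commute)
  also have "\<dots> = (\<integral>\<^sup>+y. h y \<partial>distr (density Q (indicator B)) borel (\<lambda>w. w r))"
    by (rule nn_integral_distr[symmetric]) auto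
  also have "\<dots> = (\<integral>\<^sup>+y. h y * emeasure (p y) B \<partial>distr Q borel (\<lambda>w. w r))"
    unfolding eq by (subst nn_integral_density) (auto intro!: nn_integral_cong simp: mult.commute)
  finally show ?thesis .
qed

context sde
begin

lemma path_of_in_Omega:
  assumes "\<omega> \<in> space M" shows "path_of s X \<omega> \<in> Omega s"
proof -
  have "continuous_on {s..} (path_of s X \<omega>)"
    using X_cont[OF assms] by (rule continuous_on_cong[THEN iffD1, rotated 2]) (auto simp: path_of_def)
  then show ?thesis by (auto simp: Omega_def path_of_def)
qed

lemma path_of_at: "s \<le> t \<Longrightarrow> path_of s X \<omega> t = X t \<omega>"
  by (simp add: path_of_def)

lemma measurable_path_of: "path_of s X \<in> measurable M (Omega_space s)"
  by (rule measurable_into_Omega) (auto simp: path_of_in_Omega path_of_at X_measurable)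

lemma measurable_path_of_F_sr:
  assumes "s \<le> r" shows "path_of s X \<in> measurable (Fl r) (F_sr s r)"
proof (rule measurable_into_F_sr)
  show "path_of s X \<omega> \<in> Omega s" if "\<omega> \<in> space (Fl r)" for \<omega>
    using that space_Fl[OF assms] by (simp add: path_of_in_Omega)
  show "(\<lambda>\<omega>. path_of s X \<omega> t) \<in> borel_measurable (Fl r)" if "s \<le> t" "t \<le> r" for t
    using Fl_measurable_mono[OF that X_adapted[OF that(1)]] that by (simp add: path_of_at)
qed

lemma path_law:
  defines "P \<equiv> distr M (Omega_space s) (path_of s X)"
  shows "prob_space P" "sets P = sets (Omega_space s)" "s \<le> t \<Longrightarrow> distr P borel (\<lambda>w. w t) = \<mu> t"
proof -
  show "prob_space P" unfolding P_def by (rule prob_space_distr[OF measurable_path_of])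
  show "sets P = sets (Omega_space s)" by (simp add: P_def)
  show "distr P borel (\<lambda>w. w t) = \<mu> t" if "s \<le> t"
    unfolding P_def using that
    by (subst distr_distr[OF measurable_Omega_coord measurable_path_of])
       (auto simp: o_def path_of_at lawX)
qed

end

text \<open>\<open>G\<close> weights the first solution. The weighted law at r has a density f with
  respect to the law at r, the conditional probability of \<open>G\<close> given the position.
  Weighting the restarted solution by f of its starting point gives the same law at r, hence at t,
  and there the kernel is available.\<close>

lemma markov_identity:
  assumes S1: "sde \<nu> s \<mu>1 M1 Fl1 W1 X1 \<beta>1" and S2: "sde \<nu> r \<mu>2 M2 Fl2 W2 X2 \<beta>2" and r: "s < r" "r \<le> t"
    and flow: "\<And>t. r \<le> t \<Longrightarrow> \<mu>1 t = \<mu>2 t"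
    and p: "rcp_kernel (distr M2 (Omega_space r) (path_of r X2)) r p"
    and A: "A \<in> sets borel" and G: "G \<in> sets (F_sr s r)"
  shows "emeasure (distr M1 (Omega_space s) (path_of s X1)) (G \<inter> {w \<in> Omega s. w t \<in> A}) =
       (\<integral>\<^sup>+w. indicator G w * emeasure (p (w r)) {w' \<in> Omega r. w' t \<in> A} \<partial>distr M1 (Omega_space s) (path_of s X1))"
proof -
  interpret S1: sde \<nu> s \<mu>1 M1 Fl1 W1 X1 \<beta>1 by fact
  interpret S2: sde \<nu> r \<mu>2 M2 Fl2 W2 X2 \<beta>2 by fact
  let ?P = "distr M1 (Omega_space s) (path_of s X1)" and ?Q = "distr M2 (Omega_space r) (path_of r X2)"
  let ?B = "{w' \<in> Omega r. w' t \<in> A}"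
  note [measurable] = A
  have B: "?B \<in> sets (Omega_space r)" using r by (intro coord_set_Omega) auto
  have GO: "G \<in> sets (Omega_space s)" using G sets_F_sr_subset by blast
  note [measurable] = rcp_kernelD(3)[OF p B]
  have [measurable]: "X1 r \<in> borel_measurable M1" "X1 t \<in> borel_measurable M1" "X2 r \<in> borel_measurable M2" "X2 t \<in> borel_measurable M2"
    using r by (auto intro: S1.X_measurable S2.X_measurable)
  note [measurable] = S1.measurable_path_of S2.measurable_path_of
  define \<rho>1 where "\<rho>1 \<omega> = indicat_real G (path_of s X1 \<omega>)" for \<omega>
  have \<rho>1F: "\<rho>1 \<in> borel_measurable (Fl1 r)"
    unfolding \<rho>1_def
    by (rule measurable_compose[OF S1.measurable_path_of_F_sr]) (use r G in auto)
  have \<rho>1[measurable]: "\<rho>1 \<in> borel_measurable M1" using S1.Fl_measurable[OF _ \<rho>1F] r by simp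
  have \<rho>101: "0 \<le> \<rho>1 \<omega>" "\<rho>1 \<omega> \<le> 1" for \<omega> by (auto simp: \<rho>1_def indicator_le_1)
  let ?n1 = "\<lambda>t. distr (density M1 (\<lambda>\<omega>. ennreal (\<rho>1 \<omega>))) borel (X1 t)"
  have lawr: "distr M1 borel (X1 r) = distr M2 borel (X2 r)"
    using S1.lawX[of r] S2.lawX[of r] flow[of r] r by simp
  let ?m = "distr M2 borel (X2 r)"
  interpret m: prob_space ?m by (rule S2.prob_space_distr) measurable
  note fw = finite_weighted_law[OF S1.prob \<rho>1 \<open>X1 r \<in> borel_measurable M1\<close> \<rho>101]
  have "\<exists>f. f \<in> borel_measurable ?m \<and> (\<forall>x. 0 \<le> f x) \<and> (\<forall>x. f x \<le> (1::real)) \<and> ?n1 r = density ?m (\<lambda>x. ennreal (f x))"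
    using fw(5) by (intro bounded_Radon_Nikodym m.finite_measure_axioms) (auto simp: lawr)
  then obtain f where f: "f \<in> borel_measurable borel" "\<And>x. 0 \<le> f x" "\<And>x. f x \<le> (1::real)" "?n1 r = density ?m (\<lambda>x. ennreal (f x))"
    by auto
  note [measurable] = f(1)
  define \<rho>2 where "\<rho>2 \<omega> = f (X2 r \<omega>)" for \<omega>
  have \<rho>2F: "\<rho>2 \<in> borel_measurable (Fl2 r)"
    unfolding \<rho>2_def by (rule measurable_compose[OF S2.X_adapted[OF order_refl] f(1)])
  have \<rho>2[measurable]: "\<rho>2 \<in> borel_measurable M2" using S2.Fl_measurable[OF _ \<rho>2F] by simp
  have \<rho>201: "0 \<le> \<rho>2 \<omega>" "\<rho>2 \<omega> \<le> 1" for \<omega> by (auto simp: \<rho>2_def f)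
  let ?n2 = "\<lambda>t. distr (density M2 (\<lambda>\<omega>. ennreal (\<rho>2 \<omega>))) borel (X2 t)"
  have init: "?n1 r = ?n2 r"
  proof (rule measure_eqI)
    fix C assume "C \<in> sets (?n1 r)"
    then have C[measurable]: "C \<in> sets borel" by simp
    have "emeasure (?n2 r) C = (\<integral>\<^sup>+\<omega>. ennreal (\<rho>2 \<omega>) * indicator C (X2 r \<omega>) \<partial>M2)"
      by (rule finite_weighted_law(4)[OF S2.prob \<rho>2 \<open>X2 r \<in> borel_measurable M2\<close> \<rho>201 C])
    also have "\<dots> = (\<integral>\<^sup>+y. ennreal (f y) * indicator C y \<partial>?m)"
      unfolding \<rho>2_def by (subst nn_integral_distr) auto
    also have "\<dots> = emeasure (?n1 r) C" unfolding f(4) by (subst emeasure_density) auto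
    finally show "emeasure (?n1 r) C = emeasure (?n2 r) C" ..
  qed simp
  \<comment> \<open>Equality of one-time laws is enough, since the target event concerns the
    position at t alone.\<close>
  have agree: "?n1 t = ?n2 t"
    by (rule weighted_laws_agree[OF S1 S2 r(1) flow \<rho>1F \<rho>101 \<rho>2F \<rho>201 init r(2)])
  have "emeasure ?P (G \<inter> {w \<in> Omega s. w t \<in> A}) = (\<integral>\<^sup>+w. indicator (G \<inter> {w \<in> Omega s. w t \<in> A}) w \<partial>?P)"
    using GO r coord_set_Omega[of s t A] A by (intro nn_integral_indicator[symmetric]) auto
  also have "\<dots> = (\<integral>\<^sup>+\<omega>. indicator (G \<inter> {w \<in> Omega s. w t \<in> A}) (path_of s X1 \<omega>) \<partial>M1)"
    using GO r coord_set_Omega[of s t A] A by (intro nn_integral_distr S1.measurable_path_of) auto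
  also have "\<dots> = (\<integral>\<^sup>+\<omega>. ennreal (\<rho>1 \<omega>) * indicator A (X1 t \<omega>) \<partial>M1)"
    using r by (intro nn_integral_cong) (auto simp: \<rho>1_def indicator_def S1.path_of_at S1.path_of_in_Omega)
  also have "\<dots> = emeasure (?n1 t) A"
    by (rule finite_weighted_law(4)[OF S1.prob \<rho>1 \<open>X1 t \<in> borel_measurable M1\<close> \<rho>101 A, symmetric])
  also have "\<dots> = (\<integral>\<^sup>+\<omega>. ennreal (\<rho>2 \<omega>) * indicator A (X2 t \<omega>) \<partial>M2)"
    unfolding agree by (rule finite_weighted_law(4)[OF S2.prob \<rho>2 \<open>X2 t \<in> borel_measurable M2\<close> \<rho>201 A])
  also have "\<dots> = (\<integral>\<^sup>+\<omega>. ennreal (f (path_of r X2 \<omega> r)) * indicator ?B (path_of r X2 \<omega>) \<partial>M2)"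
    using r by (intro nn_integral_cong) (auto simp: \<rho>2_def indicator_def S2.path_of_at S2.path_of_in_Omega)
  also have "\<dots> = (\<integral>\<^sup>+w. ennreal (f (w r)) * indicator ?B w \<partial>?Q)"
  proof (rule nn_integral_distr[symmetric, OF S2.measurable_path_of])
    have [measurable]: "(\<lambda>w. w r) \<in> borel_measurable (Omega_space r)" by (rule measurable_Omega_coord) simp
    have [measurable]: "?B \<in> sets (Omega_space r)" by (rule B)
    have "(\<lambda>w. ennreal (f (w r)) * indicator ?B w) \<in> borel_measurable (Omega_space r)"
      by (intro borel_measurable_times_ennreal borel_measurable_indicator B) measurable
    then show "(\<lambda>w. ennreal (f (w r)) * indicator ?B w) \<in> borel_measurable ?Q" by simp
  qed
  also have "\<dots> = (\<integral>\<^sup>+y. ennreal (f y) * emeasure (p y) ?B \<partial>distr ?Q borel (\<lambda>w. w r))"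
    by (rule rcp_kernel_weighted[OF _ p B]) auto
  also have "distr ?Q borel (\<lambda>w. w r) = ?m"
    using S2.path_law(3)[of r] S2.lawX[of r] by simp
  \<comment> \<open>The way back: f times the law at r is the weighted law of the first solution, so
    the kernel is now integrated over \<open>X1 r\<close> on the event \<open>G\<close>.\<close>
  also have "(\<integral>\<^sup>+y. ennreal (f y) * emeasure (p y) ?B \<partial>?m) = (\<integral>\<^sup>+y. emeasure (p y) ?B \<partial>?n1 r)"
    unfolding f(4) by (subst nn_integral_density) auto
  also have "\<dots> = (\<integral>\<^sup>+\<omega>. emeasure (p (X1 r \<omega>)) ?B \<partial>density M1 (\<lambda>\<omega>. ennreal (\<rho>1 \<omega>)))"
    by (rule nn_integral_distr) auto
  also have "\<dots> = (\<integral>\<^sup>+\<omega>. ennreal (\<rho>1 \<omega>) * emeasure (p (X1 r \<omega>)) ?B \<partial>M1)"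
    by (rule nn_integral_density) auto
  also have "\<dots> = (\<integral>\<^sup>+\<omega>. indicator G (path_of s X1 \<omega>) * emeasure (p (path_of s X1 \<omega> r)) ?B \<partial>M1)"
    using r by (intro nn_integral_cong) (auto simp: \<rho>1_def indicator_def S1.path_of_at)
  also have "\<dots> = (\<integral>\<^sup>+w. indicator G w * emeasure (p (w r)) ?B \<partial>?P)"
  proof (rule nn_integral_distr[symmetric, OF S1.measurable_path_of])
    have [measurable]: "(\<lambda>w. w r) \<in> borel_measurable (Omega_space s)" using r by (intro measurable_Omega_coord) simp
    have [measurable]: "(\<lambda>w. emeasure (p (w r)) ?B) \<in> borel_measurable (Omega_space s)" by measurable
    have "(\<lambda>w. indicator G w * emeasure (p (w r)) ?B) \<in> borel_measurable (Omega_space s)"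
      by (intro borel_measurable_times_ennreal borel_measurable_indicator GO) measurable
    then show "(\<lambda>w. indicator G w * emeasure (p (w r)) ?B) \<in> borel_measurable ?P" by simp
  qed
  finally show ?thesis .
qed

lemma markov_identity_initial:
  assumes P: "sets P = sets (Omega_space s)" and p: "rcp_kernel P s p" and t: "s \<le> t"
    and A: "A \<in> sets borel" and G: "G \<in> sets (F_sr s s)"
  shows "emeasure P (G \<inter> {w \<in> Omega s. w t \<in> A}) =
       (\<integral>\<^sup>+w. indicator G w * emeasure (p (w s)) {w' \<in> Omega s. w' t \<in> A} \<partial>P)"
proof -
  let ?B = "{w' \<in> Omega s. w' t \<in> A}"
  have B: "?B \<in> sets (Omega_space s)" using t A by (rule coord_set_Omega)
  note [measurable] = rcp_kernelD(3)[OF p B]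
  obtain C where C[measurable]: "C \<in> sets borel" and GC: "G = {w \<in> Omega s. w s \<in> C}" using sets_F_sr_initial[OF G] by blast
  have [measurable]: "(\<lambda>w. w s) \<in> borel_measurable P"
    using measurable_Omega_coord[OF order_refl] P by (simp cong: measurable_cong_sets)
  have "emeasure P (G \<inter> ?B) = emeasure P (?B \<inter> {w \<in> Omega s. w s \<in> C})" unfolding GC by (simp add: Int_commute)
  also have "\<dots> = (\<integral>\<^sup>+ y. indicator C y * emeasure (p y) ?B \<partial>(distr P borel (\<lambda>w. w s)))"
    by (rule rcp_kernelD(4)[OF p B C])
  also have "\<dots> = (\<integral>\<^sup>+ w. indicator C (w s) * emeasure (p (w s)) ?B \<partial>P)"
    by (rule nn_integral_distr) auto
  also have "\<dots> = (\<integral>\<^sup>+w. indicator G w * emeasure (p (w s)) ?B \<partial>P)"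
    using sets_eq_imp_space_eq[OF P] by (intro nn_integral_cong) (auto simp: GC indicator_def)
  finally show ?thesis .
qed

section \<open>The Markov property for all times, assembled from the cases r = s and r > s\<close>

theorem theorem4p6:
  fixes \<nu> :: real
    and mu :: "real \<Rightarrow> (real^2) measure \<Rightarrow> real \<Rightarrow> (real^2) measure"
    and Pl :: "real \<Rightarrow> (real^2) measure \<Rightarrow> (real \<Rightarrow> real^2) measure"
  assumes nu_pos: "\<nu> > 0"
    and vort: "\<And>s \<zeta>. 0 \<le> s \<Longrightarrow> \<zeta> \<in> Prob2 \<Longrightarrow> vorticity_solution \<nu> s \<zeta> (mu s \<zeta>)"
    and law: "\<And>s \<zeta>. 0 \<le> s \<Longrightarrow> \<zeta> \<in> Prob2 \<Longrightarrow>
       \<exists>(M :: 'a measure) Fl W X. weak_solution \<nu> s (mu s \<zeta>) M Fl W X \<and>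
          (\<forall>t\<ge>s. distr M borel (X t) = mu s \<zeta> t) \<and>
          Pl s \<zeta> = distr M (Omega_space s) (path_of s X)"
  shows "nonlinear_markov Pl Prob2"
proof -
  have data: "\<exists>(M :: 'a measure) Fl W X \<beta>. sde \<nu> s (mu s \<zeta>) M Fl W X \<beta> \<and> Pl s \<zeta> = distr M (Omega_space s) (path_of s X)"
    if sz: "0 \<le> s" "\<zeta> \<in> Prob2" for s \<zeta>
  proof -
    obtain M :: "'a measure" and Fl W X where w: "weak_solution \<nu> s (mu s \<zeta>) M Fl W X"
      "\<forall>t\<ge>s. distr M borel (X t) = mu s \<zeta> t" "Pl s \<zeta> = distr M (Omega_space s) (path_of s X)"
      using law[OF sz] by blast
    obtain \<beta> where "sde \<nu> s (mu s \<zeta>) M Fl W X \<beta>"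
      using sde_of_vorticity[OF nu_pos vort[OF sz] w(1)] w(2) by blast
    then show ?thesis using w(3) by blast
  qed
  have Pl: "prob_space (Pl s \<zeta>)" "sets (Pl s \<zeta>) = sets (Omega_space s)" "\<And>t. s \<le> t \<Longrightarrow> marg Pl s \<zeta> t = mu s \<zeta> t"
    if sz: "0 \<le> s" "\<zeta> \<in> Prob2" for s \<zeta>
  proof -
    obtain M :: "'a measure" and Fl W X \<beta> where S: "sde \<nu> s (mu s \<zeta>) M Fl W X \<beta>" and P: "Pl s \<zeta> = distr M (Omega_space s) (path_of s X)"
      using data[OF sz] by blast
    show "prob_space (Pl s \<zeta>)" "sets (Pl s \<zeta>) = sets (Omega_space s)" "\<And>t. s \<le> t \<Longrightarrow> marg Pl s \<zeta> t = mu s \<zeta> t"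
      unfolding marg_def P using sde.path_law[OF S] by auto
  qed
  have marg2: "marg Pl s \<zeta> t \<in> Prob2" if "0 \<le> s" "s \<le> t" "\<zeta> \<in> Prob2" for s t \<zeta>
    using Pl(3)[of s \<zeta> t] vorticity_prob[OF vort[of s \<zeta>], of t] that by simp
  show ?thesis
    unfolding nonlinear_markov_def
  proof (intro conjI allI impI ballI)
    show "Prob2 \<subseteq> Prob2" by simp
    show "prob_space (Pl s \<zeta>)" "sets (Pl s \<zeta>) = sets (Omega_space s)" if "0 \<le> s" "\<zeta> \<in> Prob2" for s \<zeta>
      using Pl[OF that] by auto
    show "marg Pl s \<zeta> t \<in> Prob2" if "0 \<le> s \<and> s \<le> t \<and> \<zeta> \<in> Prob2" for s t \<zeta> using marg2 that by blast
    fix s r t :: real and \<zeta> and A :: "(real^2) set"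
    assume h: "0 \<le> s \<and> s \<le> r \<and> r \<le> t \<and> \<zeta> \<in> Prob2 \<and> A \<in> sets borel"
    define \<zeta>' where "\<zeta>' = marg Pl s \<zeta> r"
    have z': "\<zeta>' \<in> Prob2" "0 \<le> r" using h marg2 by (auto simp: \<zeta>'_def)
    show "\<exists>p. rcp_kernel (Pl r (marg Pl s \<zeta> r)) r p"
      unfolding \<zeta>'_def[symmetric] using Pl(1,2)[OF z'(2,1)] by (rule rcp_kernel_exists)
    fix p assume p: "rcp_kernel (Pl r (marg Pl s \<zeta> r)) r p"
    show "AE w in Pl s \<zeta>. real_cond_exp (Pl s \<zeta>) (F_sr s r) (indicator {w' \<in> Omega s. w' t \<in> A}) w =
              measure (p (w r)) {w' \<in> Omega r. w' t \<in> A}"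
    proof (rule cond_exp_eq_kernel[OF Pl(1,2) p])
      fix G assume G: "G \<in> sets (F_sr s r)"
      show "emeasure (Pl s \<zeta>) (G \<inter> {w \<in> Omega s. w t \<in> A}) =
         (\<integral>\<^sup>+w. indicator G w * emeasure (p (w r)) {w' \<in> Omega r. w' t \<in> A} \<partial>Pl s \<zeta>)"
      proof (cases "r = s")
        case True
        \<comment> \<open>For r = s the kernel thus disintegrates \<open>Pl s \<zeta>\<close>
          itself.\<close>
        have "marg Pl s \<zeta> s = \<zeta>" using Pl(3)[of s \<zeta> s] vorticity_init[OF vort[of s \<zeta>]] h by simp
        then show ?thesis using markov_identity_initial[of "Pl s \<zeta>" s p t A G] Pl(2)[of s \<zeta>] p G h True by simp
      next
        case False
        then have sr: "s < r" using h by simp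
        obtain M1 :: "'a measure" and Fl1 W1 X1 \<beta>1 where S1: "sde \<nu> s (mu s \<zeta>) M1 Fl1 W1 X1 \<beta>1"
          and P1: "Pl s \<zeta> = distr M1 (Omega_space s) (path_of s X1)"
          using data[of s \<zeta>] h by blast
        obtain M2 :: "'a measure" and Fl2 W2 X2 \<beta>2 where S2: "sde \<nu> r (mu r \<zeta>') M2 Fl2 W2 X2 \<beta>2"
          and P2: "Pl r \<zeta>' = distr M2 (Omega_space r) (path_of r X2)"
          using data[OF z'(2,1)] by blast
        have v1: "vorticity_solution \<nu> s \<zeta> (mu s \<zeta>)" and v2: "vorticity_solution \<nu> r \<zeta>' (mu r \<zeta>')"
          using vort h z' by auto
        \<comment> \<open>The restarted curve begins at the law reached at time r; through this law
          the kernel depends on the pair of \<open>s\<close> and \<open>\<zeta>\<close>, which is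
          the nonlinearity of the process.\<close>
        have init: "mu r \<zeta>' r = mu s \<zeta> r"
          using vorticity_init[OF v2] Pl(3)[of s \<zeta> r] h by (simp add: \<zeta>'_def)
        have flow: "mu s \<zeta> t = mu r \<zeta>' t" if "r \<le> t" for t
          by (rule vorticity_flow[OF v1 S1 v2 S2 sr init that])
        show ?thesis
          unfolding P1 using h p G
          by (intro markov_identity[OF S1 S2 sr _ flow]) (auto simp: P2[symmetric] \<zeta>'_def)
      qed
    qed (use h in auto)
  qed
qed

end
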